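(* Let $r_M>0$ and let $r:(0,\infty)\times[0,r_M]\to\mathbb{R}$ satisfy $0\le r(x,I)\le r_M$ for all $x>0$, $I\in[0,r_M]$, $\frac{\partial r}{\partial I}\in L^\infty((0,\infty)\times(0,r_M))$ and $\frac{\partial r}{\partial I}\le 0$. With $R(x,I)=\int_0^x r(y,I)\,dy$, assume $\int_0^\infty e^{-R(x,r_M)}dx<\infty$ and $\sup_{I\in(0,r_M)}\int_0^\infty|\partial_IR(x,I)|e^{-R(x,I)}dx<\infty$, and let $(\overline n,\overline I)$ be the unique mass $1$ stationary state. Let $n_{\rm ini}\in L^1(0,\infty)$, $n_{\rm ini}\ge0$, $\int_0^\infty n_{\rm ini}\,dx=1$, and let $n(t,x)$ be the solution of $$\begin{cases}\partial_t n(t,x)+\partial_x n(t,x)+r(x,I(t))\,n(t,x)=0, & t,x\ge 0,\\ I(t)=\int_0^\infty r(x,I(t))\,n(t,x)\,dx,\\ n(t,x=0)=I(t),\\ n(t=0)=n_{\rm ini}.\end{cases}$$ (i) If there is $r_0>0$ with $r(x,I)\ge r_0$ for all $x\ge0$, $I\in[0,r_M]$, then for all $t\ge0$ $$\|n(t)-\overline n\|_1\le e^{-r_0t}\|n_{\rm ini}-\overline n\|_1.$$ (ii) If there is an $x_*\in\mathrm{Int}\big(\mathrm{supp}(r(\cdot,\overline I))\big)$ such that the function $I\mapsto r(x_*,I)$ is strictly decreasing for $I\in[0,r_M]$, then $$\lim_{t\to\infty}\|n(t)-\overline n\|_1=0.$$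
   Context: Notation: $\|u\|_1=\int_0^\infty|u(x)|\,dx$; $\mathrm{Int}$ is the interior. A solution is a pair $(n,I)$ with $n\in C([0,\infty);L^1(0,\infty))$, $n\ge0$, $\int_0^\infty n(t,x)\,dx=1$ and $I:[0,\infty)\to[0,r_M]$ continuous, $I(t)=\int_0^\infty r(x,I(t))n(t,x)dx$, the transport equation being understood in the weak sense, i.e. by characteristics: $n(t,x)=n_{\rm ini}(x-t)\exp(-\int_0^t r(x-t+s,I(s))ds)$ for $x\ge t$ and $n(t,x)=I(t-x)\exp(-\int_0^x r(s,I(t-x+s))ds)$ for $x<t$. The unique mass $1$ stationary state is $\overline n(x)=\overline I e^{-R(x,\overline I)}$, where $\overline I\in[0,r_M]$ is the unique solution of $\overline I=\big(\int_0^\infty e^{-R(x,\overline I)}dx\big)^{-1}$. *)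

theory Defs
  imports "HOL-Analysis.Analysis"
begin

text \<open>
  Functions on (0,\<infinity>), (0,\<infinity>) \<times> [0,rM] and [0,\<infinity>) \<times> (0,\<infinity>) are represented by total functions on the
  reals; values outside these sets are never used. Elements of Lebesgue spaces are represented by
  Lebesgue measurable functions, and equations between them are required almost everywhere only.
\<close>

definition L1_norm :: "(real \<Rightarrow> real) \<Rightarrow> real" where
  "L1_norm u = (LINT x:{0<..}|lebesgue. \<bar>u x\<bar>)"

definition cumulative_rate :: "(real \<Rightarrow> real \<Rightarrow> real) \<Rightarrow> real \<Rightarrow> real \<Rightarrow> real" where
  "cumulative_rate r x I = (LINT y:{0<..<x}|lebesgue. r y I)"

text \<open>
  The function df is a version of the partial derivative of f with respect to its second variable I
  on (0,\<infinity>) \<times> (0,rM). As derivatives are only assumed to be L\<infinity> functions, the derivative is meant in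
  the Sobolev sense: for almost every x the function f x is absolutely continuous on [0,rM], with
  derivative df x. Functions that are continuous on [0,rM] and differentiable in (0,rM) with
  integrable derivative are included. Changing df on a null set does not affect the property.
\<close>

definition is_partial_I ::
    "real \<Rightarrow> (real \<Rightarrow> real \<Rightarrow> real) \<Rightarrow> (real \<Rightarrow> real \<Rightarrow> real) \<Rightarrow> bool" where
  "is_partial_I rM f df \<longleftrightarrow>
     (\<lambda>p. df (fst p) (snd p)) \<in> borel_measurable (lebesgue_on ({0<..} \<times> {0<..<rM})) \<and>
     (AE x in lebesgue_on {0<..}.
        set_integrable lebesgue {0<..<rM} (df x) \<and>
        (\<forall>a b. 0 \<le> a \<and> a \<le> b \<and> b \<le> rM \<longrightarrow>
           f x b - f x a = (LINT s:{a<..<b}|lebesgue. df x s)))"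

definition stationary_state ::
    "real \<Rightarrow> (real \<Rightarrow> real \<Rightarrow> real) \<Rightarrow> (real \<Rightarrow> real) \<Rightarrow> real \<Rightarrow> bool" where
  "stationary_state rM r nbar Ibar \<longleftrightarrow>
     Ibar \<in> {0..rM} \<and>
     Ibar = inverse (LINT x:{0<..}|lebesgue. exp (- cumulative_rate r x Ibar)) \<and>
     (\<forall>x>0. nbar x = Ibar * exp (- cumulative_rate r x Ibar))"

text \<open>
  Solutions (n, I) with initial datum nini. The transport equation, together with the
  boundary condition n(t,0) = I(t) and the initial condition n(0,x) = nini(x), is understood by
  integration along characteristics.
\<close>

definition age_solution ::
    "real \<Rightarrow> (real \<Rightarrow> real \<Rightarrow> real) \<Rightarrow> (real \<Rightarrow> real) \<Rightarrow> (real \<Rightarrow> real \<Rightarrow> real) \<Rightarrow> (real \<Rightarrow> real) \<Rightarrow> bool"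
  where
  "age_solution rM r nini n I \<longleftrightarrow>
     (\<forall>t\<ge>0. set_integrable lebesgue {0<..} (n t)) \<and>
     (\<forall>t\<ge>0. ((\<lambda>s. L1_norm (\<lambda>x. n s x - n t x)) \<longlongrightarrow> 0) (at t within {0..})) \<and>
     (\<forall>t\<ge>0. AE x in lebesgue_on {0<..}. 0 \<le> n t x) \<and>
     (\<forall>t\<ge>0. (LINT x:{0<..}|lebesgue. n t x) = 1) \<and>
     continuous_on {0..} I \<and>
     (\<forall>t\<ge>0. I t \<in> {0..rM}) \<and>
     (\<forall>t\<ge>0. I t = (LINT x:{0<..}|lebesgue. r x (I t) * n t x)) \<and>
     (\<forall>t\<ge>0. AE x in lebesgue_on {0<..}.
        n t x =
          (if t \<le> x
           then nini (x - t) * exp (- (LINT s:{0<..<t}|lebesgue. r (x - t + s) (I s)))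
           else I (t - x) * exp (- (LINT s:{0<..<x}|lebesgue. r s (I (t - x + s))))))"

end

theory Submission
  imports Defs
begin

text \<open>
  The population is followed along the characteristics \<open>x = y + t\<close>: the label \<open>y > 0\<close> belongs to the
  individuals of age \<open>y\<close> at time 0, the label \<open>y \<le> 0\<close> to those born at time \<open>-y\<close>. If the rate \<open>\<rho>\<close> is
  extended by 0 to nonpositive ages, both kinds obey one formula,
  \<open>w(y,t) = u(y) exp (- \<integral>\<^sub>0\<^sup>t \<rho>(y + s, I(s)) ds)\<close>, where \<open>u\<close> is the initial density on \<open>y > 0\<close> and
  \<open>u(y) = I(-y)\<close> on \<open>y \<le> 0\<close>. The stationary state has this form too, so both claims compare two
  solutions \<open>w\<^sub>1, w\<^sub>2\<close> with birth rates \<open>I\<^sub>1, I\<^sub>2\<close>.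

  Half of their \<open>L\<^sup>1\<close> distance is the excess \<open>1 - \<integral> min(w\<^sub>1,w\<^sub>2)\<close>. Let \<open>m = min(I\<^sub>1,I\<^sub>2)\<close>. As \<open>\<rho>\<close> decreases in
  its second argument, the larger of the two loss rates is \<open>\<rho>(\<cdot>,m)\<close>; so the common part
  \<open>min(w\<^sub>1,w\<^sub>2)\<close> is lost at most at this rate, while it receives births at rate \<open>m\<close>. If \<open>I\<^sub>j\<close> is the
  smaller birth rate, then \<open>m = \<integral> \<rho>(\<cdot>,m) w\<^sub>j\<close>, and therefore the excess decreases at least at the rate
  \<open>\<integral> \<rho>(\<cdot>,m) (w\<^sub>j - min(w\<^sub>1,w\<^sub>2)) \<ge> 0\<close>, its dissipation (lemmas \<open>balance\<close> and \<open>dissipation_lower1\<close>). If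
  \<open>\<rho> \<ge> r\<^sub>0\<close>, the dissipation is at least \<open>r\<^sub>0\<close> times the excess. This is the exponential decay of part (i).

  For part (ii), integrability of \<open>exp(-R(\<cdot>,r\<^sub>M))\<close> forces \<open>\<rho>(\<cdot>,r\<^sub>M)\<close> to be bounded below by a positive
  constant on a set \<open>P\<close> of positive measure, and the monotonicity of the excess makes the dissipation in a
  time window \<open>[t,t+T]\<close> tend to 0 as \<open>t \<rightarrow> \<infinity>\<close>. Let \<open>v\<^sub>i = I\<^sub>i - m\<close>; at each time one of \<open>v\<^sub>1, v\<^sub>2\<close> is 0.
  Individuals that solution \<open>i\<close> has in excess remain in excess, up to the dissipation, until they are lost,
  and each loss is a birth. Hence, up to an error that the dissipation of the window controls,
  \<open>v\<^sub>i(\<tau>) \<ge> k \<integral> 1\<^sub>P(\<tau> - s) v\<^sub>i(s) ds\<close> (lemma \<open>excess_births_renewal\<close>). Inserting this inequality into itself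
  replaces \<open>P\<close> by \<open>P + P\<close>, which contains an interval (Steinhaus), and then by arbitrarily long
  intervals (lemma \<open>renewal_ineq_spreads\<close>). If both \<open>v\<^sub>1\<close> and \<open>v\<^sub>2\<close> had a substantial integral over \<open>[t,t+h]\<close>,
  they would thus be positive simultaneously later on. So the smaller of the two integrals tends to 0
  (lemma \<open>renewal_ineq_min\<close>). But each of them, times a constant, bounds the excess at time \<open>t+h\<close> up to
  the mass of age at least \<open>h\<close> (lemma \<open>excess_le_excess_births\<close>), and this mass is small for large \<open>h\<close>
  and \<open>t\<close> (lemma \<open>old_mass_small\<close>).

  The rate of the theorem is measurable in the age only up to null sets, and regular in its second
  argument for almost every age only. It is first replaced by a version that is jointly Borel
  measurable, and decreasing and Lipschitz in its second argument at every age
  (lemma \<open>borel_decreasing_rate\<close>); no integral along a characteristic notices the change.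
\<close>

section \<open>Integrals over half-open intervals\<close>

lemma set_integrable_lborel_bounded:
  fixes f :: "real \<Rightarrow> real"
  assumes f: "f \<in> borel_measurable borel" and S: "S \<in> sets borel" and fin: "emeasure lborel S < \<infinity>"
    and bd: "\<And>x. x \<in> S \<Longrightarrow> \<bar>f x\<bar> \<le> B"
  shows "set_integrable lborel S f"
  unfolding set_integrable_def
proof (rule integrableI_bounded_set[where A=S and B=B])
  show "S \<in> sets lborel" "emeasure lborel S < \<infinity>"
    "(\<lambda>x. indicator S x *\<^sub>R f x) \<in> borel_measurable lborel"
    using S fin f by (auto intro!: borel_measurable_scaleR borel_measurable_indicator)
qed (use bd in \<open>auto simp: indicator_def\<close>)

lemma set_integrable_Ioc_bounded:
  fixes f :: "real \<Rightarrow> real"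
  assumes "f \<in> borel_measurable borel" and "\<And>x. a < x \<Longrightarrow> x \<le> b \<Longrightarrow> \<bar>f x\<bar> \<le> B"
  shows "set_integrable lborel {a<..b} f"
proof (cases "a \<le> b")
  case True
  then show ?thesis
    by (intro set_integrable_lborel_bounded[OF assms(1), of _ B]) (use assms(2) in auto)
qed (simp add: set_integrable_def)

lemma borel_measurable_set_integral_Ioc [measurable (raw)]:
  fixes f :: "'a \<Rightarrow> real \<Rightarrow> real"
  assumes [measurable]: "(\<lambda>p. f (fst p) (snd p)) \<in> borel_measurable (M \<Otimes>\<^sub>M borel)" "g \<in> borel_measurable M"
  shows "(\<lambda>z. LBINT s:{a<..g z}. f z s) \<in> borel_measurable M"
proof -
  have "(\<lambda>z. LBINT s. (if a < s \<and> s \<le> g z then f z s else 0)) \<in> borel_measurable M"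
    by measurable
  moreover have "(LBINT s:{a<..g z}. f z s) = (LBINT s. (if a < s \<and> s \<le> g z then f z s else 0))" for z
    unfolding set_lebesgue_integral_def by (rule Bochner_Integration.integral_cong) (auto simp: indicator_def)
  ultimately show ?thesis by simp
qed

lemma set_integral_Ioc_split:
  fixes f :: "real \<Rightarrow> real"
  assumes "a \<le> b" "b \<le> c" "set_integrable lborel {a<..c} f"
  shows "(LBINT v:{a<..c}. f v) = (LBINT v:{a<..b}. f v) + (LBINT v:{b<..c}. f v)"
proof -
  have "{a<..c} = {a<..b} \<union> {b<..c}" using assms by auto
  then show ?thesis
    using assms by (auto intro!: set_integral_Un intro: set_integrable_subset[OF assms(3)])
qed

lemma set_integral_nonneg_real:
  fixes f :: "real \<Rightarrow> real"
  assumes "\<And>x. x \<in> A \<Longrightarrow> 0 \<le> f x"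
  shows "0 \<le> (LINT x:A|M. f x)"
  unfolding set_lebesgue_integral_def using assms
  by (intro Bochner_Integration.integral_nonneg) (auto simp: indicator_def)

lemma set_integral_mono_set:
  fixes f :: "real \<Rightarrow> real"
  assumes "set_integrable M B f" "A \<in> sets M" "A \<subseteq> B" "\<And>x. x \<in> B \<Longrightarrow> 0 \<le> f x"
  shows "(LINT x:A|M. f x) \<le> (LINT x:B|M. f x)"
  unfolding set_lebesgue_integral_def
  using set_integrable_subset[OF assms(1-3)] assms
  by (intro integral_mono) (auto simp: set_integrable_def indicator_def)

lemma set_integral_Ioc_bounds:
  fixes f :: "real \<Rightarrow> real"
  assumes f: "f \<in> borel_measurable borel" and "a \<le> b"
    and lo: "\<And>x. a < x \<Longrightarrow> x \<le> b \<Longrightarrow> l \<le> f x" and hi: "\<And>x. a < x \<Longrightarrow> x \<le> b \<Longrightarrow> f x \<le> h"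
  shows "l * (b - a) \<le> (LBINT v:{a<..b}. f v)" "(LBINT v:{a<..b}. f v) \<le> h * (b - a)"
proof -
  have i: "set_integrable lborel {a<..b} f"
    by (rule set_integrable_Ioc_bounded[OF f, of _ _ "max \<bar>l\<bar> \<bar>h\<bar>"]) (use lo hi in fastforce)
  have c: "set_integrable lborel {a<..b} (\<lambda>_. k)" "(LBINT v:{a<..b}. k) = k * (b - a)" for k :: real
    using \<open>a \<le> b\<close> by (auto intro!: set_integrable_Ioc_bounded[of _ _ _ "\<bar>k\<bar>"] simp: set_lebesgue_integral_def)
  show "l * (b - a) \<le> (LBINT v:{a<..b}. f v)" "(LBINT v:{a<..b}. f v) \<le> h * (b - a)"
    using set_integral_mono[OF c(1)[of l] i] set_integral_mono[OF i c(1)[of h]] lo hi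
    by (auto simp: c(2))
qed

text \<open>
  A decrease of size \<open>O(h\<^sup>2)\<close> on steps of length \<open>h\<close> adds up to \<open>O(1/N)\<close> over \<open>N\<close> steps. This replaces the
  fundamental theorem of calculus for Lipschitz functions whose derivative exists only almost everywhere.
\<close>

lemma mono_from_quadratic_error:
  fixes f :: "real \<Rightarrow> real"
  assumes "a \<le> b" and step: "\<And>s t. a \<le> s \<Longrightarrow> s \<le> t \<Longrightarrow> t \<le> b \<Longrightarrow> f s - f t \<le> K * (t - s)\<^sup>2"
  shows "f a \<le> f b"
proof -
  have part: "f a - f b \<le> K * (b - a)\<^sup>2 / real (Suc N)" for N
  proof -
    define p where "p i = a + real i * (b - a) / real (Suc N)" for i
    have p: "a \<le> p i" "p i \<le> p (Suc i)" "p (Suc i) - p i = (b - a) / real (Suc N)" for i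
      using \<open>a \<le> b\<close> mult_nonneg_nonneg[of "real i" "b - a"]
      by (auto simp: p_def add_divide_distrib[symmetric] diff_divide_distrib[symmetric] algebra_simps divide_right_mono
          simp del: of_nat_0_le_iff intro!: divide_nonneg_nonneg)
    have "p i \<le> b" if "i \<le> Suc N" for i
      using mult_right_mono[of "real i" "real (Suc N)" "b - a"] that \<open>a \<le> b\<close> by (simp add: p_def field_simps)
    then have "(\<Sum>i<Suc N. f (p i) - f (p (Suc i))) \<le> (\<Sum>i<Suc N. K * ((b - a) / real (Suc N))\<^sup>2)"
      using p by (intro sum_mono) (metis step lessThan_iff Suc_leI)
    also have "\<dots> = K * (b - a)\<^sup>2 / real (Suc N)"
      by (simp add: power2_eq_square del: of_nat_Suc)
    finally show ?thesis
      using sum_lessThan_telescope'[of "\<lambda>i. f (p i)" "Suc N"] by (simp add: p_def)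
  qed
  have "(\<lambda>N. K * (b - a)\<^sup>2 / real (Suc N)) \<longlonglongrightarrow> 0"
    by (intro tendsto_divide_0[OF tendsto_const] filterlim_compose[OF filterlim_at_top_imp_at_infinity filterlim_Suc] filterlim_compose[OF filterlim_real_sequentially filterlim_Suc] filterlim_at_top_imp_at_infinity)
  then have "f a - f b \<le> 0"
    by (rule LIMSEQ_le_const) (use part in auto)
  then show ?thesis by simp
qed

text \<open>
  Comparison with \<open>F' = - q F\<close> for a merely measurable rate \<open>q\<close>: over a short step the exponential and its
  linearisation differ by \<open>O(h\<^sup>2)\<close>, so \<open>t \<mapsto> F t + \<integral>\<^sub>a\<^sup>t q F\<close> is monotone by the preceding lemma. Only
  one-sided bounds on \<open>F\<close> are available for a minimum of two solutions; hence the two halves are separate.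
\<close>

lemma decay_integral_bounds:
  fixes F q :: "real \<Rightarrow> real"
  assumes ab: "a \<le> b" and q [measurable]: "q \<in> borel_measurable borel" and F [measurable]:
      "F \<in> borel_measurable borel"
    and q_bd: "\<And>v. 0 \<le> q v" "\<And>v. q v \<le> M"
    and F_bd: "\<And>v. a \<le> v \<Longrightarrow> v \<le> b \<Longrightarrow> 0 \<le> F v" "\<And>v. a \<le> v \<Longrightarrow> v \<le> b \<Longrightarrow> F v \<le> B"
  shows decay_integral_lower:
      "(\<And>s t. a \<le> s \<Longrightarrow> s \<le> t \<Longrightarrow> t \<le> b \<Longrightarrow> F s * exp (- (LBINT v:{s<..t}. q v)) \<le> F t) \<Longrightarrow>
         F a - (LBINT v:{a<..b}. q v * F v) \<le> F b"
    and decay_integral_upper: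
      "(\<And>s t. a \<le> s \<Longrightarrow> s \<le> t \<Longrightarrow> t \<le> b \<Longrightarrow> F t \<le> F s * exp (- (LBINT v:{s<..t}. q v))) \<Longrightarrow>
         F b \<le> F a - (LBINT v:{a<..b}. q v * F v)"
proof -
  define Q where "Q s t = (LBINT v:{s<..t}. q v)" for s t
  define G where "G s t = (LBINT v:{s<..t}. q v * F v)" for s t
  have M0: "0 \<le> M" using q_bd[of 0] by linarith
  have B0: "0 \<le> B" using F_bd[OF order_refl ab] by linarith
  have qi: "set_integrable lborel {s<..t} q" for s t
    by (rule set_integrable_Ioc_bounded[of _ _ _ M]) (use q_bd in auto)
  have bnd: "\<bar>q v * F v\<bar> \<le> M * B" if "a \<le> v" "v \<le> b" for v
    using that q_bd[of v] F_bd[of v] M0 B0 by (auto simp: abs_mult intro!: mult_mono)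
  have gi: "set_integrable lborel {s<..t} (\<lambda>v. q v * F v)" if "a \<le> s" "t \<le> b" for s t
    by (rule set_integrable_Ioc_bounded[of _ _ _ "M * B"]) (use bnd that in auto)
  have Q0: "0 \<le> Q s t" for s t unfolding Q_def by (rule set_integral_nonneg_real) (use q_bd in auto)
  have QM: "Q s t \<le> M * (t - s)" if "s \<le> t" for s t
    unfolding Q_def by (rule set_integral_Ioc_bounds[OF q that q_bd]) 
  have Qmono: "Q s v \<le> Q s t" if "v \<le> t" for s v t
    unfolding Q_def by (rule set_integral_mono_set[OF qi]) (use q_bd that in auto)
  have Gsplit: "G a t = G a s + G s t" if "a \<le> s" "s \<le> t" "t \<le> b" for s t
    unfolding G_def by (rule set_integral_Ioc_split) (use that gi in auto)
  have sq: "B * (Q s t)\<^sup>2 \<le> (B * M\<^sup>2) * (t - s)\<^sup>2" if "s \<le> t" for s t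
    using mult_left_mono[OF power_mono[OF QM[OF that] Q0[of s t], of 2] B0] by
        (simp add: power_mult_distrib mult_ac)
  have Fsq: "F s * (Q s t)\<^sup>2 \<le> (B * M\<^sup>2) * (t - s)\<^sup>2" if "a \<le> s" "s \<le> t" "t \<le> b" for s t
    by (rule order_trans[OF mult_right_mono[OF F_bd(2)] sq]) (use that in auto)
  have G_aa: "G a a = 0" by (simp add: G_def set_lebesgue_integral_def)
  { assume low: "\<And>s t. a \<le> s \<Longrightarrow> s \<le> t \<Longrightarrow> t \<le> b \<Longrightarrow> F s * exp (- (LBINT v:{s<..t}. q v)) \<le> F t"
    have "F a + G a a \<le> F b + G a b"
    proof (rule mono_from_quadratic_error[where f = "\<lambda>t. F t + G a t" and K = "B * M\<^sup>2", OF ab])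
      fix s t assume st: "a \<le> s" "s \<le> t" "t \<le> b"
      have F0: "0 \<le> F s" using F_bd st by auto
      have "(LBINT v:{s<..t}. q v * (F s * exp (- Q s t))) \<le> G s t"
        unfolding G_def
      proof (rule set_integral_mono)
        show "set_integrable lborel {s<..t} (\<lambda>v. q v * (F s * exp (- Q s t)))" using qi by simp
        show "set_integrable lborel {s<..t} (\<lambda>v. q v * F v)" using gi st by simp
        fix v assume v: "v \<in> {s<..t}"
        have "F s * exp (- Q s t) \<le> F s * exp (- Q s v)"
          using Qmono[of v t s] v F0 by (intro mult_left_mono) auto
        also have "\<dots> \<le> F v" using low[of s v] v st by (auto simp: Q_def)
        finally show "q v * (F s * exp (- Q s t)) \<le> q v * F v" using q_bd by (intro mult_left_mono)
      qed
      then have "Q s t * (F s * exp (- Q s t)) \<le> G s t" by (simp add: Q_def)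
      moreover have "F s * exp (- Q s t) \<le> F t" using low st by (simp add: Q_def)
      \<comment> \<open>The linearisation error is quadratic in \<open>Q s t\<close>, hence in the length of the step.\<close>
      moreover have "1 - (Q s t)\<^sup>2 \<le> exp (- Q s t) * (1 + Q s t)"
      proof -
        have "1 - Q s t \<le> exp (- Q s t)" using exp_ge_add_one_self[of "- Q s t"] by simp
        then have "(1 - Q s t) * (1 + Q s t) \<le> exp (- Q s t) * (1 + Q s t)"
          using Q0[of s t] by (intro mult_right_mono) auto
        then show ?thesis by (simp add: algebra_simps power2_eq_square)
      qed
      then have "F s * (1 - (Q s t)\<^sup>2) \<le> F s * (exp (- Q s t) * (1 + Q s t))" using F0 by (intro mult_left_mono)
      ultimately show "F s + G a s - (F t + G a t) \<le> B * M\<^sup>2 * (t - s)\<^sup>2"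
        using Gsplit[OF st] Fsq[OF st] by (simp add: algebra_simps)
    qed
    then show "F a - (LBINT v:{a<..b}. q v * F v) \<le> F b" by (simp add: G_aa) (simp add: G_def)
  }
  { assume upp: "\<And>s t. a \<le> s \<Longrightarrow> s \<le> t \<Longrightarrow> t \<le> b \<Longrightarrow> F t \<le> F s * exp (- (LBINT v:{s<..t}. q v))"
    have "- (F a + G a a) \<le> - (F b + G a b)"
    proof (rule mono_from_quadratic_error[where f = "\<lambda>t. - (F t + G a t)" and K = "B * M\<^sup>2", OF ab])
      fix s t assume st: "a \<le> s" "s \<le> t" "t \<le> b"
      have F0: "0 \<le> F s" using F_bd st by auto
      have "G s t \<le> (LBINT v:{s<..t}. q v * F s)"
        unfolding G_def
      proof (rule set_integral_mono)
        show "set_integrable lborel {s<..t} (\<lambda>v. q v * F s)" using qi by simp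
        show "set_integrable lborel {s<..t} (\<lambda>v. q v * F v)" using gi st by simp
        fix v assume v: "v \<in> {s<..t}"
        have "F v \<le> F s * exp (- Q s v)" using upp[of s v] v st by (auto simp: Q_def)
        also have "\<dots> \<le> F s * 1" using F0 Q0 by (intro mult_left_mono) auto
        finally show "q v * F v \<le> q v * F s" using q_bd by (intro mult_left_mono) auto
      qed
      then have "G s t \<le> Q s t * F s" by (simp add: Q_def)
      moreover have "F t \<le> F s * exp (- Q s t)" using upp st by (simp add: Q_def)
      moreover have "exp (- Q s t) \<le> 1 - Q s t + (Q s t)\<^sup>2"
      proof -
        have "exp (- Q s t) * (1 + Q s t) \<le> exp (- Q s t) * exp (Q s t)"
          using exp_ge_add_one_self[of "Q s t"] by (intro mult_left_mono) auto
        then have "exp (- Q s t) * (1 + Q s t) \<le> 1" by (simp add: exp_minus_inverse mult.commute)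
        then have "exp (- Q s t) \<le> 1 / (1 + Q s t)" using Q0[of s t] by (simp add: field_simps)
        also have "\<dots> \<le> 1 - Q s t + (Q s t)\<^sup>2"
        proof -
          have "(1 - Q s t + (Q s t)\<^sup>2) * (1 + Q s t) = 1 + (Q s t)^3"
            by (simp add: algebra_simps power2_eq_square power3_eq_cube)
          then have "1 \<le> (1 - Q s t + (Q s t)\<^sup>2) * (1 + Q s t)" using Q0[of s t] by simp
          then show ?thesis using Q0[of s t] by (subst pos_divide_le_eq) auto
        qed
        finally show ?thesis .
      qed
      then have "F s * exp (- Q s t) \<le> F s * (1 - Q s t + (Q s t)\<^sup>2)" using F0 by (intro mult_left_mono)
      ultimately show "- (F s + G a s) - - (F t + G a t) \<le> B * M\<^sup>2 * (t - s)\<^sup>2"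
        using Gsplit[OF st] Fsq[OF st] by (simp add: algebra_simps)
    qed
    then show "F b \<le> F a - (LBINT v:{a<..b}. q v * F v)" by (simp add: G_aa) (simp add: G_def)
  }
qed

lemma fubini_dominated:
  fixes f :: "real \<Rightarrow> real \<Rightarrow> real"
  assumes f: "(\<lambda>p. f (fst p) (snd p)) \<in> borel_measurable borel"
    and b: "integrable lborel b" and c: "integrable lborel c"
    and le: "\<And>y s. \<bar>f y s\<bar> \<le> b y * c s"
  shows "(LBINT y. LBINT s. f y s) = (LBINT s. LBINT y. f y s)"
    and "integrable lborel (\<lambda>y. LBINT s. f y s)"
    and "integrable lborel (\<lambda>s. LBINT y. f y s)"
    and "integrable lborel (\<lambda>s. f y s)"
proof -
  have f' [measurable]: "(\<lambda>(y, s). f y s) \<in> borel_measurable (lborel \<Otimes>\<^sub>M lborel)"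
    using f by (simp add: lborel_prod case_prod_beta)
  have [measurable]: "f y \<in> borel_measurable borel" for y
    using measurable_compose[OF _ f, of "\<lambda>s. (y, s)" borel] by simp
  have [measurable]: "(\<lambda>y. f y s) \<in> borel_measurable borel" for s
    using measurable_compose[OF _ f, of "\<lambda>y. (y, s)" borel] by simp
  show fs: "integrable lborel (\<lambda>s. f y s)" for y
    by (rule Bochner_Integration.integrable_bound[where f = "\<lambda>s. b y * c s"])
       (use c le[of y] in \<open>auto intro: order_trans[OF _ abs_ge_self]\<close>)
  have int: "integrable (lborel \<Otimes>\<^sub>M lborel) (\<lambda>(y, s). f y s)"
  proof (rule lborel_pair.Fubini_integrable)
    have "(\<integral>s. \<bar>f y s\<bar> \<partial>lborel) \<le> b y * (LBINT s. c s)" for y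
    proof -
      have "(\<integral>s. \<bar>f y s\<bar> \<partial>lborel) \<le> (\<integral>s. b y * c s \<partial>lborel)"
        using fs[of y] c le by (intro integral_mono) auto
      then show ?thesis by simp
    qed
    then have bd: "\<bar>\<integral>s. \<bar>f y s\<bar> \<partial>lborel\<bar> \<le> \<bar>b y * (LBINT s. c s)\<bar>" for y
      using Bochner_Integration.integral_nonneg[of lborel "\<lambda>s. \<bar>f y s\<bar>"]
      by (metis abs_ge_zero abs_of_nonneg abs_ge_self order_trans)
    show "integrable lborel (\<lambda>x. \<integral>y. norm (case (x, y) of (y, s) \<Rightarrow> f y s) \<partial>lborel)"
    proof (rule Bochner_Integration.integrable_bound[where f = "\<lambda>y. b y * (LBINT s. c s)"])
      show "integrable lborel (\<lambda>y. b y * (LBINT s. c s))" using b by simp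
      show "(\<lambda>x. \<integral>y. norm (case (x, y) of (y, s) \<Rightarrow> f y s) \<partial>lborel) \<in> borel_measurable lborel"
        by measurable
      show "AE y in lborel. norm (\<integral>s. norm (case (y, s) of (y, s) \<Rightarrow> f y s) \<partial>lborel)
          \<le> norm (b y * (LBINT s. c s))"
        using bd by (intro AE_I2) (simp only: case_prod_conv real_norm_def)
    qed
  qed (use fs in auto)
  show "(LBINT y. LBINT s. f y s) = (LBINT s. LBINT y. f y s)"
    using lborel_pair.Fubini_integral[OF int] by simp
  show "integrable lborel (\<lambda>y. LBINT s. f y s)" "integrable lborel (\<lambda>s. LBINT y. f y s)"
    using lborel_pair.integrable_fst'[OF int] lborel_pair.integrable_snd[OF int] by simp_all
qed

lemma set_integral_Ioc_reflect:
  fixes f :: "real \<Rightarrow> real"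
  assumes [measurable]: "f \<in> borel_measurable borel"
  shows "(LBINT y:{-b<..-a}. f (-y)) = (LBINT s:{a<..b}. f s)"
proof -
  have "(LBINT y:{-b<..-a}. f (-y)) = (LBINT y. indicator {a..<b} (-y) * f (-y))"
    unfolding set_lebesgue_integral_def by (rule Bochner_Integration.integral_cong) (auto simp: indicator_def)
  also have "\<dots> = (LBINT s. indicator {a..<b} s * f s)"
    using lborel_integral_real_affine[of "-1" "\<lambda>s. indicator {a..<b} s * f s" 0] by simp
  also have "\<dots> = (LBINT s. indicator {a<..b} s * f s)"
  proof (rule integral_cong_AE)
    show "AE s in lborel. indicator {a..<b} s * f s = indicator {a<..b} s * f s"
      using AE_lborel_singleton[of a] AE_lborel_singleton[of b] by eventually_elim (auto simp: indicator_def)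
  qed auto
  finally show ?thesis by (simp add: set_lebesgue_integral_def)
qed

lemma set_integral_Ioc_shift:
  fixes f :: "real \<Rightarrow> real"
  shows "(LBINT s:{t + a<..t + b}. f s) = (LBINT s:{a<..b}. f (t + s))"
proof -
  have "(LBINT s:{t + a<..t + b}. f s) = (LBINT s. indicator {t + a<..t + b} (t + s) * f (t + s))"
    unfolding set_lebesgue_integral_def
    using lborel_integral_real_affine[of 1 "\<lambda>s. indicator {t + a<..t + b} s * f s" t] by simp
  also have "\<dots> = (LBINT s:{a<..b}. f (t + s))"
    unfolding set_lebesgue_integral_def by (rule Bochner_Integration.integral_cong) (auto simp: indicator_def)
  finally show ?thesis .
qed

lemma set_integrable_Ioc_shift:
  fixes f :: "real \<Rightarrow> real"
  assumes "set_integrable lborel {t + a<..t + b} f"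
  shows "set_integrable lborel {a<..b} (\<lambda>s. f (t + s))"
proof -
  have "integrable lborel (\<lambda>s. indicator {t + a<..t + b} (t + 1 * s) *\<^sub>R f (t + 1 * s))"
    using assms unfolding set_integrable_def by (rule lborel_integrable_real_affine) simp
  also have "(\<lambda>s. indicator {t + a<..t + b} (t + 1 * s) *\<^sub>R f (t + 1 * s))
      = (\<lambda>s. indicator {a<..b} s *\<^sub>R f (t + s))"
    by (auto simp: indicator_def)
  finally show ?thesis by (simp add: set_integrable_def)
qed

lemma set_integral_const_Ioc: "a \<le> b \<Longrightarrow> (LBINT v:{a<..b}. k) = (b - a) * (k::real)"
  by (simp add: set_lebesgue_integral_def)

lemma set_integral_Ioi_shift:
  fixes f :: "real \<Rightarrow> real"
  shows "(LBINT x:{0<..}. f (x - t)) = (LBINT y:{-t<..}. f y)"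
proof -
  have "(LBINT y:{-t<..}. f y) = (LBINT x. indicator {-t<..} (-t + x) * f (-t + x))"
    unfolding set_lebesgue_integral_def
        using lborel_integral_real_affine[of 1 "\<lambda>y. indicator {-t<..} y * f y" "-t"] by simp
  also have "\<dots> = (LBINT x:{0<..}. f (x - t))"
    unfolding set_lebesgue_integral_def by (rule Bochner_Integration.integral_cong) (auto simp: indicator_def)
  finally show ?thesis by simp
qed

section \<open>Sumsets and renewal inequalities\<close>

text \<open>
  Steinhaus' theorem for sums, in a quantitative form. By Fubini some \<open>y0\<close> makes \<open>Q = K \<inter> (y0 - K)\<close>
  non-null, where \<open>K \<subseteq> P\<close> is compact. For small \<open>h\<close> the translate \<open>Q + h\<close> stays inside an open set that is
  hardly larger than \<open>Q\<close>, so \<open>Q\<close> and \<open>Q + h\<close> overlap substantially; the overlap lies in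
  \<open>P \<inter> (y0 + h - P)\<close>.
\<close>

lemma sumset_contains_interval:
  fixes P :: "real set"
  assumes P: "P \<in> sets borel" and bd: "bounded P" and pos: "emeasure lborel P \<noteq> 0"
  obtains a b m where "a < b" "0 < m" "\<And>y. y \<in> {a..b} \<Longrightarrow> m \<le> measure lborel (P \<inter> {x. y - x \<in> P})"
proof -
  have "emeasure lebesgue P > 0" using P pos by (simp add: zero_less_iff_neq_zero)
  then obtain e where e: "0 < ennreal e" "ennreal e \<le> emeasure lebesgue P" "e > 0"
  proof (cases "emeasure lebesgue P")
    case (real r)
    then show ?thesis using \<open>emeasure lebesgue P > 0\<close> that[of r] by auto
  next
    case top
    then show ?thesis using that[of 1] by auto
  qed
  obtain K where K: "closed K" "K \<subseteq> P" "emeasure lebesgue (P - K) < ennreal e"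
    using sets_lebesgue_inner_closed[of P e] sets_completionI_sets[of P lborel] P(1) e(3) by (metis sets_lborel)
  have compK: "compact K" using K bd by (meson bounded_subset compact_eq_bounded_closed)
  have [measurable]: "K \<in> sets borel" using K by auto
  have Kpos: "emeasure lborel K \<noteq> 0"
  proof
    assume "emeasure lborel K = 0"
    then have "emeasure lebesgue (P - K) = emeasure lebesgue P"
      using P K by (subst emeasure_Diff_null_set) (auto simp: null_sets_def)
    then show False using K e by auto
  qed
  have Kfin: "emeasure lborel K < \<infinity>" using emeasure_bounded_finite[OF compact_imp_bounded[OF compK]] by simp
  have "\<exists>y0. emeasure lborel (K \<inter> {x. y0 - x \<in> K}) \<noteq> 0"
  proof (rule ccontr)
    assume "\<nexists>y0. emeasure lborel (K \<inter> {x. y0 - x \<in> K}) \<noteq> 0"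
    then have z: "emeasure lborel (K \<inter> {x. y - x \<in> K}) = 0" for y by auto
    have "0 = (\<integral>\<^sup>+y. emeasure lborel (K \<inter> {x. y - x \<in> K}) \<partial>lborel)" by (simp add: z)
    also have "\<dots> = (\<integral>\<^sup>+y. \<integral>\<^sup>+x. indicator K x * indicator K (y - x) \<partial>lborel \<partial>lborel)"
    proof (intro nn_integral_cong)
      fix y :: real
      have "K \<inter> {x. y - x \<in> K} \<in> sets lborel" by measurable
      then show "emeasure lborel (K \<inter> {x. y - x \<in> K}) = (\<integral>\<^sup>+x. indicator K x * indicator K (y - x) \<partial>lborel)"
        by (simp only: nn_integral_indicator[symmetric] indicator_inter_arith)
           (auto intro!: nn_integral_cong split: split_indicator)
    qed
    also have "\<dots> = (\<integral>\<^sup>+x. \<integral>\<^sup>+y. indicator K x * indicator K (y - x) \<partial>lborel \<partial>lborel)"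
      by (rule lborel_pair.Fubini') measurable
    also have "\<dots> = (\<integral>\<^sup>+x. indicator K x * emeasure lborel K \<partial>lborel)"
    proof (intro nn_integral_cong)
      fix x :: real
      have "(\<integral>\<^sup>+y. indicator K x * indicator K (y - x) \<partial>lborel)
          = indicator K x * (\<integral>\<^sup>+y. indicator K (y - x) \<partial>lborel)"
        by (rule nn_integral_cmult) measurable
      also have "(\<integral>\<^sup>+y. indicator K (y - x) \<partial>lborel) = (\<integral>\<^sup>+y. indicator K y \<partial>lborel)"
        using nn_integral_real_affine[of "\<lambda>y. indicator K (y - x)" 1 x] by simp
      finally show "(\<integral>\<^sup>+y. indicator K x * indicator K (y - x) \<partial>lborel) = indicator K x * emeasure lborel K"
        by simp
    qed
    also have "\<dots> = emeasure lborel K * emeasure lborel K"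
      by (subst nn_integral_multc) auto
    finally show False using Kpos by auto
  qed
  then obtain y0 where y0: "emeasure lborel (K \<inter> {x. y0 - x \<in> K}) \<noteq> 0" by blast
  define Q where "Q = K \<inter> {x. y0 - x \<in> K}"
  have "closed {x. y0 - x \<in> K}"
    using closed_vimage[OF K(1), of "\<lambda>x. y0 - x"] by (simp add: vimage_def continuous_on_diff)
  then have compQ: "compact Q" unfolding Q_def by (intro compact_Int_closed compK)
  then have [measurable]: "Q \<in> sets borel" by (metis compact_imp_closed borel_closed)
  have Qfin: "Q \<in> fmeasurable lborel" using emeasure_bounded_finite[OF compact_imp_bounded[OF compQ]]
      by (intro fmeasurableI) auto
  define q where "q = measure lborel Q"
  have q: "0 < q" using y0 Qfin by
      (simp add: q_def Q_def measure_def enn2real_positive_iff fmeasurable_def zero_less_iff_neq_zero)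
  obtain U where U: "open U" "Q \<subseteq> U" "U - Q \<in> lmeasurable" "emeasure lebesgue (U - Q) < ennreal (q/2)"
    using sets_lebesgue_outer_open[of Q "q/2"] q by auto
  obtain d where d: "d > 0" "(\<Union>x\<in>Q. ball x d) \<subseteq> U"
    using compact_subset_open_imp_ball_epsilon_subset[OF compQ U(1,2)] by blast
  have [measurable]: "U \<in> sets borel" using U by auto
  have UQ1: "U - Q \<in> fmeasurable lborel" using U by (auto simp: fmeasurable_def)
  have "ennreal (measure lborel (U - Q)) < ennreal (q / 2)"
    using U(4) by (simp add: emeasure_eq_measure2[OF UQ1, symmetric])
  then have UQ: "U - Q \<in> fmeasurable lborel" "measure lborel (U - Q) < q / 2"
    using UQ1 by (simp_all add: ennreal_less_iff)
  have Ufm: "U \<in> fmeasurable lborel" using fmeasurable.Un[OF UQ(1) Qfin] U(2) by (simp add: Un_absorb2)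
  have Um: "measure lborel U < 3 * q / 2"
    using measure_Un2[OF UQ(1) Qfin] UQ(2) U(2)
    measure_Un_le[of "U - Q" lborel Q] by (simp add: Un_absorb2 q_def)
  have main: "q / 2 \<le> measure lborel (P \<inter> {x. y - x \<in> P})" if y: "\<bar>y - y0\<bar> < d" for y
  proof -
    define h where "h = y - y0"
    define Qh where "Qh = {x. x - h \<in> Q}"
    have [measurable]: "Qh \<in> sets borel" unfolding Qh_def by measurable
    have Qh_eq: "Qh = (\<lambda>x. h + x) ` Q" by (force simp: Qh_def image_iff)
    have "measure lebesgue Qh = measure lborel Qh" by (rule measure_completion) simp
    then have "measure lborel Qh = q"
      using measure_translation[of h Q] by (simp add: q_def Qh_eq)
    have "Qh \<subseteq> U"
    proof
      fix x assume "x \<in> Qh"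
      then have "x \<in> ball (x - h) d" "x - h \<in> Q" using y by (auto simp: Qh_def h_def dist_real_def)
      then show "x \<in> U" using d by blast
    qed
    then have Qhf: "Qh \<in> fmeasurable lborel" using Ufm by (auto intro: fmeasurableI2)
    have "measure lborel (Q \<union> Qh) \<le> measure lborel U"
      using \<open>Qh \<subseteq> U\<close> U(2) Ufm by (intro measure_mono_fmeasurable) auto
    moreover have "measure lborel (Q \<union> Qh) = q + q - measure lborel (Q \<inter> Qh)"
      using measure_Un3[OF Qfin Qhf] \<open>measure lborel Qh = q\<close> by (simp add: q_def)
    ultimately have "q / 2 \<le> measure lborel (Q \<inter> Qh)" using Um by linarith
    also have "\<dots> \<le> measure lborel (P \<inter> {x. y - x \<in> P})"
    proof (rule measure_mono_fmeasurable)
      show "Q \<inter> Qh \<subseteq> P \<inter> {x. y - x \<in> P}"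
        using K(2) by (auto simp: Q_def Qh_def h_def algebra_simps)
      have [measurable]: "P \<in> sets borel" by fact
      have "P \<inter> {x. y - x \<in> P} \<in> sets lborel" by measurable
      moreover have "P \<in> fmeasurable lborel"
        using P emeasure_bounded_finite[OF bd] by (intro fmeasurableI) auto
      ultimately show "P \<inter> {x. y - x \<in> P} \<in> fmeasurable lborel"
        using fmeasurableI2[of P lborel "P \<inter> {x. y - x \<in> P}"] by blast
    qed auto
    finally show ?thesis .
  qed
  show ?thesis
  proof (rule that[of "y0 - d/2" "y0 + d/2" "q/2"])
    fix y assume "y \<in> {y0 - d/2..y0 + d/2}"
    then have "\<bar>y - y0\<bar> < d" using d by (auto simp: abs_if)
    then show "q/2 \<le> measure lborel (P \<inter> {x. y - x \<in> P})" by (rule main)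
  qed (use d q in auto)
qed

text \<open>
  A renewal inequality whose form is stable under iteration. Its error consists of \<open>e\<close>, which is small in
  \<open>L\<^sup>1\<close> only, and of a uniform part \<open>C * E\<close>, where \<open>E\<close> bounds the \<open>L\<^sup>1\<close> norm of \<open>e\<close>. If the inequality is
  inserted into itself, the convolutions of \<open>e\<close> are bounded by multiples of \<open>E\<close>, so \<open>e\<close> keeps its
  coefficient 1.
\<close>

definition renewal_ineq :: "real \<Rightarrow> real set \<Rightarrow> real \<Rightarrow> real \<Rightarrow> (real \<Rightarrow> real) \<Rightarrow> (real \<Rightarrow> real) \<Rightarrow> real \<Rightarrow> bool" where
  "renewal_ineq T P k C v e E \<longleftrightarrow>
     (\<forall>\<tau>\<in>{0<..T}. k * (LBINT s:{0<..\<tau>}. indicator P (\<tau> - s) * v s) \<le> v \<tau> + e \<tau> + C * E)"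

definition renewal_data :: "real \<Rightarrow> (real \<Rightarrow> real) \<Rightarrow> (real \<Rightarrow> real) \<Rightarrow> real \<Rightarrow> bool" where
  "renewal_data T v e E \<longleftrightarrow> v \<in> borel_measurable borel \<and> (\<forall>s. 0 \<le> v s) \<and> (\<exists>B. \<forall>s. v s \<le> B) \<and>
     e \<in> borel_measurable borel \<and> (\<forall>s. 0 \<le> e s) \<and> set_integrable lborel {0<..T} e \<and>
     (LBINT s:{0<..T}. e s) \<le> E"

text \<open>
  The inequality for \<open>P'\<close> is inserted into the one for \<open>P\<close>. The iterated kernel is the convolution of the
  two indicator functions, which is at least \<open>m\<close> on \<open>S\<close>; the convolution of \<open>e\<close> with the bounded kernel is
  controlled by \<open>E\<close>.
\<close>

lemma renewal_ineq_compose: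
  assumes dat: "renewal_data T v e E"
    and 1: "renewal_ineq T P k1 C1 v e E" and 2: "renewal_ineq T P' k2 C2 v e E"
    and k: "0 \<le> k1" "0 \<le> k2" "0 \<le> m" and C: "0 \<le> C2" and T: "0 < T"
    and P: "P \<in> sets borel" "P' \<in> sets borel" "S \<in> sets borel" "P \<subseteq> {0..}" "P' \<subseteq> {0..}"
    and over: "\<And>y. y \<in> S \<Longrightarrow> m \<le> measure lborel (P \<inter> {x. y - x \<in> P'})"
  shows "renewal_ineq T S (k1 * k2 * m) (C1 + k1 * (1 + C2 * T)) v e E"
  unfolding renewal_ineq_def
proof
  fix \<tau> assume \<tau>: "\<tau> \<in> {0<..T}"
  from dat obtain B where v [measurable]: "v \<in> borel_measurable borel" and v0: "\<And>s. 0 \<le> v s" and vB: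
      "\<And>s. v s \<le> B"
    and e [measurable]: "e \<in> borel_measurable borel" and e0: "\<And>s. 0 \<le> e s"
    and ei: "set_integrable lborel {0<..T} e" and eE: "(LBINT s:{0<..T}. e s) \<le> E"
    by (auto simp: renewal_data_def)
  note [measurable] = P(1-3)
  have B0: "0 \<le> B" using v0[of 0] vB[of 0] by linarith
  have E0: "0 \<le> E" using set_integral_nonneg_real[of "{0<..T}" e lborel] e0 eE by fastforce
  define f where "f r s = indicator {0<..\<tau>} s * indicator {0<..\<tau>} r *
      (if r \<le> s then indicator P (\<tau> - s) * indicator P' (s - r) * v r else 0)" for r s
  have fm: "(\<lambda>p. f (fst p) (snd p)) \<in> borel_measurable borel"
    unfolding f_def borel_prod[symmetric] by measurable
  have ind: "integrable lborel (indicat_real {0<..\<tau>})" by (rule integrable_real_indicator) (use \<tau> in auto)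
  have fle: "\<bar>f r s\<bar> \<le> (B * indicator {0<..\<tau>} r) * indicator {0<..\<tau>} s" for r s
    using v0[of r] vB[of r] B0 by (auto simp: f_def indicator_def)
  note fub = fubini_dominated[OF fm integrable_mult_right[OF ind, of B] ind fle]
  have inner1: "(LBINT r. f r s)
      = indicator {0<..\<tau>} s * indicator P (\<tau> - s) * (LBINT r:{0<..s}. indicator P' (s - r) * v r)" for s
    unfolding set_lebesgue_integral_def integral_mult_right_zero[symmetric]
    by (rule Bochner_Integration.integral_cong) (auto simp: f_def indicator_def)
  have inner2: "m * (indicator {0<..\<tau>} r * (indicator S (\<tau> - r) * v r)) \<le> (LBINT s. f r s)" for r
  proof (cases "r \<in> {0<..\<tau>} \<and> \<tau> - r \<in> S")
    case True
    have "(LBINT s. f r s) = (LBINT s. v r * indicator (P \<inter> {x. (\<tau> - r) - x \<in> P'}) (\<tau> - s))"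
    proof (intro Bochner_Integration.integral_cong refl)
      fix s
      show "f r s = v r * indicator (P \<inter> {x. \<tau> - r - x \<in> P'}) (\<tau> - s)"
        using True P(4,5) by (auto simp: f_def indicator_def)
    qed
    also have "\<dots> = v r * (LBINT s. indicator (P \<inter> {x. (\<tau> - r) - x \<in> P'}) (\<tau> - s))" by simp
    also have "(LBINT s. indicat_real (P \<inter> {x. (\<tau> - r) - x \<in> P'}) (\<tau> - s))
        = (LBINT s. indicat_real (P \<inter> {x. (\<tau> - r) - x \<in> P'}) s)"
      using lborel_integral_real_affine[of "-1" "indicat_real (P \<inter> {x. (\<tau> - r) - x \<in> P'})" \<tau>] by simp
    also have "\<dots> = measure lborel (P \<inter> {x. (\<tau> - r) - x \<in> P'})" by simp
    finally show ?thesis using True mult_right_mono[OF over[of "\<tau> - r"] v0[of r]]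
      by (simp add: mult.commute)
  next
    case False
    have "0 \<le> (LBINT s. f r s)" by (rule Bochner_Integration.integral_nonneg) (auto simp: f_def v0)
    then show ?thesis using False by auto
  qed
  have [measurable]: "(\<lambda>s. LBINT r. f r s) \<in> borel_measurable borel"
    using borel_measurable_integrable[OF fub(3)] by simp
  have si: "set_integrable lborel {0<..\<tau>} (\<lambda>r. indicator S (\<tau> - r) * v r)"
    by (rule set_integrable_Ioc_bounded[of _ _ _ B]) (use v0 vB B0 in \<open>auto simp: indicator_def\<close>)
  have "m * (LBINT r:{0<..\<tau>}. indicator S (\<tau> - r) * v r)
      = (LBINT r. m * (indicator {0<..\<tau>} r * (indicator S (\<tau> - r) * v r)))"
    by (simp add: set_lebesgue_integral_def)
  also have "\<dots> \<le> (LBINT r. LBINT s. f r s)"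
    using si fub(2) inner2 by (intro integral_mono integrable_mult_right) (auto simp: set_integrable_def)
  also have "\<dots> = (LBINT s. LBINT r. f r s)" by (rule fub(1))
  finally have A: "m * (LBINT r:{0<..\<tau>}. indicator S (\<tau> - r) * v r) \<le> (LBINT s. LBINT r. f r s)" .
  have eti: "set_integrable lborel {0<..\<tau>} e" by (rule set_integrable_subset[OF ei]) (use \<tau> in auto)
  have vi: "set_integrable lborel {0<..\<tau>} (\<lambda>s. indicator P (\<tau> - s) * v s)"
    by (rule set_integrable_Ioc_bounded[of _ _ _ B]) (use v0 vB B0 in \<open>auto simp: indicator_def\<close>)
  have ci: "set_integrable lborel {0<..\<tau>} (\<lambda>_. C2 * E)"
    by (rule set_integrable_Ioc_bounded[of _ _ _ "\<bar>C2 * E\<bar>"]) auto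
  have "k2 * (LBINT s. LBINT r. f r s) = (LBINT s. k2 * (LBINT r. f r s))" by simp
  also have "\<dots> \<le> (LBINT s:{0<..\<tau>}. indicator P (\<tau> - s) * v s + (e s + C2 * E))"
    unfolding set_lebesgue_integral_def
  proof (intro integral_mono integrable_mult_right fub(3))
    show "integrable lborel (\<lambda>s. indicat_real {0<..\<tau>} s *\<^sub>R (indicat_real P (\<tau> - s) * v s + (e s + C2 * E)))"
      using set_integral_add(1)[OF vi set_integral_add(1)[OF eti ci]] by (simp add: set_integrable_def)
    fix s
    show "k2 * (LBINT r. f r s) \<le> indicat_real {0<..\<tau>} s *\<^sub>R (indicat_real P (\<tau> - s) * v s + (e s + C2 * E))"
    proof (cases "s \<in> {0<..\<tau>} \<and> \<tau> - s \<in> P")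
      case True
      then have "s \<in> {0<..T}" using \<tau> by auto
      with 2 have "k2 * (LBINT r:{0<..s}. indicat_real P' (s - r) * v r) \<le> v s + e s + C2 * E"
        unfolding renewal_ineq_def by blast
      then show ?thesis using True by (simp add: inner1 add.assoc)
    next
      case False
      then show ?thesis using e0[of s] C E0 by (auto simp: inner1 indicator_def)
    qed
  qed
  also have "\<dots> = (LBINT s:{0<..\<tau>}. indicator P (\<tau> - s) * v s)
      + ((LBINT s:{0<..\<tau>}. e s) + (LBINT s:{0<..\<tau>}. C2 * E))"
    using set_integral_add(1)[OF eti ci] by
        (simp add: set_integral_add(2)[OF vi] set_integral_add(2)[OF eti ci])
  also have "(LBINT s:{0<..\<tau>}. e s) \<le> E"
    using \<tau> e0 by (intro order_trans[OF set_integral_mono_set[OF ei] eE]) auto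
  also have "(LBINT s:{0<..\<tau>}. C2 * E) \<le> C2 * T * E"
    using \<tau> mult_right_mono[of \<tau> T "C2 * E"] C E0 by (simp add: set_lebesgue_integral_def mult_ac)
  finally have Bq: "k2 * (LBINT s. LBINT r. f r s)
      \<le> (LBINT s:{0<..\<tau>}. indicator P (\<tau> - s) * v s) + (E + C2 * T * E)" by simp
  have "k2 * (m * (LBINT r:{0<..\<tau>}. indicator S (\<tau> - r) * v r))
      \<le> (LBINT s:{0<..\<tau>}. indicator P (\<tau> - s) * v s) + (E + C2 * T * E)"
    by (rule order_trans[OF mult_left_mono[OF A k(2)] Bq])
  then have "k1 * (k2 * (m * (LBINT r:{0<..\<tau>}. indicator S (\<tau> - r) * v r)))
      \<le> k1 * ((LBINT s:{0<..\<tau>}. indicator P (\<tau> - s) * v s) + (E + C2 * T * E))"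
    by (intro mult_left_mono k)
  also have "\<dots> \<le> v \<tau> + e \<tau> + C1 * E + k1 * (E + C2 * T * E)"
    using 1 \<tau> by (auto simp: renewal_ineq_def algebra_simps)
  finally show "k1 * k2 * m * (LBINT r:{0<..\<tau>}. indicator S (\<tau> - r) * v r)
      \<le> v \<tau> + e \<tau> + (C1 + k1 * (1 + C2 * T)) * E"
    by (simp add: algebra_simps)
qed

text \<open>
  The interval is shrunk to \<open>[a',b']\<close> because the convolution of two interval indicators vanishes at the
  ends of the sum of the intervals; well inside it has a positive lower bound.
\<close>

lemma renewal_ineq_interval_power:
  assumes ab: "0 \<le> a" "a < a'" "a' < b'" "b' < b" and T: "0 < T" and k: "0 < k" and C: "0 \<le> C"
  shows "\<exists>k'>0. \<exists>C'\<ge>0. \<forall>v e E. renewal_data T v e E \<longrightarrow> renewal_ineq T {a..b} k C v e E \<longrightarrow>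
    renewal_ineq T {real (Suc j) * a'..real (Suc j) * b'} k' C' v e E"
proof (induction j)
  case 0
  have "renewal_ineq T {a'..b'} k C v e E" if dat: "renewal_data T v e E" and ine:
      "renewal_ineq T {a..b} k C v e E" for v e E
    unfolding renewal_ineq_def
  proof
    fix \<tau> assume \<tau>: "\<tau> \<in> {0<..T}"
    from dat obtain B where v [measurable]: "v \<in> borel_measurable borel" and v0: "\<And>s. 0 \<le> v s" and vB:
        "\<And>s. v s \<le> B"
      by (auto simp: renewal_data_def)
    have B0: "0 \<le> B" using v0[of 0] vB[of 0] by linarith
    have i: "set_integrable lborel {0<..\<tau>} (\<lambda>s. indicator {x..y} (\<tau> - s) * v s)" for x y
      by (rule set_integrable_Ioc_bounded[of _ _ _ B]) (use v0 vB B0 in \<open>auto simp: indicator_def\<close>)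
    have "(LBINT s:{0<..\<tau>}. indicator {a'..b'} (\<tau> - s) * v s)
        \<le> (LBINT s:{0<..\<tau>}. indicator {a..b} (\<tau> - s) * v s)"
      by (rule set_integral_mono[OF i i]) (use ab v0 in \<open>auto simp: indicator_def\<close>)
    then show "k * (LBINT s:{0<..\<tau>}. indicator {a'..b'} (\<tau> - s) * v s) \<le> v \<tau> + e \<tau> + C * E"
      using ine \<tau> k by (auto simp: renewal_ineq_def intro: order_trans[OF mult_left_mono])
  qed
  then show ?case using k C by auto
next
  case (Suc j)
  then obtain k' C' where k': "k' > 0" "C' \<ge> 0"
    and IH: "\<And>v e E. renewal_data T v e E \<Longrightarrow> renewal_ineq T {a..b} k C v e E \<Longrightarrow>
      renewal_ineq T {real (Suc j) * a'..real (Suc j) * b'} k' C' v e E" by blast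
  define m where "m = min (b - b') (min (a' - a) (b' - a'))"
  have m: "0 < m" using ab by (auto simp: m_def)
  have over: "m \<le> measure lborel ({a..b} \<inter> {x. y - x \<in> {real (Suc j) * a'..real (Suc j) * b'}})"
    if "y \<in> {real (Suc (Suc j)) * a'..real (Suc (Suc j)) * b'}" for y
  proof -
    have y: "real (Suc j) * a' + a' \<le> y" "y \<le> real (Suc j) * b' + b'"
      using that by (auto simp: algebra_simps)
    have j: "b' - a' \<le> real (Suc j) * b' - real (Suc j) * a'"
      using mult_right_mono[of 1 "real (Suc j)" "b' - a'"] ab by (simp add: algebra_simps)
    have "{a..b} \<inter> {x. y - x \<in> {real (Suc j) * a'..real (Suc j) * b'}}
        = {max a (y - real (Suc j) * b')..min b (y - real (Suc j) * a')}"
      by auto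
    moreover have "m \<le> min b (y - real (Suc j) * a') - max a (y - real (Suc j) * b')"
      using y j ab unfolding m_def by linarith
    moreover have "max a (y - real (Suc j) * b') \<le> min b (y - real (Suc j) * a')"
      using calculation(2) m by linarith
    ultimately show ?thesis by (metis measure_lborel_Icc)
  qed
  have *: "renewal_ineq T {real (Suc (Suc j)) * a'..real (Suc (Suc j)) * b'} (k * k' * m) (C
      + k * (1 + C' * T)) v e E"
    if "renewal_data T v e E" "renewal_ineq T {a..b} k C v e E" for v e E
    by (rule renewal_ineq_compose[OF that IH[OF that] _ _ _ _ T _ _ _ _ _ over])
        (use k k' m ab in \<open>auto intro: order_trans[of 0 "real (Suc j) * a'"]\<close>)
  show ?case
    by (intro exI[of _ "k * k' * m"] exI[of _ "C + k * (1 + C' * T)"] conjI allI impI *)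
       (use k k' m C T in auto)
qed

text \<open>
  An interval \<open>[a',b']\<close> contained in \<open>P + P\<close> has multiples \<open>[j a', j b']\<close> of any prescribed length \<open>W\<close>.
  The constants are independent of \<open>v\<close>, \<open>e\<close> and \<open>E\<close>, hence the same for all windows.
\<close>

lemma renewal_ineq_spreads:
  assumes P: "P \<in> sets borel" "P \<subseteq> {0<..}" "bounded P" "emeasure lborel P \<noteq> 0"
  obtains L where "0 < L" "\<And>T k. 0 < T \<Longrightarrow> 0 < k \<Longrightarrow>
     \<exists>k'>0. \<exists>C\<ge>0. \<forall>v e E. renewal_data T v e E \<longrightarrow> renewal_ineq T P k 0 v e E \<longrightarrow> renewal_ineq T {L..L + W} k' C v e E"
proof -
  obtain a b m where abm: "a < b" "0 < m" "\<And>y. y \<in> {a..b} \<Longrightarrow> m \<le> measure lborel (P \<inter> {x. y - x \<in> P})"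
    using sumset_contains_interval[OF P(1,3,4)] by metis
  have a0: "0 < a"
  proof -
    have "P \<inter> {x. a - x \<in> P} \<noteq> {}" using abm(3)[of a] abm(1,2) by auto
    then obtain x where "x \<in> P" "a - x \<in> P" by auto
    with P(2) have "0 < x" "0 < a - x" by auto
    then show ?thesis by linarith
  qed
  define a' where "a' = (2 * a + b) / 3"
  define b' where "b' = (a + 2 * b) / 3"
  have ab': "a < a'" "a' < b'" "b' < b" using abm(1) by (auto simp: a'_def b'_def)
  \<comment> \<open>The \<open>j\<close>-th multiple of \<open>[a',b']\<close> has length \<open>j (b' - a') > W\<close>.\<close>
  obtain j where j: "W / (b' - a') < real j" using reals_Archimedean2 by blast
  then have j: "real (Suc j) * a' + W \<le> real (Suc j) * b'"
    using ab' by (simp add: divide_less_eq algebra_simps)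
  show ?thesis
  proof (rule that[of "real (Suc j) * a'"])
    show "0 < real (Suc j) * a'" using a0 ab' by (intro mult_pos_pos) auto
    fix T k :: real assume T: "0 < T" and k: "0 < k"
    have 1: "renewal_ineq T {a..b} (k * k * m) (0 + k * (1 + 0 * T)) v e E"
      if "renewal_data T v e E" "renewal_ineq T P k 0 v e E" for v e E
      by (rule renewal_ineq_compose[OF that that(2) _ _ _ _ T _ _ _ _ _ abm(3)])
          (use k P abm(2) in \<open>auto intro: less_imp_le\<close>)
    obtain k' C' where k': "k' > 0" "C' \<ge> 0"
      and 2: "\<And>v e E. renewal_data T v e E \<Longrightarrow> renewal_ineq T {a..b} (k * k * m) (0 + k * (1 + 0 * T)) v e E \<Longrightarrow>
        renewal_ineq T {real (Suc j) * a'..real (Suc j) * b'} k' C' v e E"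
      using renewal_ineq_interval_power[OF less_imp_le[OF a0] ab' T, of "k * k * m"
          "0 + k * (1 + 0 * T)" j] k abm(2)
      by auto
    have "renewal_ineq T {real (Suc j) * a'..real (Suc j) * a' + W} k' C' v e E"
      if dat: "renewal_data T v e E" and ine: "renewal_ineq T P k 0 v e E" for v e E
      unfolding renewal_ineq_def
    proof
      fix \<tau> assume \<tau>: "\<tau> \<in> {0<..T}"
      from dat obtain B where v [measurable]: "v \<in> borel_measurable borel" and v0: "\<And>s. 0 \<le> v s" and vB:
          "\<And>s. v s \<le> B"
        by (auto simp: renewal_data_def)
      have B0: "0 \<le> B" using v0[of 0] vB[of 0] by linarith
      have i: "set_integrable lborel {0<..\<tau>} (\<lambda>s. indicator {x..y} (\<tau> - s) * v s)" for x y
        by (rule set_integrable_Ioc_bounded[of _ _ _ B]) (use v0 vB B0 in \<open>auto simp: indicator_def\<close>)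
      have "(LBINT s:{0<..\<tau>}. indicator {real (Suc j) * a'..real (Suc j) * a' + W} (\<tau> - s) * v s)
          \<le> (LBINT s:{0<..\<tau>}. indicator {real (Suc j) * a'..real (Suc j) * b'} (\<tau> - s) * v s)"
        by (rule set_integral_mono[OF i i]) (use j v0 in \<open>auto simp: indicator_def\<close>)
      then show "k' * (LBINT s:{0<..\<tau>}. indicator {real (Suc j) * a'..real (Suc j) * a' + W} (\<tau> - s) * v s)
          \<le> v \<tau> + e \<tau> + C' * E"
        using 2[OF dat 1[OF dat ine]] \<tau> k' by
            (auto simp: renewal_ineq_def intro: order_trans[OF mult_left_mono])
    qed
    then show "\<exists>k'>0. \<exists>C\<ge>0. \<forall>v e E. renewal_data T v e E \<longrightarrow> renewal_ineq T P k 0 v e E \<longrightarrow>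
        renewal_ineq T {real (Suc j) * a'..real (Suc j) * a' + W} k' C v e E"
      using k' by auto
  qed
qed

text \<open>
  For \<open>\<tau> \<in> (L + h, L + 2h]\<close> and \<open>s \<in> (0,h]\<close> the lag \<open>\<tau> - s\<close> lies in \<open>[L, L + 2h]\<close>, so both functions are
  bounded below at \<open>\<tau>\<close> by their integrals over \<open>(0,h]\<close>. As one of them vanishes at \<open>\<tau>\<close>, the smaller
  integral is an error term.
\<close>

lemma renewal_ineq_min:
  assumes dat: "renewal_data (L + 2 * h) v1 e E" "renewal_data (L + 2 * h) v2 e E"
    and ine: "renewal_ineq (L + 2 * h) {L..L + 2 * h} k C v1 e E"
        "renewal_ineq (L + 2 * h) {L..L + 2 * h} k C v2 e E"
    and zero: "\<And>s. min (v1 s) (v2 s) = 0" and pos: "0 < h" "0 < L" "0 < k" "0 \<le> C"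
  shows "k * h * min (LBINT s:{0<..h}. v1 s) (LBINT s:{0<..h}. v2 s) \<le> (1 + C * h) * E"
proof -
  from dat have e [measurable]: "e \<in> borel_measurable borel" and e0: "\<And>s. 0 \<le> e s"
    and ei: "set_integrable lborel {0<..L + 2 * h} e" and eE: "(LBINT s:{0<..L + 2 * h}. e s) \<le> E"
    by (auto simp: renewal_data_def)
  define X where "X = min (LBINT s:{0<..h}. v1 s) (LBINT s:{0<..h}. v2 s)"
  have low: "k * (LBINT s:{0<..h}. v s) \<le> v \<tau> + e \<tau> + C * E"
    if dat: "renewal_data (L + 2 * h) v e E" and ine: "renewal_ineq (L + 2 * h) {L..L + 2 * h} k C v e E"
      and \<tau>: "\<tau> \<in> {L + h<..L + 2 * h}" for v \<tau>
  proof -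
    from dat obtain B where v [measurable]: "v \<in> borel_measurable borel" and v0: "\<And>s. 0 \<le> v s" and vB:
        "\<And>s. v s \<le> B"
      by (auto simp: renewal_data_def)
    have B0: "0 \<le> B" using v0[of 0] vB[of 0] by linarith
    have i: "set_integrable lborel {0<..\<tau>} (\<lambda>s. indicator {L..L + 2 * h} (\<tau> - s) * v s)"
      by (rule set_integrable_Ioc_bounded[of _ _ _ B]) (use v0 vB B0 in \<open>auto simp: indicator_def\<close>)
    have "(LBINT s:{0<..h}. v s) = (LBINT s:{0<..h}. indicator {L..L + 2 * h} (\<tau> - s) * v s)"
      by (rule set_lebesgue_integral_cong) (use \<tau> pos in \<open>auto simp: indicator_def\<close>)
    also have "\<dots> \<le> (LBINT s:{0<..\<tau>}. indicator {L..L + 2 * h} (\<tau> - s) * v s)"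
      by (rule set_integral_mono_set[OF i]) (use \<tau> pos v0 in \<open>auto simp: indicator_def\<close>)
    finally have "k * (LBINT s:{0<..h}. v s) \<le> k * (LBINT s:{0<..\<tau>}. indicator {L..L + 2 * h} (\<tau> - s) * v s)"
      using pos by (intro mult_left_mono) auto
    also have "\<dots> \<le> v \<tau> + e \<tau> + C * E" using ine \<tau> pos by (auto simp: renewal_ineq_def)
    finally show ?thesis .
  qed
  have pt: "k * X - C * E \<le> e \<tau>" if "\<tau> \<in> {L + h<..L + 2 * h}" for \<tau>
  proof -
    have "k * X \<le> k * (LBINT s:{0<..h}. v1 s)" "k * X \<le> k * (LBINT s:{0<..h}. v2 s)"
      unfolding X_def using pos by (auto intro!: mult_left_mono)
    then show ?thesis using low[OF dat(1) ine(1) that] low[OF dat(2) ine(2) that] zero[of \<tau>] by linarith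
  qed
  have ei': "set_integrable lborel {L + h<..L + 2 * h} e"
    by (rule set_integrable_subset[OF ei]) (use pos in auto)
  have c: "set_integrable lborel {L + h<..L + 2 * h} (\<lambda>_. k * X - C * E)"
    by (rule set_integrable_Ioc_bounded[of _ _ _ "\<bar>k * X - C * E\<bar>"]) auto
  have "(LBINT \<tau>:{L + h<..L + 2 * h}. k * X - C * E) = h * (k * X - C * E)"
    using pos by (simp add: set_lebesgue_integral_def)
  then have "h * (k * X - C * E) \<le> (LBINT \<tau>:{L + h<..L + 2 * h}. e \<tau>)"
    using set_integral_mono[OF c ei'] pt by simp
  also have "\<dots> \<le> (LBINT \<tau>:{0<..L + 2 * h}. e \<tau>)"
    by (rule set_integral_mono_set[OF ei]) (use pos e0 in auto)
  finally show ?thesis using eE unfolding X_def by (simp add: algebra_simps)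
qed

section \<open>Populations along characteristics\<close>

text \<open>
  Nonpositive ages get the rate 0: an individual that is not yet born is not lost. Monotonicity and the
  Lipschitz bound are required for all real levels, beyond \<open>[0,rM]\<close> too, so that no side conditions arise.
\<close>

locale decreasing_rate =
  fixes rM C :: real and \<rho> :: "real \<Rightarrow> real \<Rightarrow> real"
  assumes rM_pos: "0 < rM" and C_nonneg: "0 \<le> C"
    and rate_borel: "(\<lambda>p. \<rho> (fst p) (snd p)) \<in> borel_measurable borel"
    and rate_nonneg: "\<And>x J. 0 \<le> \<rho> x J" and rate_le: "\<And>x J. \<rho> x J \<le> rM"
    and rate_antimono: "\<And>x J K. J \<le> K \<Longrightarrow> \<rho> x K \<le> \<rho> x J"
    and rate_lipschitz: "\<And>x J K. J \<le> K \<Longrightarrow> \<rho> x J - \<rho> x K \<le> C * (K - J)"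
    and rate_nonpos_age: "\<And>x J. x \<le> 0 \<Longrightarrow> \<rho> x J = 0"
begin

lemma rate_measurable [measurable]:
  assumes [measurable]: "f \<in> borel_measurable M" "g \<in> borel_measurable M"
  shows "(\<lambda>z. \<rho> (f z) (g z)) \<in> borel_measurable M"
  using measurable_compose[OF _ rate_borel, of "\<lambda>z. (f z, g z)" M] by simp

text \<open>
  The density at time \<open>t\<close> on the characteristic with label \<open>y\<close>, that is, at age \<open>y + t\<close>.
\<close>

definition along :: "(real \<Rightarrow> real) \<Rightarrow> (real \<Rightarrow> real) \<Rightarrow> real \<Rightarrow> real \<Rightarrow> real" where
  "along u I y t = u y * exp (- (LBINT s:{0<..t}. \<rho> (y + s) (I s)))"

text \<open>
  A solution in characteristic coordinates. For \<open>y \<le> 0\<close> the label is the negative of the birth time; at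
  time \<open>t\<close> the living individuals are those with \<open>y > -t\<close>.
\<close>

definition solution :: "(real \<Rightarrow> real) \<Rightarrow> (real \<Rightarrow> real) \<Rightarrow> bool" where
  "solution u I \<longleftrightarrow> u \<in> borel_measurable borel \<and> I \<in> borel_measurable borel \<and> (\<forall>y. 0 \<le> u y) \<and>
     (\<forall>s. 0 \<le> I s \<and> I s \<le> rM) \<and> (\<forall>y\<le>0. u y = I (- y)) \<and> set_integrable lborel {0<..} u \<and>
     (\<forall>t\<ge>0. (LBINT y:{-t<..}. along u I y t) = 1) \<and>
     (\<forall>t\<ge>0. (LBINT y:{-t<..}. \<rho> (y + t) (I t) * along u I y t) = I t)"

lemma along_measurable [measurable]:
  assumes [measurable]: "u \<in> borel_measurable borel" "I \<in> borel_measurable borel"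
    and [measurable]: "f \<in> borel_measurable M" "g \<in> borel_measurable M"
  shows "(\<lambda>z. along u I (f z) (g z)) \<in> borel_measurable M"
  unfolding along_def by measurable

lemma abs_rate: "\<bar>\<rho> x J\<bar> \<le> rM"
  using rate_nonneg[of x J] rate_le[of x J] by simp

lemma rate_Ioc_integrable:
  assumes [measurable]: "I \<in> borel_measurable borel"
  shows "set_integrable lborel {a<..b} (\<lambda>s. \<rho> (y + s) (I s))"
  by (rule set_integrable_Ioc_bounded[of _ _ _ rM]) (auto simp: abs_rate)

lemma along_split:
  assumes [measurable]: "I \<in> borel_measurable borel" and "0 \<le> s" "s \<le> t"
  shows "along u I y t = along u I y s * exp (- (LBINT v:{s<..t}. \<rho> (y + v) (I v)))"
  using set_integral_Ioc_split[OF assms(2,3) rate_Ioc_integrable[OF assms(1)]]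
  by (simp add: along_def exp_add[symmetric])

lemma along_before_birth:
  assumes "t \<le> - y" shows "along u I y t = u y"
proof -
  have "(LBINT s:{0<..t}. \<rho> (y + s) (I s)) = (LBINT s:{0<..t}. 0)"
    by (rule set_lebesgue_integral_cong) (use assms in \<open>auto intro!: rate_nonpos_age\<close>)
  then show ?thesis by (simp add: along_def)
qed

context
  fixes u I assumes sol: "solution u I"
begin

lemma solution_simps:
  shows u_meas: "u \<in> borel_measurable borel" and I_meas: "I \<in> borel_measurable borel"
    and u_nonneg: "0 \<le> u y" and I_nonneg: "0 \<le> I s" and I_le: "I s \<le> rM"
    and u_birth: "y \<le> 0 \<Longrightarrow> u y = I (- y)"
    and mass: "0 \<le> t \<Longrightarrow> (LBINT y:{-t<..}. along u I y t) = 1"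
    and births: "0 \<le> t \<Longrightarrow> (LBINT y:{-t<..}. \<rho> (y + t) (I t) * along u I y t) = I t"
  using sol by (auto simp: solution_def)

lemma along_nonneg: "0 \<le> along u I y t"
  by (simp add: along_def u_nonneg)

lemma along_le: "along u I y t \<le> u y"
proof -
  have "0 \<le> (LBINT s:{0<..t}. \<rho> (y + s) (I s))"
    by (rule set_integral_nonneg_real) (rule rate_nonneg)
  then show ?thesis using u_nonneg[of y] by (simp add: along_def mult_left_le)
qed

lemma u_integrable: "set_integrable lborel {a<..} u"
proof -
  note [measurable] = u_meas I_meas
  have "set_integrable lborel {a<..0} u"
    by (rule set_integrable_Ioc_bounded[of _ _ _ rM])
       (auto simp: u_birth I_nonneg I_le u_meas)
  moreover have "set_integrable lborel {0<..} u" using sol by (auto simp: solution_def)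
  ultimately have "set_integrable lborel ({a<..0} \<union> {0<..}) u" by (rule set_integrable_Un) auto
  then show ?thesis by (rule set_integrable_subset) auto
qed

text \<open>
  Everything along the characteristics is dominated by \<open>u\<close>, which is integrable on every half line.
\<close>

lemma bounded_times_along_integrable:
  assumes [measurable]: "g \<in> borel_measurable borel" "F \<in> borel_measurable borel"
    and S: "S \<in> sets borel" "S \<subseteq> {a<..}"
    and le: "\<And>y. \<bar>g y\<bar> \<le> B" "\<And>y. y \<in> S \<Longrightarrow> 0 \<le> F y" "\<And>y. y \<in> S \<Longrightarrow> F y \<le> u y"
  shows "set_integrable lborel S (\<lambda>y. g y * F y)"
proof (rule set_integrable_bound)
  show "set_integrable lborel S (\<lambda>y. B * u y)"
    using set_integrable_subset[OF u_integrable _ S(2)] S(1) by simp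
  show "set_borel_measurable lborel S (\<lambda>y. g y * F y)"
    unfolding set_borel_measurable_def using S(1) by measurable
  show "AE y in lborel. y \<in> S \<longrightarrow> norm (g y * F y) \<le> norm (B * u y)"
  proof (intro AE_I2 impI)
    fix y assume y: "y \<in> S"
    have "\<bar>g y\<bar> * \<bar>F y\<bar> \<le> B * u y"
      using le(1)[of y] le(2,3)[OF y] by (intro mult_mono) auto
    then show "norm (g y * F y) \<le> norm (B * u y)"
      unfolding real_norm_def abs_mult[of "g y"] using abs_ge_self[of "B * u y"] by linarith
  qed
qed

lemma along_evolution:
  assumes "0 \<le> s" "s \<le> t"
  shows "along u I y t \<le> along u I y s - (LBINT v:{s<..t}. \<rho> (y + v) (I v) * along u I y v)"
proof (rule decay_integral_upper[where M = rM and B = "u y"])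
  note [measurable] = u_meas I_meas
  show "(\<lambda>v. \<rho> (y + v) (I v)) \<in> borel_measurable borel" "(\<lambda>v. along u I y v) \<in> borel_measurable borel"
    by measurable
qed (use assms in \<open>auto simp: along_le along_nonneg I_meas rate_nonneg rate_le intro!: eq_refl[OF along_split]\<close>)

end

end


section \<open>Dissipation of the distance between two populations\<close>

text \<open>
  The part that the two populations have in common plays the role of a third population, with birth rate
  \<open>Imin\<close> and with the larger of the two loss rates.
\<close>

locale two_solutions = decreasing_rate +
  fixes u1 I1 u2 I2 :: "real \<Rightarrow> real"
  assumes sol1: "solution u1 I1" and sol2: "solution u2 I2"
begin

abbreviation "w1 \<equiv> along u1 I1"
abbreviation "w2 \<equiv> along u2 I2"

definition Imin :: "real \<Rightarrow> real" where "Imin s = min (I1 s) (I2 s)"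
definition common :: "real \<Rightarrow> real \<Rightarrow> real" where "common y t = min (w1 y t) (w2 y t)"

text \<open>
  Both masses being 1, this is half of the \<open>L\<^sup>1\<close> distance.
\<close>

definition excess :: "real \<Rightarrow> real" where "excess t = 1 - (LBINT y:{-t<..}. common y t)"

text \<open>
  Births minus losses of the common part. By lemma \<open>balance\<close> this is the rate at which the excess
  decreases, up to the slack.
\<close>

definition dissipation :: "real \<Rightarrow> real" where
    "dissipation t = Imin t - (LBINT y:{-t<..}. \<rho> (y + t) (Imin t) * common y t)"

text \<open>
  The smaller of the two densities may be lost at less than the rate \<open>\<rho>(\<cdot>,Imin)\<close>; the slack is what
  survives for this reason.
\<close>

definition slack :: "real \<Rightarrow> real \<Rightarrow> real \<Rightarrow> real" where
  "slack s t y = common y t - common y s + (LBINT v:{s<..t}. \<rho> (y + v) (Imin v) * common y v)"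

lemma swapped: "two_solutions rM C \<rho> u2 I2 u1 I1"
  by unfold_locales (fact sol2 sol1)+

lemmas [measurable] = u_meas[OF sol1] u_meas[OF sol2] I_meas[OF sol1] I_meas[OF sol2]

lemma Imin_measurable [measurable]: "Imin \<in> borel_measurable borel"
  unfolding Imin_def by measurable

lemma common_measurable [measurable]:
  assumes [measurable]: "f \<in> borel_measurable M" "g \<in> borel_measurable M"
  shows "(\<lambda>z. common (f z) (g z)) \<in> borel_measurable M"
  unfolding common_def by measurable

lemma slack_measurable [measurable]: "slack s t \<in> borel_measurable borel"
  unfolding slack_def[abs_def] by measurable

lemma Imin_bounds: "0 \<le> Imin s" "Imin s \<le> rM" "Imin s \<le> I1 s" "Imin s \<le> I2 s"
  using I_nonneg[OF sol1] I_le[OF sol1] I_nonneg[OF sol2] by (auto simp: Imin_def min_le_iff_disj)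

lemma common_bounds: "0 \<le> common y t" "common y t \<le> w1 y t" "common y t \<le> w2 y t" "common y t \<le> u1 y"
  using along_nonneg[OF sol1] along_nonneg[OF sol2] along_le[OF sol1, of y t]
  by (auto simp: common_def min_le_iff_disj)

lemma common_before_birth: "0 \<le> t \<Longrightarrow> t \<le> - y \<Longrightarrow> common y t = Imin (- y)"
  by (simp add: common_def Imin_def along_before_birth u_birth[OF sol1] u_birth[OF sol2])

text \<open>
  \<open>\<rho>(\<cdot>,Imin)\<close> dominates both loss rates, so both densities decay at most at this rate, hence so does their
  minimum.
\<close>

lemma common_decay:
  assumes "0 \<le> s" "s \<le> t"
  shows "common y s * exp (- (LBINT v:{s<..t}. \<rho> (y + v) (Imin v))) \<le> common y t"
proof -
  have mono: "common y s * exp (- (LBINT v:{s<..t}. \<rho> (y + v) (Imin v)))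
      \<le> along u I y s * exp (- (LBINT v:{s<..t}. \<rho> (y + v) (I v)))"
    if "\<And>v. Imin v \<le> I v" "common y s \<le> along u I y s" and [measurable]: "I \<in> borel_measurable borel" for u I
  proof (rule mult_mono)
    have "(LBINT v:{s<..t}. \<rho> (y + v) (I v)) \<le> (LBINT v:{s<..t}. \<rho> (y + v) (Imin v))"
      by (rule set_integral_mono) (auto intro!: rate_Ioc_integrable rate_antimono that)
    then show "exp (- (LBINT v:{s<..t}. \<rho> (y + v) (Imin v))) \<le> exp (- (LBINT v:{s<..t}. \<rho> (y + v) (I v)))"
        by simp
    show "0 \<le> along u I y s" using that(2) common_bounds(1) order_trans by blast
  qed (use that in auto)
  show ?thesis
    using mono[of I1 u1] mono[of I2 u2] Imin_bounds common_bounds[of y s]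
      along_split[OF I_meas[OF sol1] assms] along_split[OF I_meas[OF sol2] assms]
    by (simp add: common_def[of y t])
qed

lemma common_evolution:
  assumes "0 \<le> s" "s \<le> t"
  shows "common y s - (LBINT v:{s<..t}. \<rho> (y + v) (Imin v) * common y v) \<le> common y t"
  by (rule decay_integral_lower[where M = rM and B = "u1 y"])
     (use assms in \<open>auto simp: common_bounds rate_nonneg rate_le intro!: common_decay\<close>)

lemma slack_nonneg: "0 \<le> s \<Longrightarrow> s \<le> t \<Longrightarrow> 0 \<le> slack s t y"
  using common_evolution[of s t y] by (simp add: slack_def)

lemma common_integrable:
  assumes [measurable]: "g \<in> borel_measurable borel" and "\<And>y. \<bar>g y\<bar> \<le> B" "S \<in> sets borel" "S \<subseteq> {a<..}"
  shows "set_integrable lborel S (\<lambda>y. g y * common y t)"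
  by (rule bounded_times_along_integrable[OF sol1, of _ _ _ a B]) (use assms common_bounds in auto)

lemma w1_integrable:
  assumes [measurable]: "g \<in> borel_measurable borel" and "\<And>y. \<bar>g y\<bar> \<le> B" "S \<in> sets borel" "S \<subseteq> {a<..}"
  shows "set_integrable lborel S (\<lambda>y. g y * w1 y t)"
  by (rule bounded_times_along_integrable[OF sol1, of _ _ _ a B])
     (use assms along_le[OF sol1] along_nonneg[OF sol1] in auto)

lemma excess_eq: assumes "0 \<le> t" shows "excess t = (LBINT y:{-t<..}. w1 y t - common y t)"
  using w1_integrable[of "\<lambda>_. 1" 1 "{-t<..}" "-t" t] common_integrable[of "\<lambda>_. 1" 1 "{-t<..}" "-t" t]
  by (simp add: excess_def set_integral_diff mass[OF sol1 assms])

lemma excess_nonneg: assumes "0 \<le> t" shows "0 \<le> excess t"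
  unfolding excess_eq[OF assms] by (rule set_integral_nonneg_real) (simp add: common_bounds)

text \<open>
  The individuals born after time \<open>v\<close> have age at most 0 at time \<open>v\<close> and rate 0; so the inner domain
  \<open>y > -t\<close> may be replaced by the population \<open>y > -v\<close> that is alive.
\<close>

lemma loss_exchange:
  assumes "0 \<le> s"
  shows "(LBINT y:{-t<..}. LBINT v:{s<..t}. \<rho> (y + v) (Imin v) * common y v)
      = (LBINT v:{s<..t}. LBINT y:{-v<..}. \<rho> (y + v) (Imin v) * common y v)"
    and "set_integrable lborel {-t<..} (\<lambda>y. LBINT v:{s<..t}. \<rho> (y + v) (Imin v) * common y v)"
    and "set_integrable lborel {s<..t} (\<lambda>v. LBINT y:{-v<..}. \<rho> (y + v) (Imin v) * common y v)"
proof -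
  define f where "f y v = indicator {-t<..} y * (indicator {s<..t} v * (\<rho> (y + v) (Imin v) * common y v))"
      for y v
  have fm: "(\<lambda>p. f (fst p) (snd p)) \<in> borel_measurable borel"
    unfolding f_def borel_prod[symmetric] by measurable
  have b: "integrable lborel (\<lambda>y. rM * (indicator {-t<..} y * u1 y))"
    using u_integrable[OF sol1, of "-t"] by (simp add: set_integrable_def)
  have c: "integrable lborel (indicat_real {s<..t})"
    by (cases "s \<le> t") (auto intro!: integrable_real_indicator)
  have le: "\<bar>f y v\<bar> \<le> rM * (indicator {-t<..} y * u1 y) * indicator {s<..t} v" for y v
  proof -
    have "\<rho> (y + v) (Imin v) * common y v \<le> rM * u1 y"
      using rM_pos by (intro mult_mono rate_le common_bounds) auto
    moreover have "0 \<le> \<rho> (y + v) (Imin v) * common y v" by (simp add: rate_nonneg common_bounds)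
    ultimately show ?thesis by (auto simp: f_def indicator_def)
  qed
  note fub = fubini_dominated[OF fm b c le]
  have 1: "(LBINT v. f y v) = indicator {-t<..} y * (LBINT v:{s<..t}. \<rho> (y + v) (Imin v) * common y v)" for y
    by (simp add: f_def set_lebesgue_integral_def)
  have 2: "(LBINT y. f y v) = indicator {s<..t} v * (LBINT y:{-v<..}. \<rho> (y + v) (Imin v) * common y v)" for v
    unfolding set_lebesgue_integral_def integral_mult_right_zero[symmetric]
    by (rule Bochner_Integration.integral_cong)
       (auto simp: f_def indicator_def rate_nonpos_age)
  show "(LBINT y:{-t<..}. LBINT v:{s<..t}. \<rho> (y + v) (Imin v) * common y v)
      = (LBINT v:{s<..t}. LBINT y:{-v<..}. \<rho> (y + v) (Imin v) * common y v)"
    using fub(1) by (simp add: 1 2 set_lebesgue_integral_def)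
  show "set_integrable lborel {-t<..} (\<lambda>y. LBINT v:{s<..t}. \<rho> (y + v) (Imin v) * common y v)"
    using fub(2) by (simp add: 1 set_integrable_def)
  show "set_integrable lborel {s<..t} (\<lambda>v. LBINT y:{-v<..}. \<rho> (y + v) (Imin v) * common y v)"
    using fub(3) by (simp add: 2 set_integrable_def)
qed

lemma dissipation_measurable [measurable]: "dissipation \<in> borel_measurable borel"
proof -
  have "(\<lambda>v. LBINT y. (if - v < y then \<rho> (y + v) (Imin v) * common y v else 0)) \<in> borel_measurable borel"
      by measurable
  moreover have "(LBINT y:{-v<..}. \<rho> (y + v) (Imin v) * common y v)
      = (LBINT y. (if - v < y then \<rho> (y + v) (Imin v) * common y v else 0))" for v
    unfolding set_lebesgue_integral_def by (rule Bochner_Integration.integral_cong) (auto simp: indicator_def)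
  ultimately show ?thesis unfolding dissipation_def by simp
qed

lemma Imin_integrable: "set_integrable lborel {s<..t} Imin"
  by (rule set_integrable_Ioc_bounded[of _ _ _ rM]) (use Imin_bounds in auto)

lemma dissipation_integrable: assumes "0 \<le> s" shows "set_integrable lborel {s<..t} dissipation"
  unfolding dissipation_def by (rule set_integral_diff(1)[OF Imin_integrable loss_exchange(3)[OF assms]])

text \<open>
  The integral over the labels of the definition of the slack. The labels \<open>-t < y \<le> -s\<close> are the births
  between \<open>s\<close> and \<open>t\<close>; there the common part is \<open>Imin(-y)\<close>.
\<close>

lemma balance:
  assumes s: "0 \<le> s" and st: "s \<le> t"
  shows "excess s - excess t = (LBINT v:{s<..t}. dissipation v) + (LBINT y:{-t<..}. slack s t y)"
    and "set_integrable lborel {-t<..} (slack s t)"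
proof -
  have i: "set_integrable lborel S (\<lambda>y. common y v)" if "S \<in> sets borel" "S \<subseteq> {-t<..}" for v S
    using common_integrable[of "\<lambda>_. 1" 1 S "-t" v] that by simp
  show slack_i: "set_integrable lborel {-t<..} (slack s t)"
    unfolding slack_def by (intro set_integral_add(1) set_integral_diff(1) i loss_exchange(2)[OF s]) auto
  have "(LBINT y:{-t<..}. slack s t y) = (LBINT y:{-t<..}. common y t) - (LBINT y:{-t<..}. common y s)
      + (LBINT y:{-t<..}. LBINT v:{s<..t}. \<rho> (y + v) (Imin v) * common y v)"
    unfolding slack_def using i[of "{-t<..}"] loss_exchange(2)[OF s, of t]
    by (simp add: set_integral_add(2) set_integral_diff)
  also have "(LBINT y:{-t<..}. common y s) = (LBINT y:{-t<..-s}. common y s) + (LBINT y:{-s<..}. common y s)"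
  proof -
    have "{-t<..} = {-t<..-s} \<union> {-s<..}" using st by auto
    moreover have "{-t<..-s} \<inter> {-s<..} = {}" by auto
    ultimately show ?thesis
      using set_integral_Un[of "{-t<..-s}" "{-s<..}" lborel "\<lambda>y. common y s"] i st by auto
  qed
  also have "(LBINT y:{-t<..-s}. common y s) = (LBINT y:{-t<..-s}. Imin (- y))"
    by (rule set_lebesgue_integral_cong) (use s in \<open>auto intro!: common_before_birth\<close>)
  also have "\<dots> = (LBINT v:{s<..t}. Imin v)" by (rule set_integral_Ioc_reflect) measurable
  finally have "(LBINT y:{-t<..}. slack s t y)
      = excess s - excess t - ((LBINT v:{s<..t}. Imin v) - (LBINT v:{s<..t}. LBINT y:{-v<..}. \<rho> (y + v) (Imin v) * common y v))"
    by (simp add: excess_def loss_exchange(1)[OF s])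
  also have "(LBINT v:{s<..t}. Imin v) - (LBINT v:{s<..t}. LBINT y:{-v<..}. \<rho> (y + v) (Imin v) * common y v)
      = (LBINT v:{s<..t}. dissipation v)"
    unfolding dissipation_def by (rule set_integral_diff(2)[OF Imin_integrable loss_exchange(3)[OF s], symmetric])
  finally show "excess s - excess t = (LBINT v:{s<..t}. dissipation v) + (LBINT y:{-t<..}. slack s t y)" by simp
qed

text \<open>
  The smaller birth rate is \<open>I1 t\<close>, so \<open>Imin t\<close> is the total loss of the first population at the very rate
  at which the common part is lost. The difference is the loss of what the first population has in excess.
\<close>

lemma dissipation_lower1:
  assumes t: "0 \<le> t" and le: "I1 t \<le> I2 t"
  shows "(LBINT y:{-t<..}. \<rho> (y + t) rM * (w1 y t - common y t)) \<le> dissipation t"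
proof -
  have Imin: "Imin t = I1 t" using le by (simp add: Imin_def)
  note iw = w1_integrable[of "\<lambda>y. \<rho> (y + t) J" rM "{-t<..}" "-t" t for J]
  note icommon = common_integrable[of "\<lambda>y. \<rho> (y + t) J" rM "{-t<..}" "-t" t for J]
  have "(LBINT y:{-t<..}. \<rho> (y + t) rM * (w1 y t - common y t))
      \<le> (LBINT y:{-t<..}. \<rho> (y + t) (I1 t) * (w1 y t - common y t))"
  proof (rule set_integral_mono)
    have "set_integrable lborel {-t<..} (\<lambda>y. \<rho> (y + t) J * (w1 y t - common y t))" for J
      unfolding right_diff_distrib by (intro set_integral_diff(1) iw icommon) (auto simp: abs_rate)
    then show "set_integrable lborel {-t<..} (\<lambda>y. \<rho> (y + t) rM * (w1 y t - common y t))"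
      "set_integrable lborel {-t<..} (\<lambda>y. \<rho> (y + t) (I1 t) * (w1 y t - common y t))" by blast+
    show "\<rho> (y + t) rM * (w1 y t - common y t) \<le> \<rho> (y + t) (I1 t) * (w1 y t - common y t)" for y
      by (intro mult_right_mono rate_antimono I_le[OF sol1]) (simp add: common_bounds)
  qed
  also have "\<dots> = (LBINT y:{-t<..}. \<rho> (y + t) (I1 t) * w1 y t) - (LBINT y:{-t<..}. \<rho> (y
      + t) (I1 t) * common y t)"
    unfolding right_diff_distrib by (intro set_integral_diff(2) iw icommon) (auto simp: abs_rate)
  also have "\<dots> = dissipation t" by (simp add: births[OF sol1 t] dissipation_def Imin)
  finally show ?thesis .
qed

definition surplus :: "real \<Rightarrow> real" where "surplus s = I1 s - Imin s"

lemma surplus_measurable [measurable]: "surplus \<in> borel_measurable borel"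
  unfolding surplus_def by measurable

lemma surplus_bounds: "0 \<le> surplus s" "surplus s \<le> rM"
  using Imin_bounds[of s] I_le[OF sol1, of s] by (auto simp: surplus_def)

text \<open>
  The symmetry of the situation halves the work: each statement about the first population transfers to
  the second one.
\<close>

lemma swapped_eqs:
  "two_solutions.Imin I2 I1 = Imin" "two_solutions.common \<rho> u2 I2 u1 I1 = common"
  "two_solutions.excess \<rho> u2 I2 u1 I1 = excess" "two_solutions.dissipation \<rho> u2 I2 u1 I1 = dissipation"
proof -
  interpret sw: two_solutions rM C \<rho> u2 I2 u1 I1 by (rule swapped)
  show 1: "sw.Imin = Imin" by (rule ext) (simp add: Imin_def sw.Imin_def min.commute)
  show 2: "sw.common = common" by (intro ext) (simp add: common_def sw.common_def min.commute)
  show "sw.excess = excess" by (rule ext) (simp add: excess_def sw.excess_def 2)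
  show "sw.dissipation = dissipation" by (rule ext) (simp add: dissipation_def sw.dissipation_def 1 2)
qed

lemma dissipation_lower2:
  assumes "0 \<le> t" "I2 t \<le> I1 t"
  shows "(LBINT y:{-t<..}. \<rho> (y + t) rM * (w2 y t - common y t)) \<le> dissipation t"
  using two_solutions.dissipation_lower1[OF swapped assms] by (simp add: swapped_eqs)

lemma dissipation_nonneg: assumes t: "0 \<le> t" shows "0 \<le> dissipation t"
proof (cases "I1 t \<le> I2 t")
  case True
  have "0 \<le> (LBINT y:{-t<..}. \<rho> (y + t) rM * (w1 y t - common y t))"
    by (rule set_integral_nonneg_real) (simp add: rate_nonneg common_bounds)
  then show ?thesis using dissipation_lower1[OF t True] by simp
next
  case False
  have "0 \<le> (LBINT y:{-t<..}. \<rho> (y + t) rM * (w2 y t - common y t))"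
    by (rule set_integral_nonneg_real) (simp add: rate_nonneg common_bounds)
  then show ?thesis using dissipation_lower2[OF t] False by simp
qed

lemma integral_dissipation_le:
  assumes "0 \<le> s" "s \<le> t" shows "(LBINT v:{s<..t}. dissipation v) \<le> excess s - excess t"
proof -
  have "0 \<le> (LBINT y:{-t<..}. slack s t y)" by (rule set_integral_nonneg_real) (rule slack_nonneg[OF assms])
  then show ?thesis using balance(1)[OF assms] by simp
qed

lemma integral_slack_le:
  assumes "0 \<le> s" "s \<le> t" shows "(LBINT y:{-t<..}. slack s t y) \<le> excess s - excess t"
proof -
  have "0 \<le> (LBINT v:{s<..t}. dissipation v)" by (rule set_integral_nonneg_real)
      (use assms in \<open>auto intro: dissipation_nonneg\<close>)
  then show ?thesis using balance(1)[OF assms] by simp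
qed

lemma excess_antimono: assumes "0 \<le> s" "s \<le> t" shows "excess t \<le> excess s"
proof -
  have "0 \<le> (LBINT v:{s<..t}. dissipation v)" by (rule set_integral_nonneg_real)
      (use assms in \<open>auto intro: dissipation_nonneg\<close>)
  then show ?thesis using integral_dissipation_le[OF assms] by simp
qed

text \<open>
  Whichever population has the smaller birth rate, its part in excess has mass \<open>excess t\<close> and is lost at
  rate at least \<open>r0\<close>.
\<close>

lemma dissipation_ge_excess:
  assumes r0: "\<And>x. 0 < x \<Longrightarrow> r0 \<le> \<rho> x rM" and t: "0 \<le> t"
  shows "r0 * excess t \<le> dissipation t"
proof -
  have main: "r0 * (LBINT y:{-t<..}. along u I y t - common y t)
      \<le> (LBINT y:{-t<..}. \<rho> (y + t) rM * (along u I y t - common y t))"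
    if sol: "solution u I" and le: "\<And>y. common y t \<le> along u I y t" for u I
  proof -
    note [measurable] = u_meas[OF sol] I_meas[OF sol]
    have le': "along u I y t - common y t \<le> u y" for y
      using along_le[OF sol, of y t] common_bounds(1)[of y t] by linarith
    have i: "set_integrable lborel {-t<..} (\<lambda>y. g y * (along u I y t - common y t))"
      if "g \<in> borel_measurable borel" "\<And>y. \<bar>g y\<bar> \<le> B" for g B
      by (intro bounded_times_along_integrable[OF sol that(1), of _ _ "-t" B]) (use le le' that(2) in auto)
    have "(LBINT y:{-t<..}. r0 * (along u I y t - common y t))
        \<le> (LBINT y:{-t<..}. \<rho> (y + t) rM * (along u I y t - common y t))"
    proof (rule set_integral_mono)
      show "set_integrable lborel {-t<..} (\<lambda>y. r0 * (along u I y t - common y t))" by (rule i[of _ "\<bar>r0\<bar>"]) auto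
      show "set_integrable lborel {-t<..} (\<lambda>y. \<rho> (y + t) rM * (along u I y t - common y t))"
        by (rule i[of _ rM]) (auto simp: abs_rate)
    qed (use r0 le in \<open>auto intro!: mult_right_mono\<close>)
    then show ?thesis by simp
  qed
  show ?thesis
  proof (cases "I1 t \<le> I2 t")
    case True
    then show ?thesis using main[OF sol1] dissipation_lower1[OF t True] by
        (simp add: excess_eq[OF t] common_bounds)
  next
    case False
    have "excess t = (LBINT y:{-t<..}. w2 y t - common y t)"
      using two_solutions.excess_eq[OF swapped t] by (simp add: swapped_eqs)
    then show ?thesis using main[OF sol2] dissipation_lower2[OF t] False by (simp add: common_bounds)
  qed
qed

text \<open>
  As the excess is monotone, a step of length \<open>h\<close> divides it at least by \<open>1 + r0 h\<close>; with \<open>N\<close> steps of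
  length \<open>t/N\<close> the powers converge to the exponential function.
\<close>

lemma excess_exponential_decay:
  assumes r0: "\<And>x. 0 < x \<Longrightarrow> r0 \<le> \<rho> x rM" and pos: "0 < r0" and t: "0 \<le> t"
  shows "excess t \<le> exp (- r0 * t) * excess 0"
proof -
  have step: "excess (s + h) * (1 + r0 * h) \<le> excess s" if "0 \<le> s" "0 \<le> h" for s h
  proof -
    have "(LBINT v:{s<..s + h}. r0 * excess (s + h)) \<le> (LBINT v:{s<..s + h}. dissipation v)"
    proof (rule set_integral_mono)
      show "set_integrable lborel {s<..s + h} (\<lambda>v. r0 * excess (s + h))"
        by (rule set_integrable_Ioc_bounded[of _ _ _ "\<bar>r0 * excess (s + h)\<bar>"]) auto
      show "set_integrable lborel {s<..s + h} dissipation" by (rule dissipation_integrable[OF that(1)])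
      fix v assume v: "v \<in> {s<..s + h}"
      then have "r0 * excess (s + h) \<le> r0 * excess v" using pos that
          by (intro mult_left_mono excess_antimono) auto
      also have "\<dots> \<le> dissipation v" using dissipation_ge_excess[OF r0, of v] v that by auto
      finally show "r0 * excess (s + h) \<le> dissipation v" .
    qed
    then have "h * (r0 * excess (s + h)) \<le> excess s - excess (s + h)"
      using integral_dissipation_le[of s "s + h"] that by (simp add: set_integral_const_Ioc mult_ac)
    then show ?thesis by (simp add: algebra_simps)
  qed
  have pow: "excess t * (1 + r0 * t / real N) ^ N \<le> excess 0" if "0 < N" for N
  proof -
    define h where "h = t / real N"
    have h: "0 \<le> h" using t by (simp add: h_def)
    have "excess (real i * h) * (1 + r0 * h) ^ i \<le> excess 0" for i
    proof (induction i)
      case (Suc i)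
      have "excess (real (Suc i) * h) * (1 + r0 * h) ^ Suc i
          = excess (real i * h + h) * (1 + r0 * h) * (1 + r0 * h) ^ i"
        by (simp add: algebra_simps)
      also have "\<dots> \<le> excess (real i * h) * (1 + r0 * h) ^ i"
        using step[of "real i * h" h] h pos by (intro mult_right_mono) auto
      finally show ?case using Suc by simp
    qed simp
    from this[of N] show ?thesis using that by (simp add: h_def)
  qed
  have "(\<lambda>N. excess t * (1 + (r0 * t) / real N) ^ N) \<longlonglongrightarrow> excess t * exp (r0 * t)"
    by (intro tendsto_mult tendsto_const tendsto_exp_limit_sequentially)
  then have "excess t * exp (r0 * t) \<le> excess 0"
    by (rule LIMSEQ_le_const2) (use pow in \<open>auto intro!: exI[of _ 1]\<close>)
  then have "excess t * exp (r0 * t) * exp (- r0 * t) \<le> excess 0 * exp (- r0 * t)"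
      by (rule mult_right_mono) simp
  then show ?thesis by (simp add: exp_minus field_simps)
qed

lemma common_mass_le: assumes "0 \<le> t" "S \<in> sets borel" "S \<subseteq> {-t<..}" shows "(LBINT y:S. common y t) \<le> 1"
proof -
  have "(LBINT y:S. common y t) \<le> (LBINT y:{-t<..}. common y t)"
    using common_integrable[of "\<lambda>_. 1" 1 "{-t<..}" "-t" t] assms by (intro set_integral_mono_set)
        (auto simp: common_bounds)
  then show ?thesis using excess_nonneg[OF assms(1)] by (simp add: excess_def)
qed

text \<open>
  \<open>surplus t + dissipation t\<close> is the difference between the losses of the first population and those of
  the common part. The two rates in it differ by at most \<open>C * surplus t\<close>, which accounts for the factor
  \<open>1 + C\<close>.
\<close>

lemma excess_births_lower:
  assumes t: "0 \<le> t"
  shows "(LBINT y:{-t<..}. \<rho> (y + t) rM * (w1 y t - common y t)) \<le> (1 + C) * surplus t + dissipation t"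
proof -
  note iw = w1_integrable[of "\<lambda>y. \<rho> (y + t) J" rM "{-t<..}" "-t" t for J]
  note icommon = common_integrable[of "\<lambda>y. \<rho> (y + t) J" rM "{-t<..}" "-t" t for J]
  have i1: "set_integrable lborel {-t<..} (\<lambda>y. common y t)"
    using common_integrable[of "\<lambda>_. 1" 1 "{-t<..}" "-t" t] by simp
  have "(LBINT y:{-t<..}. \<rho> (y + t) rM * (w1 y t - common y t)) \<le>
    (LBINT y:{-t<..}. (\<rho> (y + t) (I1 t) * w1 y t - \<rho> (y + t) (Imin t) * common y t) + C * surplus t * common y t)"
  proof (rule set_integral_mono)
    show "set_integrable lborel {-t<..} (\<lambda>y. \<rho> (y + t) rM * (w1 y t - common y t))"
      unfolding right_diff_distrib by (intro set_integral_diff(1) iw icommon) (auto simp: abs_rate)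
    show "set_integrable lborel {-t<..} (\<lambda>y. (\<rho> (y + t) (I1 t) * w1 y t - \<rho> (y + t) (Imin t) * common y t)
        + C * surplus t * common y t)"
      using i1 by (intro set_integral_add(1) set_integral_diff(1) iw icommon) (auto simp: abs_rate)
    fix y
    have "\<rho> (y + t) rM * (w1 y t - common y t) \<le> \<rho> (y + t) (I1 t) * (w1 y t - common y t)"
      by (intro mult_right_mono rate_antimono I_le[OF sol1]) (simp add: common_bounds)
    moreover have "(\<rho> (y + t) (Imin t) - \<rho> (y + t) (I1 t)) * common y t \<le> C * surplus t * common y t"
      unfolding surplus_def by (intro mult_right_mono rate_lipschitz Imin_bounds common_bounds)
    ultimately show "\<rho> (y + t) rM * (w1 y t - common y t)
        \<le> (\<rho> (y + t) (I1 t) * w1 y t - \<rho> (y + t) (Imin t) * common y t) + C * surplus t * common y t"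
      by (simp add: algebra_simps)
  qed
  also have "\<dots> = (LBINT y:{-t<..}. \<rho> (y + t) (I1 t) * w1 y t) - (LBINT y:{-t<..}. \<rho> (y
      + t) (Imin t) * common y t) + (LBINT y:{-t<..}. C * surplus t * common y t)"
  proof -
    have a: "set_integrable lborel {-t<..} (\<lambda>y. \<rho> (y + t) (I1 t) * w1 y t)" by (rule iw) (auto simp: abs_rate)
    have b: "set_integrable lborel {-t<..} (\<lambda>y. \<rho> (y + t) (Imin t) * common y t)" by (rule icommon)
        (auto simp: abs_rate)
    have c: "set_integrable lborel {-t<..} (\<lambda>y. C * surplus t * common y t)" using i1 by simp
    show ?thesis by (simp only: set_integral_add(2)[OF set_integral_diff(1)[OF a b] c] set_integral_diff(2)[OF a b])
  qed
  also have "\<dots> = surplus t + dissipation t + C * surplus t * (LBINT y:{-t<..}. common y t)"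
    by (simp add: births[OF sol1 t] dissipation_def surplus_def)
  also have "\<dots> \<le> surplus t + dissipation t + C * surplus t * 1"
    using surplus_bounds C_nonneg by (intro add_left_mono mult_left_mono common_mass_le[OF t]) auto
  finally show ?thesis by (simp add: algebra_simps)
qed

text \<open>
  What the first population has in excess is lost at rate at most \<open>rM\<close>, or becomes common, and the latter
  is part of the slack. The proof compares the common part with its own minimal version \<open>F\<close>, which decays
  exactly at the rate \<open>\<rho>(\<cdot>,Imin)\<close>.
\<close>

lemma excess_survival:
  assumes s: "0 \<le> s" and st: "s \<le> t"
  shows "exp (- rM * (t - s)) * (w1 y s - common y s) - slack s t y \<le> w1 y t - common y t"
proof -
  define P where "P r = (LBINT v:{s<..r}. \<rho> (y + v) (Imin v))" for r
  define P1 where "P1 = (LBINT v:{s<..t}. \<rho> (y + v) (I1 v))"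
  define F where "F r = common y s * exp (- P r)" for r
  have P0: "0 \<le> P r" for r unfolding P_def by (rule set_integral_nonneg_real) (rule rate_nonneg)
  have P1le: "P1 \<le> P t" unfolding P1_def P_def
    by (rule set_integral_mono) (auto intro!: rate_Ioc_integrable rate_antimono Imin_bounds)
  have P1rM: "P1 \<le> rM * (t - s)" unfolding P1_def
    by (rule set_integral_Ioc_bounds(2)[where l = 0]) (use st in \<open>auto simp: rate_le rate_nonneg\<close>)
  have [measurable]: "F \<in> borel_measurable borel"
    unfolding F_def P_def by measurable
  have split: "P r' = P r + (LBINT v:{r<..r'}. \<rho> (y + v) (Imin v))" if "s \<le> r" "r \<le> r'" for r r'
    unfolding P_def by (rule set_integral_Ioc_split[OF that rate_Ioc_integrable]) measurable
  \<comment> \<open>The function \<open>F\<close> starts at the common part and lies below it.\<close>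
  have F_le: "F r \<le> common y s" for r using P0[of r] common_bounds(1)[of y s] by (simp add: F_def mult_left_le)
  have F0: "0 \<le> F r" for r by (simp add: F_def common_bounds)
  have "F s - (LBINT v:{s<..t}. \<rho> (y + v) (Imin v) * F v) \<le> F t"
  proof (rule decay_integral_lower[where M = rM and B = "common y s"])
    fix r r' assume "s \<le> r" "r \<le> r'"
    from split[OF this] show "F r * exp (- (LBINT v:{r<..r'}. \<rho> (y + v) (Imin v))) \<le> F r'"
      by (simp add: F_def mult.assoc exp_add[symmetric])
  qed (use st in \<open>simp_all add: rate_nonneg rate_le F_le F0\<close>)
  moreover have "F s = common y s" by (simp add: F_def P_def set_lebesgue_integral_def)
  moreover have "(LBINT v:{s<..t}. \<rho> (y + v) (Imin v) * F v)
      \<le> (LBINT v:{s<..t}. \<rho> (y + v) (Imin v) * common y v)"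
  proof (rule set_integral_mono)
    have bd: "\<bar>\<rho> (y + v) (Imin v) * x\<bar> \<le> rM * u1 y" if "0 \<le> x" "x \<le> u1 y" for v x
      unfolding abs_mult using abs_rate that rM_pos by (intro mult_mono) auto
    show "set_integrable lborel {s<..t} (\<lambda>v. \<rho> (y + v) (Imin v) * F v)"
      by (rule set_integrable_Ioc_bounded[of _ _ _ "rM * u1 y"])
         (auto intro!: bd F0 order_trans[OF F_le common_bounds(4)] intro: common_bounds(4))
    show "set_integrable lborel {s<..t} (\<lambda>v. \<rho> (y + v) (Imin v) * common y v)"
      by (rule set_integrable_Ioc_bounded[of _ _ _ "rM * u1 y"]) (auto intro!: bd simp: common_bounds)
    show "\<rho> (y + v) (Imin v) * F v \<le> \<rho> (y + v) (Imin v) * common y v" if "v \<in> {s<..t}" for v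
      using that s by (intro mult_left_mono rate_nonneg) (simp add: F_def P_def common_decay)
  qed
  ultimately have "common y s - common y s * exp (- P t) \<le> (LBINT v:{s<..t}. \<rho> (y + v) (Imin v) * common y v)"
    using F_def[of t] by linarith
  moreover have "common y s * exp (- P t) \<le> common y s * exp (- P1)"
    using P1le by (intro mult_left_mono common_bounds) auto
  moreover have "w1 y t = w1 y s * exp (- P1)"
    unfolding P1_def by (rule along_split[OF I_meas[OF sol1] s st])
  moreover have "exp (- rM * (t - s)) * (w1 y s - common y s) \<le> exp (- P1) * (w1 y s - common y s)"
    using P1rM by (intro mult_right_mono) (auto simp: common_bounds)
  ultimately show ?thesis by (simp add: slack_def algebra_simps)
qed

text \<open>
  The surplus births at time \<open>t + s\<close> are still in excess at time \<open>t + \<tau>\<close>, up to the factor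
  \<open>exp (- rM * T)\<close> and the slack, and are lost there at rate at least \<open>\<rho> (\<tau> - s) rM\<close>. By the bound on the
  losses of the part in excess, they cause surplus births again.
\<close>

lemma excess_renewal:
  assumes t: "0 \<le> t" and \<tau>: "0 < \<tau>" "\<tau> \<le> T"
  shows "exp (- rM * T) * (LBINT s:{0<..\<tau>}. \<rho> (\<tau> - s) rM * surplus (t + s))
      \<le> (1 + C) * surplus (t + \<tau>) + (dissipation (t + \<tau>) + rM * (excess t - excess (t + T)))"
proof -
  let ?b = "t + \<tau>"
  let ?S = "{- ?b<..-t}"
  have b: "0 \<le> ?b" using t \<tau> by simp
  have ri: "set_integrable lborel {-?b<..} (\<lambda>y. \<rho> (y + ?b) rM * (w1 y ?b - common y ?b))"
    unfolding right_diff_distrib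
    by (intro set_integral_diff(1) w1_integrable[of _ rM _ "-?b"] common_integrable[of _ rM _ "-?b"])
        (auto simp: abs_rate)
  have slack_i: "set_integrable lborel {-?b<..} (slack t ?b)" by (rule balance(2)) (use t \<tau> in auto)
  have slack_S: "set_integrable lborel ?S (slack t ?b)" by (rule set_integrable_subset[OF slack_i]) auto
  have vi: "set_integrable lborel ?S (\<lambda>y. exp (- rM * T) * (\<rho> (y + ?b) rM * surplus (- y)))"
  proof (rule set_integrable_Ioc_bounded)
    show "\<bar>exp (- rM * T) * (\<rho> (y + ?b) rM * surplus (- y))\<bar> \<le> 1 * (rM * rM)" for y
      unfolding abs_mult using \<tau> rM_pos surplus_bounds[of "-y"] by (intro mult_mono abs_rate) auto
  qed measurable
  have "(LBINT s:{0<..\<tau>}. \<rho> (\<tau> - s) rM * surplus (t + s))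
      = (LBINT s:{t + 0<..t + \<tau>}. \<rho> (?b - s) rM * surplus s)"
    unfolding set_integral_Ioc_shift by simp
  also have "\<dots> = (LBINT y:?S. \<rho> (?b - (- y)) rM * surplus (- y))"
    using set_integral_Ioc_reflect[of "\<lambda>s. \<rho> (?b - s) rM * surplus s" ?b t] by simp
  also have "\<dots> = (LBINT y:?S. \<rho> (y + ?b) rM * surplus (- y))" by (simp add: add.commute)
  finally have "exp (- rM * T) * (LBINT s:{0<..\<tau>}. \<rho> (\<tau> - s) rM * surplus (t + s))
      = (LBINT y:?S. exp (- rM * T) * (\<rho> (y + ?b) rM * surplus (- y)))"
    by simp
  also have "\<dots> \<le> (LBINT y:?S. \<rho> (y + ?b) rM * (w1 y ?b - common y ?b) + rM * slack t ?b y)"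
  proof (rule set_integral_mono[OF vi])
    show "set_integrable lborel ?S (\<lambda>y. \<rho> (y + ?b) rM * (w1 y ?b - common y ?b) + rM * slack t ?b y)"
      using slack_S by (intro set_integral_add(1) set_integrable_subset[OF ri]) auto
    fix y assume y: "y \<in> ?S"
    have th: "0 \<le> slack t ?b y" using t \<tau> by (intro slack_nonneg) auto
    have "w1 y t - common y t = surplus (- y)"
      using y t by (simp add: along_before_birth u_birth[OF sol1] common_before_birth surplus_def)
    then have "exp (- rM * \<tau>) * surplus (- y) \<le> w1 y ?b - common y ?b + slack t ?b y"
      using excess_survival[of t ?b y] t \<tau> by simp
    moreover have "exp (- rM * T) * surplus (- y) \<le> exp (- rM * \<tau>) * surplus (- y)"
      using \<tau> rM_pos surplus_bounds by (intro mult_right_mono) auto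
    ultimately have "\<rho> (y + ?b) rM * (exp (- rM * T) * surplus (- y))
        \<le> \<rho> (y + ?b) rM * (w1 y ?b - common y ?b + slack t ?b y)"
      by (intro mult_left_mono rate_nonneg) auto
    also have "\<dots> \<le> \<rho> (y + ?b) rM * (w1 y ?b - common y ?b) + rM * slack t ?b y"
      using mult_right_mono[OF rate_le th, of "y + ?b" rM] by (simp add: algebra_simps)
    finally show "exp (- rM * T) * (\<rho> (y + ?b) rM * surplus (- y))
        \<le> \<rho> (y + ?b) rM * (w1 y ?b - common y ?b) + rM * slack t ?b y"
      by (simp add: mult_ac)
  qed
  also have "\<dots> = (LBINT y:?S. \<rho> (y + ?b) rM * (w1 y ?b - common y ?b)) + rM * (LBINT y:?S. slack t ?b y)"
    using slack_S by (subst set_integral_add(2)) (auto intro!: set_integrable_subset[OF ri])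
  also have "\<dots> \<le> ((1 + C) * surplus ?b + dissipation ?b) + rM * (excess t - excess (t + T))"
  proof (rule add_mono)
    have "(LBINT y:?S. \<rho> (y + ?b) rM * (w1 y ?b - common y ?b))
        \<le> (LBINT y:{-?b<..}. \<rho> (y + ?b) rM * (w1 y ?b - common y ?b))"
      by (rule set_integral_mono_set[OF ri]) (auto simp: rate_nonneg common_bounds)
    then show "(LBINT y:?S. \<rho> (y + ?b) rM * (w1 y ?b - common y ?b)) \<le> (1 + C) * surplus ?b + dissipation ?b"
      using excess_births_lower[OF b] by simp
    have "(LBINT y:?S. slack t ?b y) \<le> (LBINT y:{-?b<..}. slack t ?b y)"
      by (rule set_integral_mono_set[OF slack_i]) (use t \<tau> in \<open>auto intro: slack_nonneg\<close>)
    also have "\<dots> \<le> excess t - excess ?b" by (rule integral_slack_le) (use t \<tau> in auto)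
    also have "\<dots> \<le> excess t - excess (t + T)" using excess_antimono[of ?b "t + T"] t \<tau> by simp
    finally show "rM * (LBINT y:?S. slack t ?b y) \<le> rM * (excess t - excess (t + T))" using rM_pos by simp
  qed
  finally show ?thesis by simp
qed

text \<open>
  An individual in excess at time \<open>t\<close> is older than \<open>t - s\<close>, or was a surplus birth after \<open>s\<close>, or was
  common at first. The last kind arises because the common part is lost faster than the first population,
  by at most \<open>C * surplus\<close> times the common mass, which is at most 1.
\<close>

lemma excess_le_excess_births:
  assumes s: "0 \<le> s" and st: "s \<le> t"
  shows "excess t \<le> (1 + C) * (LBINT v:{s<..t}. surplus v) + (LBINT y:{-s<..}. w1 y t)"
proof -
  let ?S = "{-t<..-s}"
  define f where "f y v = indicator ?S y * (indicator {s<..t} v * (if - v < y then surplus v * common y v else 0))" for y v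
  have t: "0 \<le> t" using s st by simp
  have fm: "(\<lambda>p. f (fst p) (snd p)) \<in> borel_measurable borel"
    unfolding f_def borel_prod[symmetric] by measurable
  have b: "integrable lborel (\<lambda>y. rM * (indicator ?S y * u1 y))"
  proof -
    have "set_integrable lborel ?S u1" by (rule set_integrable_subset[OF u_integrable[OF sol1, of "-t"]]) auto
    then show ?thesis by (simp add: set_integrable_def)
  qed
  have c: "integrable lborel (indicat_real {s<..t})" using st by (auto intro!: integrable_real_indicator)
  have le: "\<bar>f y v\<bar> \<le> rM * (indicator ?S y * u1 y) * indicator {s<..t} v" for y v
  proof -
    have "surplus v * common y v \<le> rM * u1 y"
      using rM_pos by (intro mult_mono surplus_bounds common_bounds) auto
    moreover have "0 \<le> surplus v * common y v" by (simp add: surplus_bounds common_bounds)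
    moreover have "0 \<le> rM * u1 y" using rM_pos u_nonneg[OF sol1] by simp
    ultimately show ?thesis by (auto simp: f_def indicator_def)
  qed
  note fub = fubini_dominated[OF fm b c le]
  have pt: "w1 y t - common y t \<le> surplus (- y) + C * (LBINT v. f y v)" if y: "y \<in> ?S" for y
  proof -
    have bd: "\<bar>\<rho> (y + v) J * x\<bar> \<le> rM * u1 y" if "0 \<le> x" "x \<le> u1 y" for v x J
      unfolding abs_mult using abs_rate that rM_pos by (intro mult_mono) auto
    have i1: "set_integrable lborel {s<..t} (\<lambda>v. \<rho> (y + v) (I1 v) * w1 y v)"
      by (rule set_integrable_Ioc_bounded[of _ _ _ "rM * u1 y"])
         (auto intro!: bd simp: along_nonneg[OF sol1] along_le[OF sol1])
    have i2: "set_integrable lborel {s<..t} (\<lambda>v. \<rho> (y + v) (Imin v) * common y v)"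
      by (rule set_integrable_Ioc_bounded[of _ _ _ "rM * u1 y"]) (auto intro!: bd simp: common_bounds)
    have "w1 y s - common y s = surplus (- y)"
      using y s by (simp add: along_before_birth u_birth[OF sol1] common_before_birth surplus_def)
    then have "w1 y t - common y t
        \<le> surplus (- y) + ((LBINT v:{s<..t}. \<rho> (y + v) (Imin v) * common y v) - (LBINT v:{s<..t}. \<rho> (y + v) (I1 v) * w1 y v))"
      using along_evolution[OF sol1 s st, of y] common_evolution[OF s st, of y] by simp
    also have "(LBINT v:{s<..t}. \<rho> (y + v) (Imin v) * common y v) - (LBINT v:{s<..t}. \<rho> (y + v) (I1 v) * w1 y v)
       = (LBINT v:{s<..t}. \<rho> (y + v) (Imin v) * common y v - \<rho> (y + v) (I1 v) * w1 y v)"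
      by (rule set_integral_diff(2)[OF i2 i1, symmetric])
    also have "\<dots> \<le> (LBINT v. C * f y v)"
      unfolding set_lebesgue_integral_def
    proof (rule integral_mono)
      show "integrable lborel (\<lambda>v. indicat_real {s<..t} v *\<^sub>R (\<rho> (y + v) (Imin v) * common y v - \<rho> (y
          + v) (I1 v) * w1 y v))"
        using set_integral_diff(1)[OF i2 i1] by (simp add: set_integrable_def)
      show "integrable lborel (\<lambda>v. C * f y v)" using fub(4)[of y] by simp
      fix v
      have "\<rho> (y + v) (Imin v) * common y v - \<rho> (y + v) (I1 v) * w1 y v
          \<le> C * (if - v < y then surplus v * common y v else 0)"
      proof (cases "- v < y")
        case True
        have "\<rho> (y + v) (I1 v) * common y v \<le> \<rho> (y + v) (I1 v) * w1 y v"
          by (intro mult_left_mono rate_nonneg common_bounds)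
        moreover have "(\<rho> (y + v) (Imin v) - \<rho> (y + v) (I1 v)) * common y v \<le> (C * surplus v) * common y v"
          unfolding surplus_def by (intro mult_right_mono rate_lipschitz Imin_bounds common_bounds)
        ultimately show ?thesis using True by (simp add: algebra_simps)
      qed (simp add: rate_nonpos_age)
      then show "indicat_real {s<..t} v *\<^sub>R (\<rho> (y + v) (Imin v) * common y v - \<rho> (y + v) (I1 v) * w1 y v)
          \<le> C * f y v"
        using y by (auto simp: f_def indicator_def)
    qed
    finally show ?thesis by simp
  qed
  have w1i: "set_integrable lborel {-t<..} (\<lambda>y. w1 y t - common y t)"
    using w1_integrable[of "\<lambda>_. 1" 1 "{-t<..}" "-t" t] common_integrable[of "\<lambda>_. 1" 1 "{-t<..}" "-t" t]
    by (auto intro!: set_integral_diff(1))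
  have vi: "set_integrable lborel ?S (\<lambda>y. surplus (- y))"
    by (rule set_integrable_Ioc_bounded[of _ _ _ rM]) (use surplus_bounds in auto)
  have fi: "set_integrable lborel ?S (\<lambda>y. C * (LBINT v. f y v))"
    unfolding set_integrable_def using fub(2) by (intro integrable_mult_indicator) auto
  have split: "excess t = (LBINT y:?S. w1 y t - common y t) + (LBINT y:{-s<..}. w1 y t - common y t)"
  proof -
    have "{-t<..} = ?S \<union> {-s<..}" using st by auto
    moreover have "?S \<inter> {-s<..} = {}" by auto
    ultimately show ?thesis unfolding excess_eq[OF t]
      using set_integral_Un[of ?S "{-s<..}" lborel "\<lambda>y. w1 y t - common y t"] set_integrable_subset[OF w1i]
          by auto
  qed
  have older: "(LBINT y:{-s<..}. w1 y t - common y t) \<le> (LBINT y:{-s<..}. w1 y t)"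
  proof (rule set_integral_mono)
    show "set_integrable lborel {-s<..} (\<lambda>y. w1 y t - common y t)"
      by (rule set_integrable_subset[OF w1i]) (use st in auto)
    show "set_integrable lborel {-s<..} (\<lambda>y. w1 y t)"
      using w1_integrable[of "\<lambda>_. 1" 1 "{-s<..}" "-s" t] by simp
  qed (simp add: common_bounds)
  have new: "(LBINT y:?S. w1 y t - common y t) \<le> (LBINT y:?S. surplus (- y) + C * (LBINT v. f y v))"
    by (rule set_integral_mono[OF _ set_integral_add(1)[OF vi fi] pt])
        (auto intro: set_integrable_subset[OF w1i])
  have new_eq: "(LBINT y:?S. surplus (- y) + C * (LBINT v. f y v)) = (LBINT y:?S. surplus (- y))
      + (LBINT y:?S. C * (LBINT v. f y v))"
    by (rule set_integral_add(2)[OF vi fi])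
  have born: "(LBINT y:?S. surplus (- y)) = (LBINT v:{s<..t}. surplus v)"
      by (rule set_integral_Ioc_reflect) measurable
  have gain: "(LBINT y:?S. C * (LBINT v. f y v)) \<le> C * (LBINT v:{s<..t}. surplus v)"
  proof -
    have "(LBINT y:?S. C * (LBINT v. f y v)) = C * (LBINT y. LBINT v. f y v)"
    proof -
      have "indicat_real ?S y *\<^sub>R (LBINT v. f y v) = (LBINT v. f y v)" for y
        by (cases "y \<in> ?S") (auto simp: f_def)
      then have "(LBINT y:?S. LBINT v. f y v) = (LBINT y. LBINT v. f y v)"
        by (simp only: set_lebesgue_integral_def)
      then show ?thesis by simp
    qed
    also have "(LBINT y. LBINT v. f y v) = (LBINT v. LBINT y. f y v)" by (rule fub(1))
    also have "\<dots> \<le> (LBINT v:{s<..t}. surplus v)"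
      unfolding set_lebesgue_integral_def
    proof (rule integral_mono[OF fub(3)])
      show "integrable lborel (\<lambda>v. indicat_real {s<..t} v *\<^sub>R surplus v)"
        using set_integrable_Ioc_bounded[of surplus s t rM] surplus_bounds by (simp add: set_integrable_def)
      fix v
      show "(LBINT y. f y v) \<le> indicat_real {s<..t} v *\<^sub>R surplus v"
      proof (cases "v \<in> {s<..t}")
        case True
        then have v: "0 \<le> v" using s by auto
        have "(LBINT y. f y v) = surplus v * (LBINT y:?S \<inter> {-v<..}. common y v)"
          unfolding set_lebesgue_integral_def integral_mult_right_zero[symmetric]
          by (rule Bochner_Integration.integral_cong) (use True in \<open>auto simp: f_def indicator_def\<close>)
        also have "\<dots> \<le> surplus v * 1" by (intro mult_left_mono common_mass_le[OF v] surplus_bounds) auto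
        finally show ?thesis using True by simp
      qed (simp add: f_def)
    qed
    finally show ?thesis using C_nonneg by (simp add: mult_left_mono)
  qed
  have "excess t \<le> (LBINT v:{s<..t}. surplus v) + C * (LBINT v:{s<..t}. surplus v) + (LBINT y:{-s<..}. w1 y t)"
    using split older new new_eq born gain by linarith
  then show ?thesis by (simp add: algebra_simps)
qed

end

section \<open>Convergence of two populations\<close>

context decreasing_rate begin

text \<open>
  The probability to reach age \<open>x\<close> under the smallest possible rate.
\<close>

definition survival :: "real \<Rightarrow> real" where "survival x = exp (- (LBINT s:{0<..x}. \<rho> s rM))"

lemma survival_pos: "0 < survival x" by (simp add: survival_def)

lemma cumulative_split:
  assumes "0 \<le> a" "a \<le> b"
  shows "(LBINT s:{0<..b}. \<rho> s rM) = (LBINT s:{0<..a}. \<rho> s rM) + (LBINT s:{a<..b}. \<rho> s rM)"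
  by (rule set_integral_Ioc_split) (use assms rate_Ioc_integrable[of "\<lambda>_. rM" _ _ 0] in simp_all)

lemma survival_antimono: assumes "a \<le> b" shows "survival b \<le> survival a"
proof -
  have "(LBINT s:{0<..a}. \<rho> s rM) \<le> (LBINT s:{0<..b}. \<rho> s rM)"
    by (rule set_integral_mono_set)
        (use assms rate_Ioc_integrable[of "\<lambda>_. rM" 0 b 0] in \<open>auto simp: rate_nonneg\<close>)
  then show ?thesis by (simp add: survival_def)
qed

lemma survival_borel [measurable]: "survival \<in> borel_measurable borel"
  unfolding survival_def[abs_def] by measurable

text \<open>
  A decreasing integrable function is at most its integral divided by \<open>x\<close>.
\<close>

lemma survival_at_top:
  assumes int: "set_integrable lborel {0<..} survival"
  shows "(survival \<longlongrightarrow> 0) at_top"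
proof -
  define M where "M = (LBINT x:{0<..}. survival x)"
  have le: "survival x \<le> M / x" if x: "0 < x" for x
  proof -
    have "survival x * (x - 0) \<le> (LBINT v:{0<..x}. survival v)"
      by (rule set_integral_Ioc_bounds(1)[where h = "survival 0"]) (use x in \<open>auto intro: survival_antimono\<close>)
    also have "\<dots> \<le> M" unfolding M_def
      by (rule set_integral_mono_set[OF int]) (auto intro: less_imp_le[OF survival_pos])
    finally show ?thesis using x by (simp add: field_simps)
  qed
  have lim: "((\<lambda>x. M / x) \<longlongrightarrow> 0) at_top"
    by (intro tendsto_divide_0[OF tendsto_const] filterlim_at_top_imp_at_infinity filterlim_ident)
  show ?thesis
    by (rule tendsto_sandwich[OF _ _ tendsto_const lim])
       (auto intro!: eventually_mono[OF eventually_gt_at_top[of 0]] le less_imp_le[OF survival_pos])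
qed

lemma along_le_survival:
  assumes sol: "solution u I" and t: "0 \<le> t"
  shows "along u I y t \<le> u y * (survival (max 0 (y + t)) / survival (max 0 y))"
proof -
  note [measurable] = u_meas[OF sol] I_meas[OF sol]
  have r: "set_integrable lborel {a<..b} (\<lambda>s. \<rho> (y + s) rM)" for a b
    by (rule rate_Ioc_integrable) simp
  have "(LBINT s:{max 0 y<..max 0 (y + t)}. \<rho> s rM) = (LBINT s:{y + 0<..y + t}. \<rho> s rM)"
    unfolding set_lebesgue_integral_def using t
    by (intro Bochner_Integration.integral_cong) (auto simp: indicator_def max_def rate_nonpos_age)
  also have "\<dots> = (LBINT s:{0<..t}. \<rho> (y + s) rM)" by (rule set_integral_Ioc_shift)
  also have "\<dots> \<le> (LBINT s:{0<..t}. \<rho> (y + s) (I s))"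
    by (rule set_integral_mono) (auto intro!: rate_Ioc_integrable rate_antimono I_le[OF sol])
  finally have le: "(LBINT s:{max 0 y<..max 0 (y + t)}. \<rho> s rM) \<le> (LBINT s:{0<..t}. \<rho> (y + s) (I s))" .
  have "survival (max 0 (y + t)) / survival (max 0 y) = exp (- (LBINT s:{max 0 y<..max 0 (y + t)}. \<rho> s rM))"
    using cumulative_split[of "max 0 y" "max 0 (y + t)"] t by (simp add: survival_def exp_diff[symmetric])
  then show ?thesis unfolding along_def using le u_nonneg[OF sol, of y] by (intro mult_left_mono) auto
qed

text \<open>
  At time \<open>t + h\<close> the labels \<open>y > -t\<close> are the ages above \<open>h\<close>. Those born after time 0 have density at most
  \<open>rM * survival x\<close> at age \<open>x\<close>, an integrable tail; the initial population dies out by dominated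
  convergence.
\<close>

lemma old_mass_small:
  assumes int: "set_integrable lborel {0<..} survival" and sol: "solution u I" and e: "0 < e"
  shows "\<exists>h0. \<forall>h\<ge>h0. \<forall>\<^sub>F t in at_top. (LBINT y:{-t<..}. along u I y (t + h)) < e"
proof -
  note [measurable] = u_meas[OF sol] I_meas[OF sol]
  have "((\<lambda>h. LBINT x. indicator {max 0 h<..} x * survival x) \<longlongrightarrow> integral\<^sup>L lborel (\<lambda>x::real. 0::real)) at_top"
  proof (rule integral_dominated_convergence_at_top)
    show "integrable lborel (\<lambda>x. indicator {0<..} x * survival x)" using int by (simp add: set_integrable_def)
    show "AE x in lborel. ((\<lambda>h. indicator {max 0 h<..} x * survival x) \<longlongrightarrow> 0) at_top"
    proof (rule AE_I2)
      fix x
      have "\<forall>\<^sub>F h in at_top. indicator {max 0 h<..} x * survival x = 0"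
        using eventually_ge_at_top[of x] by eventually_elim (auto simp: indicator_def)
      then show "((\<lambda>h. indicator {max 0 h<..} x * survival x) \<longlongrightarrow> 0) at_top" by (rule tendsto_eventually)
    qed
    show "\<forall>\<^sub>F h in at_top. AE x in lborel. norm (indicator {max 0 h<..} x * survival x)
        \<le> indicator {0<..} x * survival x"
      using survival_pos by (intro always_eventually allI AE_I2) (auto simp: indicator_def intro: less_imp_le)
  qed auto
  then have "\<forall>\<^sub>F h in at_top. (LBINT x. indicator {max 0 h<..} x * survival x) < e / (2 * rM)"
    by (rule order_tendstoD) (use e rM_pos in auto)
  then obtain h0 where h0: "\<And>h. h0 \<le> h \<Longrightarrow> (LBINT x. indicator {max 0 h<..} x * survival x) < e / (2 * rM)"
    by (auto simp: eventually_at_top_linorder)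
  have survival_0: "survival 0 = 1" by (simp add: survival_def set_lebesgue_integral_def)
  have old: "\<forall>\<^sub>F t in at_top. (LBINT y:{0<..}. along u I y t) < e / 2"
  proof -
    have "((\<lambda>t. LBINT y. indicator {0<..} y * along u I y t) \<longlongrightarrow> integral\<^sup>L lborel (\<lambda>y::real. 0::real)) at_top"
    proof (rule integral_dominated_convergence_at_top)
      show "integrable lborel (\<lambda>y. indicator {0<..} y * u y)" using u_integrable[OF sol, of 0] by
          (simp add: set_integrable_def)
      show "AE y in lborel. ((\<lambda>t. indicator {0<..} y * along u I y t) \<longlongrightarrow> 0) at_top"
      proof (rule AE_I2)
        fix y :: real
        have "filterlim (\<lambda>t. max 0 (y + t)) at_top at_top"
          by (rule filterlim_at_top_mono[OF filterlim_tendsto_add_at_top[OF tendsto_const[of y] filterlim_ident]])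
             (auto intro: always_eventually)
        then have "((\<lambda>t. survival (max 0 (y + t))) \<longlongrightarrow> 0) at_top"
          by (rule filterlim_compose[OF survival_at_top[OF int]])
        then have lim: "((\<lambda>t. u y * (survival (max 0 (y + t)) / survival (max 0 y))) \<longlongrightarrow> 0) at_top"
          by (auto intro!: tendsto_eq_intros)
             (use survival_pos[of "max 0 y"] in auto)
        have "((\<lambda>t. along u I y t) \<longlongrightarrow> 0) at_top"
          by (rule tendsto_sandwich[OF _ _ tendsto_const lim])
             (auto intro!: eventually_mono[OF eventually_ge_at_top[of 0]] along_le_survival[OF sol, simplified] simp: along_nonneg[OF sol])
        then show "((\<lambda>t. indicator {0<..} y * along u I y t) \<longlongrightarrow> 0) at_top" by (rule tendsto_mult_right_zero)
      qed
      show "\<forall>\<^sub>F t in at_top. AE y in lborel. norm (indicator {0<..} y * along u I y t)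
          \<le> indicator {0<..} y * u y"
        using along_le[OF sol] along_nonneg[OF sol] by (intro always_eventually allI AE_I2)
            (auto simp: indicator_def)
    qed auto
    from order_tendstoD(2)[OF this, of "e / 2"] show ?thesis using e by (simp add: set_lebesgue_integral_def)
  qed
  show ?thesis
  proof (intro exI[of _ "max 0 h0"] allI impI)
    fix h assume h: "max 0 h0 \<le> h"
    then have h_nn: "0 \<le> h" by simp
    have "\<forall>\<^sub>F t in at_top. (LBINT y:{0<..}. along u I y (t + h)) < e / 2"
      using filterlim_tendsto_add_at_top[OF tendsto_const[of h] filterlim_ident] old
      by (auto simp: filterlim_iff add.commute)
    with eventually_ge_at_top[of 0]
    show "\<forall>\<^sub>F t in at_top. (LBINT y:{-t<..}. along u I y (t + h)) < e"
    proof eventually_elim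
      case (elim t)
      have i: "set_integrable lborel T (\<lambda>y. along u I y (t + h))" if "T \<in> sets borel" "T \<subseteq> {-t<..}" for T
        using bounded_times_along_integrable[OF sol, of "\<lambda>_. 1" "\<lambda>y. along u I y (t + h)" T
            "-t" 1] that along_le[OF sol] along_nonneg[OF sol]
        by simp
      have "{-t<..} = {-t<..0} \<union> {0<..}" "{-t<..0} \<inter> {0<..} = {}" using elim by auto
      then have "(LBINT y:{-t<..}. along u I y (t + h)) = (LBINT y:{-t<..0}. along u I y (t + h))
          + (LBINT y:{0<..}. along u I y (t + h))"
        using set_integral_Un[of "{-t<..0}" "{0<..}" lborel "\<lambda>y. along u I y (t + h)"] i elim by auto
      moreover have "(LBINT y:{-t<..0}. along u I y (t + h)) < e / 2"
      proof -
        have int_h: "set_integrable lborel {h<..} survival" by (rule set_integrable_subset[OF int])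
            (use h_nn in auto)
        have int_th: "set_integrable lborel {h<..t + h} survival" by (rule set_integrable_subset[OF int_h]) auto
        have ii: "set_integrable lborel {-t<..0} (\<lambda>y. rM * survival ((t + h) + y))"
          using set_integrable_Ioc_shift[of "t + h" "-t" 0 survival] int_th by simp
        have "(LBINT y:{-t<..0}. along u I y (t + h)) \<le> (LBINT y:{-t<..0}. rM * survival ((t + h) + y))"
        proof (rule set_integral_mono[OF i ii])
          fix y assume y: "y \<in> {-t<..0}"
          have "along u I y (t + h) \<le> u y * survival (y + (t + h))"
          proof -
            have "max 0 y = 0" "max 0 (y + (t + h)) = y + (t + h)" "0 \<le> t + h" using y h_nn elim(1) by auto
            then show ?thesis using along_le_survival[OF sol, of "t + h" y] by (simp add: survival_0)
          qed
          also have "\<dots> \<le> rM * survival (y + (t + h))"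
            using y u_birth[OF sol, of y] I_le[OF sol, of "-y"] less_imp_le[OF survival_pos]
                by (intro mult_right_mono) auto
          finally show "along u I y (t + h) \<le> rM * survival ((t + h) + y)" by (simp add: add.commute)
        qed (use elim in auto)
        also have "\<dots> = rM * (LBINT x:{h<..t + h}. survival x)"
          using set_integral_Ioc_shift[of "t + h" "-t" 0 survival] by simp
        also have "\<dots> \<le> rM * (LBINT x:{h<..}. survival x)"
          using rM_pos by (intro mult_left_mono set_integral_mono_set[OF int_h])
              (auto intro: less_imp_le[OF survival_pos])
        also have "\<dots> < rM * (e / (2 * rM))"
          using h0[of h] h rM_pos unfolding max_absorb2[OF h_nn]
          by (intro mult_strict_left_mono) (auto simp: set_lebesgue_integral_def)
        finally show ?thesis using rM_pos by simp
      qed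
      ultimately show ?case using elim by simp
    qed
  qed
qed

text \<open>
  Otherwise \<open>\<rho>(\<cdot>,rM)\<close> vanishes almost everywhere, \<open>survival\<close> is constantly 1 and not integrable on a half
  line.
\<close>

lemma rate_positive_somewhere:
  assumes int: "set_integrable lborel {0<..} survival"
  obtains \<beta> X where "0 < \<beta>" "emeasure lborel {x. 0 < x \<and> x \<le> X \<and> \<beta> \<le> \<rho> x rM} \<noteq> 0"
proof (rule ccontr)
  note witness = that
  assume neg: "\<not> thesis"
  have z: "emeasure lborel {x. 0 < x \<and> x \<le> X \<and> \<beta> \<le> \<rho> x rM} = 0" if "0 < \<beta>" for \<beta> X
    using witness[OF that, of X] neg by blast
  have "{x. 0 < x \<and> x \<le> real n \<and> 1 / real (Suc n) \<le> \<rho> x rM} \<in> null_sets lborel" for n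
    using z[of "1 / real (Suc n)" "real n"] by (intro null_setsI) auto
  then have "AE x in lborel. \<forall>n. x \<notin> {x. 0 < x \<and> x \<le> real n \<and> 1 / real (Suc n) \<le> \<rho> x rM}"
    unfolding AE_all_countable by (blast intro: AE_not_in)
  then have ae: "AE x in lborel. \<rho> x rM = 0"
  proof eventually_elim
    case (elim x)
    show ?case
    proof (rule ccontr)
      assume "\<rho> x rM \<noteq> 0"
      then have pos: "0 < \<rho> x rM" and x: "0 < x" using rate_nonneg[of x rM] rate_nonpos_age[of x rM] by
          (auto simp: not_le[symmetric])
      obtain n1 where n1: "1 / \<rho> x rM < real n1" using reals_Archimedean2 by blast
      obtain n2 where n2: "x < real n2" using reals_Archimedean2 by blast
      define n where "n = max n1 n2"
      have "1 / \<rho> x rM \<le> real (Suc n)" using n1 by (simp add: n_def)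
      then have "1 / real (Suc n) \<le> \<rho> x rM" using pos by (simp add: field_simps)
      then show False using elim[rule_format, of n] x n2 by (auto simp: n_def)
    qed
  qed
  have "survival x = 1" for x
  proof -
    have "(LBINT s:{0<..x}. \<rho> s rM) = integral\<^sup>L lborel (\<lambda>s::real. 0::real)"
      unfolding set_lebesgue_integral_def by (rule integral_cong_AE) (use ae in \<open>auto elim: eventually_mono\<close>)
    then show ?thesis by (simp add: survival_def)
  qed
  then have "integrable lborel (indicat_real {0::real<..})" using int by (simp add: set_integrable_def)
  then have fin: "emeasure lborel {0::real<..} < \<infinity>" by (simp add: integrable_indicator_iff)
  obtain N where "emeasure lborel {0::real<..} < of_nat N"
    using fin ennreal_Ex_less_of_nat[of "emeasure lborel {0::real<..}"] by auto
  moreover have "of_nat N = emeasure lborel {0<..real N}" by (simp add: ennreal_of_nat_eq_real_of_nat)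
  moreover have "\<dots> \<le> emeasure lborel {0::real<..}" by (rule emeasure_mono) auto
  ultimately show False by simp
qed

end

context two_solutions begin

text \<open>
  Lemma \<open>excess_renewal\<close> as a renewal inequality for the surplus on the window \<open>[t, t + T]\<close>. The error is
  controlled by the decrease \<open>\<delta>\<close> of the excess over the window. The function \<open>e\<close> has to be nonnegative at
  all real arguments, hence the maximum with 0 for times \<open>t + s < 0\<close>.
\<close>

lemma excess_births_renewal:
  fixes X :: real
  assumes t: "0 \<le> t" and T: "0 < T" and \<beta>: "0 < \<beta>"
  defines "\<delta> \<equiv> excess t - excess (t + T)" and "P \<equiv> {x. 0 < x \<and> x \<le> X \<and> \<beta> \<le> \<rho> x rM}"
    and "e \<equiv> (\<lambda>s. max 0 (dissipation (t + s)) + rM * (excess t - excess (t + T)))"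
  shows "renewal_data T (\<lambda>s. surplus (t + s)) e ((1 + T * rM) * \<delta>)"
    and "renewal_ineq T P (\<beta> * exp (- rM * T) / (1 + C)) 0 (\<lambda>s. surplus (t + s)) e ((1 + T * rM) * \<delta>)"
proof -
  have \<delta>0: "0 \<le> \<delta>" using excess_antimono[of t "t + T"] t T by (simp add: \<delta>_def)
  have [measurable]: "P \<in> sets borel" unfolding P_def by measurable
  have di: "set_integrable lborel {t + 0<..t + T} dissipation" by (rule dissipation_integrable) (use t in simp)
  have mi: "set_integrable lborel {0<..T} (\<lambda>s. max 0 (dissipation (t + s)))"
  proof -
    have "set_integrable lborel {0<..T} (\<lambda>s. dissipation (t + s))
        = set_integrable lborel {0<..T} (\<lambda>s. max 0 (dissipation (t + s)))"
      using t by (intro set_integrable_cong refl) (auto intro!: max_absorb2[symmetric] dissipation_nonneg)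
    then show ?thesis using set_integrable_Ioc_shift[OF di] by simp
  qed
  have ci: "set_integrable lborel {0<..T} (\<lambda>s. rM * \<delta>)"
    by (rule set_integrable_Ioc_bounded[of _ _ _ "\<bar>rM * \<delta>\<bar>"]) auto
  have "(LBINT s:{0<..T}. max 0 (dissipation (t + s))) = (LBINT s:{0<..T}. dissipation (t + s))"
    by (rule set_lebesgue_integral_cong) (use t in \<open>auto intro!: max_absorb2 dissipation_nonneg\<close>)
  also have "\<dots> = (LBINT s:{t + 0<..t + T}. dissipation s)" by (rule set_integral_Ioc_shift[symmetric])
  also have "\<dots> \<le> \<delta>" using integral_dissipation_le[of t "t + T"] t T by (simp add: \<delta>_def)
  finally have "(LBINT s:{0<..T}. e s) \<le> (1 + T * rM) * \<delta>"
    using T unfolding e_def \<delta>_def[symmetric] set_integral_add(2)[OF mi ci]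
    by (simp add: set_integral_const_Ioc algebra_simps)
  then show "renewal_data T (\<lambda>s. surplus (t + s)) e ((1 + T * rM) * \<delta>)"
    using set_integral_add(1)[OF mi ci] surplus_bounds \<delta>0 rM_pos
    unfolding renewal_data_def e_def \<delta>_def[symmetric] by auto
  show "renewal_ineq T P (\<beta> * exp (- rM * T) / (1 + C)) 0 (\<lambda>s. surplus (t + s)) e ((1 + T * rM) * \<delta>)"
    unfolding renewal_ineq_def
  proof
    fix \<tau> assume \<tau>: "\<tau> \<in> {0<..T}"
    have bd: "\<bar>x * surplus (t + s)\<bar> \<le> B * rM" if "\<bar>x\<bar> \<le> B" for x B s
      unfolding abs_mult using that surplus_bounds[of "t + s"] by (intro mult_mono) auto
    have "(LBINT s:{0<..\<tau>}. \<beta> * (indicator P (\<tau> - s) * surplus (t + s)))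
        \<le> (LBINT s:{0<..\<tau>}. \<rho> (\<tau> - s) rM * surplus (t + s))"
    proof (rule set_integral_mono)
      have "set_integrable lborel {0<..\<tau>} (\<lambda>s. indicator P (\<tau> - s) * surplus (t + s))"
        by (rule set_integrable_Ioc_bounded[of _ _ _ "1 * rM"])
            (use rM_pos in \<open>auto simp: indicator_def surplus_bounds\<close>)
      then show "set_integrable lborel {0<..\<tau>} (\<lambda>s. \<beta> * (indicator P (\<tau> - s) * surplus (t + s)))" by simp
      show "set_integrable lborel {0<..\<tau>} (\<lambda>s. \<rho> (\<tau> - s) rM * surplus (t + s))"
        by (rule set_integrable_Ioc_bounded[of _ _ _ "rM * rM"]) (auto intro!: bd abs_rate)
      show "\<beta> * (indicator P (\<tau> - s) * surplus (t + s)) \<le> \<rho> (\<tau> - s) rM * surplus (t + s)" for s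
        using surplus_bounds rate_nonneg by (auto simp: P_def indicator_def intro!: mult_right_mono)
    qed
    then have "exp (- rM * T) * (\<beta> * (LBINT s:{0<..\<tau>}. indicator P (\<tau> - s) * surplus (t + s)))
        \<le> exp (- rM * T) * (LBINT s:{0<..\<tau>}. \<rho> (\<tau> - s) rM * surplus (t + s))"
      by (intro mult_left_mono) auto
    also have "\<dots> \<le> (1 + C) * surplus (t + \<tau>) + (dissipation (t + \<tau>) + rM * \<delta>)"
      unfolding \<delta>_def by (rule excess_renewal) (use t \<tau> in auto)
    also have "\<dots> \<le> (1 + C) * surplus (t + \<tau>) + (1 + C) * e \<tau>"
    proof (intro add_left_mono)
      have "dissipation (t + \<tau>) + rM * \<delta> \<le> e \<tau>" by (simp add: e_def \<delta>_def)
      also have "\<dots> \<le> (1 + C) * e \<tau>"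
        using mult_right_mono[of 1 "1 + C" "e \<tau>"] C_nonneg \<delta>0 rM_pos unfolding e_def \<delta>_def[symmetric] by auto
      finally show "dissipation (t + \<tau>) + rM * \<delta> \<le> (1 + C) * e \<tau>" .
    qed
    finally show "\<beta> * exp (- rM * T) / (1 + C) * (LBINT s:{0<..\<tau>}. indicator P (\<tau> - s) * surplus (t + s))
        \<le> surplus (t + \<tau>) + e \<tau> + 0 * ((1 + T * rM) * \<delta>)"
      using C_nonneg by (simp add: divide_le_eq algebra_simps)
  qed
qed

text \<open>
  The excess is decreasing and bounded below.
\<close>

lemma excess_increment_tendsto_0:
  assumes T: "0 \<le> T" and e: "0 < e"
  shows "\<forall>\<^sub>F t in at_top. excess t - excess (t + T) < e"
proof -
  define l where "l = (INF t\<in>{0..}. excess t)"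
  have bb: "bdd_below (excess ` {0..})" by (rule bdd_belowI[of _ 0]) (auto intro: excess_nonneg)
  have "l < l + e" using e by simp
  then obtain s where s: "0 \<le> s" "excess s < l + e"
    unfolding l_def using cInf_lessD[of "excess ` {0..}" "Inf (excess ` {0..}) + e"] by auto
  show ?thesis using eventually_ge_at_top[of s]
  proof eventually_elim
    case (elim t)
    have "excess t \<le> excess s" using excess_antimono[OF s(1) elim] .
    moreover have "l \<le> excess (t + T)" unfolding l_def by (rule cINF_lower[OF bb]) (use s elim T in auto)
    ultimately show ?case using s(2) by simp
  qed
qed

text \<open>
  Since the minimum of the two surpluses vanishes, the smaller of their integrals over \<open>(t, t + h]\<close> is
  bounded by the decrease of the excess over a longer window, which tends to 0; and either integral bounds
  the excess at \<open>t + h\<close>.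
\<close>

lemma excess_tendsto_0:
  assumes int: "set_integrable lborel {0<..} survival"
  shows "(excess \<longlongrightarrow> 0) at_top"
proof (rule order_tendstoI)
  fix a :: real assume "a < 0"
  then have "a < excess t" if "0 \<le> t" for t using excess_nonneg[OF that] by simp
  then show "\<forall>\<^sub>F t in at_top. a < excess t" by (intro eventually_mono[OF eventually_ge_at_top[of 0]])
next
  fix \<epsilon> :: real assume \<epsilon>: "0 < \<epsilon>"
  interpret sw: two_solutions rM C \<rho> u2 I2 u1 I1 by (rule swapped)
  note sw_eq = swapped_eqs
  obtain h1 where h1: "\<And>h. h1 \<le> h \<Longrightarrow> \<forall>\<^sub>F t in at_top. (LBINT y:{-t<..}. w1 y (t + h)) < \<epsilon> / 2"
    using old_mass_small[OF int sol1 half_gt_zero[OF \<epsilon>]] by blast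
  obtain h2 where h2: "\<And>h. h2 \<le> h \<Longrightarrow> \<forall>\<^sub>F t in at_top. (LBINT y:{-t<..}. w2 y (t + h)) < \<epsilon> / 2"
    using old_mass_small[OF int sol2 half_gt_zero[OF \<epsilon>]] by blast
  define h where "h = max 1 (max h1 h2)"
  have h: "0 < h" "h1 \<le> h" "h2 \<le> h" by (auto simp: h_def)
  obtain \<beta> X where \<beta>: "0 < \<beta>" and Ppos: "emeasure lborel {x. 0 < x \<and> x \<le> X \<and> \<beta> \<le> \<rho> x rM} \<noteq> 0"
    using rate_positive_somewhere[OF int] by metis
  define P where "P = {x. 0 < x \<and> x \<le> X \<and> \<beta> \<le> \<rho> x rM}"
  have P: "P \<in> sets borel" "P \<subseteq> {0<..}" "bounded P" "emeasure lborel P \<noteq> 0"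
  proof -
    show "P \<in> sets borel" unfolding P_def by measurable
    show "bounded P" by (rule bounded_subset[OF bounded_closed_interval[of 0 X]]) (auto simp: P_def)
  qed (use Ppos in \<open>auto simp: P_def\<close>)
  obtain L where L: "0 < L" and spread: "\<And>T k. 0 < T \<Longrightarrow> 0 < k \<Longrightarrow>
     \<exists>k'>0. \<exists>C\<ge>0. \<forall>v e E. renewal_data T v e E \<longrightarrow> renewal_ineq T P k 0 v e E \<longrightarrow> renewal_ineq T {L..L + 2 * h} k' C v e E"
    using renewal_ineq_spreads[OF P, of "2 * h"] by metis
  define T where "T = L + 2 * h"
  have T: "0 < T" using L h by (simp add: T_def)
  have kpos: "0 < \<beta> * exp (- rM * T) / (1 + C)" using \<beta> C_nonneg by (intro divide_pos_pos) auto
  obtain k' C' where k': "0 < k'" "0 \<le> C'" and sp: "\<And>v e E. renewal_data T v e E \<Longrightarrow>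
      renewal_ineq T P (\<beta> * exp (- rM * T) / (1 + C)) 0 v e E \<Longrightarrow> renewal_ineq T {L..L + 2 * h} k' C' v e E"
    using spread[OF T kpos] by metis
  \<comment> \<open>The constant is chosen so that \<open>c * \<delta>\<close> bounds \<open>1 + C\<close> times the smaller integral of the surplus.\<close>
  define c where "c = (1 + C) * ((1 + C' * h) * (1 + T * rM)) / (k' * h)"
  have c: "0 < c" unfolding c_def using C_nonneg k' h T rM_pos
    by (intro divide_pos_pos mult_pos_pos add_pos_nonneg mult_nonneg_nonneg) auto
  have "\<forall>\<^sub>F t in at_top. excess t - excess (t + T) < \<epsilon> / (2 * c)"
    by (rule excess_increment_tendsto_0) (use T \<epsilon> c in auto)
  with eventually_ge_at_top[of 0] h1[OF h(2)] h2[OF h(3)]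
  have "\<forall>\<^sub>F t in at_top. excess (t + h) < \<epsilon>"
  proof eventually_elim
    case (elim t)
    define \<delta> where "\<delta> = excess t - excess (t + T)"
    define e where "e s = max 0 (dissipation (t + s)) + rM * \<delta>" for s
    define a1 where "a1 = (LBINT s:{0<..h}. surplus (t + s))"
    define a2 where "a2 = (LBINT s:{0<..h}. sw.surplus (t + s))"
    note r1 = excess_births_renewal(1)[OF elim(1) T \<beta>, folded \<delta>_def, folded e_def]
      excess_births_renewal(2)[OF elim(1) T \<beta>, of X, folded P_def \<delta>_def, folded e_def]
    note r2 = sw.excess_births_renewal(1)[OF elim(1) T \<beta>, unfolded sw_eq, folded \<delta>_def, folded e_def]
      sw.excess_births_renewal(2)[OF elim(1) T \<beta>, of X, unfolded sw_eq, folded P_def \<delta>_def, folded e_def]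
    have "k' * h * min a1 a2 \<le> (1 + C' * h) * ((1 + T * rM) * \<delta>)"
      unfolding a1_def a2_def
    proof (rule renewal_ineq_min[where L = L and e = e])
      show "renewal_data (L + 2 * h) (\<lambda>s. surplus (t + s)) e ((1 + T * rM) * \<delta>)"
        "renewal_data (L + 2 * h) (\<lambda>s. sw.surplus (t + s)) e ((1 + T * rM) * \<delta>)"
        using r1(1) r2(1) by (simp_all add: T_def e_def[abs_def])
      show "renewal_ineq (L + 2 * h) {L..L + 2 * h} k' C' (\<lambda>s. surplus (t + s)) e ((1 + T * rM) * \<delta>)"
        "renewal_ineq (L + 2 * h) {L..L + 2 * h} k' C' (\<lambda>s. sw.surplus (t + s)) e ((1 + T * rM) * \<delta>)"
        using sp[OF r1] sp[OF r2] by (simp_all add: T_def e_def[abs_def])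
      show "min (surplus (t + s)) (sw.surplus (t + s)) = 0" for s
        by (auto simp: surplus_def sw.surplus_def sw_eq Imin_def min_def)
    qed (use h L k' in auto)
    then have "min a1 a2 \<le> (1 + C' * h) * ((1 + T * rM) * \<delta>) / (k' * h)"
      using k' h by (simp add: pos_le_divide_eq mult.commute)
    then have "(1 + C) * min a1 a2 \<le> (1 + C) * ((1 + C' * h) * ((1 + T * rM) * \<delta>) / (k' * h))"
      using C_nonneg by (intro mult_left_mono) auto
    also have "\<dots> = c * \<delta>" by (simp add: c_def)
    also have "\<dots> < \<epsilon> / 2" using elim(4) c unfolding \<delta>_def[symmetric] by (simp add: field_simps)
    finally have m: "(1 + C) * min a1 a2 < \<epsilon> / 2" .
    have "excess (t + h) \<le> (1 + C) * a1 + (LBINT y:{-t<..}. w1 y (t + h))"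
      using excess_le_excess_births[of t "t + h"] elim(1) h set_integral_Ioc_shift[of t 0 h surplus] by
          (simp add: a1_def)
    moreover have "excess (t + h) \<le> (1 + C) * a2 + (LBINT y:{-t<..}. w2 y (t + h))"
      using sw.excess_le_excess_births[of t "t + h"] elim(1) h set_integral_Ioc_shift[of t 0 h sw.surplus]
          by (simp add: a2_def sw_eq)
    ultimately show ?case using m elim(2,3) by (cases "a1 \<le> a2") (auto simp: min_def)
  qed
  then obtain t0 where "\<And>t. t0 \<le> t \<Longrightarrow> excess (t + h) < \<epsilon>" by (auto simp: eventually_at_top_linorder)
  from this[of "t - h" for t] show "\<forall>\<^sub>F t in at_top. excess t < \<epsilon>"
    unfolding eventually_at_top_linorder by (intro exI[of _ "t0 + h"]) (auto simp: le_diff_eq)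
qed

end

section \<open>Borel versions and the stationary population\<close>

lemma borel_measurable_lebesgue_AE:
  fixes F G :: "real \<Rightarrow> real"
  assumes G: "G \<in> borel_measurable borel" and eq: "AE x in lborel. F x = G x"
  shows "F \<in> borel_measurable lebesgue"
proof (rule borel_measurableI_greater)
  fix a
  show "{x \<in> space lebesgue. a < F x} \<in> sets lebesgue"
  proof (rule completion.in_sets_AE)
    have "{x. a < G x} \<in> sets borel" using G by measurable
    then show "{x. a < G x} \<in> sets lebesgue" by auto
    show "AE x in lebesgue. (x \<in> {x. a < G x}) = (x \<in> {x \<in> space lebesgue. a < F x})"
      using eq unfolding AE_completion_iff by eventually_elim auto
  qed auto
qed

lemma lebesgue_integral_AE_borel:
  fixes F G :: "real \<Rightarrow> real"
  assumes G: "G \<in> borel_measurable borel" and eq: "AE x in lborel. F x = G x"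
  shows "integral\<^sup>L lebesgue F = integral\<^sup>L lborel G"
    and "integrable lebesgue F \<longleftrightarrow> integrable lborel G"
proof -
  have F: "F \<in> borel_measurable lebesgue" by (rule borel_measurable_lebesgue_AE[OF assms])
  have G': "G \<in> borel_measurable lborel" "G \<in> borel_measurable lebesgue"
    using G by (auto intro: measurable_completion)
  have eq': "AE x in lebesgue. F x = G x" using eq by (simp add: AE_completion_iff)
  have "integral\<^sup>L lebesgue F = integral\<^sup>L lebesgue G" by (rule integral_cong_AE[OF F G'(2) eq'])
  then show "integral\<^sup>L lebesgue F = integral\<^sup>L lborel G" by (simp add: integral_completion[OF G'(1)])
  have "integrable lebesgue F \<longleftrightarrow> integrable lebesgue G" by (rule integrable_cong_AE[OF F G'(2) eq'])
  then show "integrable lebesgue F \<longleftrightarrow> integrable lborel G" using integrable_completion[OF G'(1)] by simp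
qed

text \<open>
  Transfers integrals of Lebesgue measurable functions to Borel versions. The indicator functions are part
  of the equation so that end points of intervals can be changed at the same time.
\<close>

lemma set_lebesgue_integral_AE_borel:
  fixes f g :: "real \<Rightarrow> real"
  assumes g: "g \<in> borel_measurable borel" and B: "B \<in> sets borel"
    and eq: "AE x in lborel. indicator A x * f x = indicator B x * g x"
  shows "(LINT x:A|lebesgue. f x) = (LBINT x:B. g x)"
    and "set_integrable lebesgue A f \<longleftrightarrow> set_integrable lborel B g"
proof -
  have "(\<lambda>x. indicator B x * g x) \<in> borel_measurable borel" using g B by measurable
  from lebesgue_integral_AE_borel[OF this eq]
  show "(LINT x:A|lebesgue. f x) = (LBINT x:B. g x)" "set_integrable lebesgue A f \<longleftrightarrow> set_integrable lborel B g"
    by (simp_all add: set_lebesgue_integral_def set_integrable_def)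
qed

lemma AE_lborel_translate:
  assumes N: "N \<in> null_sets lborel" shows "AE x in lborel. c + x \<notin> (N :: real set)"
proof -
  have [measurable]: "N \<in> sets borel" using N by auto
  have "AE x in lborel. c + 1 * x \<notin> N"
    by (rule AE_borel_affine) (use N in \<open>auto intro: AE_not_in\<close>)
  then show ?thesis by simp
qed

lemma AE_lborel_null_set:
  assumes "AE x in lborel. P (x :: real)"
  obtains N where "N \<in> null_sets lborel" "\<And>x. x \<notin> N \<Longrightarrow> P x"
  using AE_E3[OF assms] by auto

lemma AE_lebesgue_on_Ioi:
  "(AE x in lebesgue_on {0<..}. P x) \<longleftrightarrow> (AE x in lborel. (0::real) < x \<longrightarrow> P x)"
  by (subst AE_restrict_space_iff) (auto simp: AE_completion_iff)

lemma borel_version_Ioi: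
  fixes f :: "real \<Rightarrow> real"
  assumes "f \<in> borel_measurable (lebesgue_on {0<..})"
  obtains g where "g \<in> borel_measurable borel" "AE x in lborel. 0 < x \<longrightarrow> f x = g x"
proof -
  have "(\<lambda>x. indicator {0<..} x *\<^sub>R f x) \<in> borel_measurable lebesgue"
    using assms by (subst (asm) borel_measurable_restrict_space_iff) auto
  from completion_ex_borel_measurable_real[OF this]
  obtain g where g: "g \<in> borel_measurable lborel" "AE x in lborel. indicator {0<..} x *\<^sub>R f x = g x" by blast
  show ?thesis
  proof (rule that[of g])
    show "AE x in lborel. 0 < x \<longrightarrow> f x = g x" using g(2) by eventually_elim (auto simp: indicator_def)
  qed (use g in auto)
qed

text \<open>
  By Fubini, for almost every \<open>x\<close> the bounds on the derivative hold for almost every \<open>s\<close>; then they are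
  integrated over \<open>(J,K)\<close>.
\<close>

lemma partial_bounds_imp_lipschitz_antimono:
  assumes dr: "is_partial_I rM r dr"
    and dr_Linf: "\<exists>C. AE p in lebesgue_on ({0<..} \<times> {0<..<rM}). \<bar>dr (fst p) (snd p)\<bar> \<le> C"
    and dr_nonpos: "AE p in lebesgue_on ({0<..} \<times> {0<..<rM}). dr (fst p) (snd p) \<le> 0"
  obtains C where "0 \<le> C" "AE x in lborel. 0 < x \<longrightarrow>
    (\<forall>J K. 0 \<le> J \<and> J \<le> K \<and> K \<le> rM \<longrightarrow> r x K \<le> r x J \<and> r x J - r x K \<le> C * (K - J))"
proof -
  obtain C0 where C0: "AE p in lebesgue_on ({0<..} \<times> {0<..<rM}). \<bar>dr (fst p) (snd p)\<bar> \<le> C0" using dr_Linf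
      by blast
  define C where "C = max 0 C0"
  have m: "{0::real<..} \<times> {0<..<rM} \<inter> space lebesgue \<in> sets lebesgue"
  proof -
    have "{0::real<..} \<times> {0<..<rM} \<in> sets borel"
      by (intro borel_open open_Times open_greaterThan open_greaterThanLessThan)
    then show ?thesis by auto
  qed
  have "AE p in lebesgue. p \<in> {0<..} \<times> {0<..<rM} \<longrightarrow> - C \<le> dr (fst p) (snd p) \<and> dr (fst p) (snd p) \<le> 0"
    using C0 dr_nonpos unfolding AE_restrict_space_iff[OF m] by eventually_elim (auto simp: C_def)
  then have "AE p in lborel \<Otimes>\<^sub>M lborel. p \<in> {0<..} \<times> {0<..<rM} \<longrightarrow> - C \<le> dr (fst p) (snd p)
      \<and> dr (fst p) (snd p) \<le> 0"
    unfolding lborel_prod AE_completion_iff .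
  then have ae1: "AE x in lborel. AE s in lborel. (x, s) \<in> {0<..} \<times> {0<..<rM} \<longrightarrow> - C \<le> dr x s \<and> dr x s \<le> 0"
    using lborel_pair.AE_pair by fastforce
  have ae2: "AE x in lborel. 0 < x \<longrightarrow> set_integrable lebesgue {0<..<rM} (dr x) \<and>
        (\<forall>a b. 0 \<le> a \<and> a \<le> b \<and> b \<le> rM \<longrightarrow> r x b - r x a = (LINT s:{a<..<b}|lebesgue. dr x s))"
    using dr unfolding is_partial_I_def AE_lebesgue_on_Ioi by auto
  have "AE x in lborel. 0 < x \<longrightarrow>
    (\<forall>J K. 0 \<le> J \<and> J \<le> K \<and> K \<le> rM \<longrightarrow> r x K \<le> r x J \<and> r x J - r x K \<le> C * (K - J))"
    using ae1 ae2
  proof eventually_elim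
    case (elim x)
    show ?case
    proof (intro impI allI, elim conjE)
      fix J K assume x: "0 < x" and J: "0 \<le> J" "J \<le> K" "K \<le> rM"
      have i: "set_integrable lebesgue {J<..<K} (dr x)"
        by (rule set_integrable_subset[of _ "{0<..<rM}"]) (use elim(2) x J in auto)
      have ci: "set_integrable lebesgue {J<..<K} (\<lambda>_. k)" and c:
          "(LINT s:{J<..<K}|lebesgue. k) = k * (K - J)" for k :: real
        using J by (auto simp: set_integrable_def set_lebesgue_integral_def)
      have b: "AE s in lebesgue. s \<in> {J<..<K} \<longrightarrow> - C \<le> dr x s \<and> dr x s \<le> 0"
        using elim(1) unfolding AE_completion_iff by eventually_elim (use x J in auto)
      have e: "r x K - r x J = (LINT s:{J<..<K}|lebesgue. dr x s)" using elim(2) x J by blast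
      have "(LINT s:{J<..<K}|lebesgue. - C) \<le> (LINT s:{J<..<K}|lebesgue. dr x s)"
        by (rule set_integral_mono_AE[OF ci i]) (use b in \<open>auto elim: eventually_mono\<close>)
      moreover have "(LINT s:{J<..<K}|lebesgue. dr x s) \<le> (LINT s:{J<..<K}|lebesgue. 0)"
        by (rule set_integral_mono_AE[OF i ci]) (use b in \<open>auto elim: eventually_mono\<close>)
      ultimately show "r x K \<le> r x J \<and> r x J - r x K \<le> C * (K - J)"
        using e by (simp add: c)
    qed
  qed
  then show ?thesis by (rule that[of C, rotated]) (simp add: C_def)
qed

text \<open>
  Off a null set of ages, \<open>r x\<close> is Lipschitz and its values on the grids \<open>rM * i / k\<close> are Borel functions
  of \<open>x\<close>. So \<open>\<rho>\<close> is the limit of the step functions that round the level down to the grid, hence jointly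
  Borel measurable. On the exceptional null set the rate is \<open>rM\<close>; this keeps every lower bound \<open>r0\<close> of
  \<open>r\<close>, as \<open>r0 \<le> r \<le> rM\<close>.
\<close>

lemma borel_decreasing_rate:
  assumes rM_pos: "0 < rM" and C: "0 \<le> C"
    and r_meas: "\<And>J. J \<in> {0..rM} \<Longrightarrow> (\<lambda>x. r x J) \<in> borel_measurable (lebesgue_on {0<..})"
    and r_bounds: "\<And>x J. 0 < x \<Longrightarrow> J \<in> {0..rM} \<Longrightarrow> 0 \<le> r x J \<and> r x J \<le> rM"
    and reg: "AE x in lborel. 0 < x \<longrightarrow>
      (\<forall>J K. 0 \<le> J \<and> J \<le> K \<and> K \<le> rM \<longrightarrow> r x K \<le> r x J \<and> r x J - r x K \<le> C * (K - J))"
  obtains \<rho> N where "decreasing_rate rM C \<rho>" "N \<in> null_sets lborel"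
    "\<forall>x J. 0 < x \<longrightarrow> x \<notin> N \<longrightarrow> J \<in> {0..rM} \<longrightarrow> r x J = \<rho> x J"
    "\<forall>r0. (\<forall>x>0. \<forall>J\<in>{0..rM}. r0 \<le> r x J) \<longrightarrow> (\<forall>x>0. r0 \<le> \<rho> x rM)"
proof -
  define grid where "grid k i = rM * (real (min i k) / real k)" for k i :: nat
  have grid: "grid k i \<in> {0..rM}" for k i
  proof -
    have "real (min i k) / real k \<le> 1" by (cases "k = 0") auto
    then show ?thesis using rM_pos mult_left_le[of "real (min i k) / real k" rM]
      unfolding grid_def atLeastAtMost_iff by (intro conjI mult_nonneg_nonneg divide_nonneg_nonneg) auto
  qed
  have "\<forall>k i. \<exists>g. g \<in> borel_measurable borel \<and> (AE x in lborel. 0 < x \<longrightarrow> r x (grid k i) = g x)"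
    using borel_version_Ioi[OF r_meas[OF grid]] by metis
  then obtain g where g [measurable]: "\<And>k i. g k i \<in> borel_measurable borel"
    and g_eq: "\<And>k i. AE x in lborel. 0 < x \<longrightarrow> r x (grid k i) = g k i x"
    by metis
  have "AE x in lborel. (0 < x \<longrightarrow>
      (\<forall>J K. 0 \<le> J \<and> J \<le> K \<and> K \<le> rM \<longrightarrow> r x K \<le> r x J \<and> r x J - r x K \<le> C * (K - J))) \<and> (\<forall>k i. 0 < x \<longrightarrow> r x (grid k i) = g k i x)"
  proof -
    have "AE x in lborel. \<forall>k i. 0 < x \<longrightarrow> r x (grid k i) = g k i x"
      unfolding AE_all_countable using g_eq by blast
    with reg show ?thesis by eventually_elim blast
  qed
  then obtain N where N: "N \<in> null_sets lborel" and good: "\<And>x. x \<notin> N \<Longrightarrow> (0 < x \<longrightarrow>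
      (\<forall>J K. 0 \<le> J \<and> J \<le> K \<and> K \<le> rM \<longrightarrow> r x K \<le> r x J \<and> r x J - r x K \<le> C * (K - J))) \<and> (\<forall>k i. 0 < x \<longrightarrow> r x (grid k i) = g k i x)"
    by (rule AE_lborel_null_set) blast
  have [measurable]: "N \<in> sets borel" using N by auto
  define cl where "cl J = max 0 (min J rM)" for J
  have cl: "cl J \<in> {0..rM}" for J using rM_pos by (auto simp: cl_def)
  have cl_id: "J \<in> {0..rM} \<Longrightarrow> cl J = J" for J by (auto simp: cl_def)
  have cl_mono: "J \<le> K \<Longrightarrow> cl J \<le> cl K" and cl_lip: "J \<le> K \<Longrightarrow> cl K - cl J \<le> K - J" for J K by (auto simp: cl_def)
  define \<rho> where "\<rho> x J = (if x \<le> 0 then 0 else if x \<in> N then rM else r x (cl J))" for x J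
  \<comment> \<open>The index of the last grid point below the level.\<close>
  define i where "i k J = nat \<lfloor>real k * (cl J / rM)\<rfloor>" for k J
  define a where "a k x J = (if x \<le> 0 then 0 else if x \<in> N then rM else g k (i k J) x)" for k x J
  have i_le: "i k J \<le> k" for k J
  proof -
    have "real k * (cl J / rM) \<le> real k" using cl[of J] rM_pos by (intro mult_left_le) auto
    then have "\<lfloor>real k * (cl J / rM)\<rfloor> \<le> int k" by linarith
    then show ?thesis by (simp add: i_def nat_le_iff)
  qed
  have near: "grid k (i k J) \<le> cl J \<and> cl J - grid k (i k J) \<le> rM / real k" if "0 < k" for k J
  proof -
    define z where "z = real k * (cl J / rM)"
    have z: "0 \<le> z" using cl[of J] rM_pos by (auto simp: z_def)
    have iz: "real (i k J) = real_of_int \<lfloor>z\<rfloor>" using z by (simp add: i_def z_def)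
    have gr: "grid k (i k J) = rM / real k * real (i k J)" using i_le[of k J] by
        (simp add: grid_def min_absorb1)
    have clz: "cl J = rM / real k * z" using that rM_pos by (simp add: z_def)
    have "real (i k J) \<le> z" "z - real (i k J) \<le> 1" using iz by linarith+
    then show ?thesis unfolding gr clz right_diff_distrib[symmetric]
      using that rM_pos mult_left_mono[of "real (i k J)" z "rM / real k"] mult_left_mono[of
          "z - real (i k J)" 1 "rM / real k"] by auto
  qed
  have lim: "(\<lambda>k. a k x J) \<longlonglongrightarrow> \<rho> x J" for x J
  proof (cases "x \<le> 0 \<or> x \<in> N")
    case False
    then have x: "0 < x" "x \<notin> N" by auto
    have bound: "\<bar>a k x J - \<rho> x J\<bar> \<le> C * (rM / real k)" if "0 < k" for k
    proof -
      have "a k x J = r x (grid k (i k J))" using good[OF x(2)] x by (simp add: a_def)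
      moreover have "r x (cl J) \<le> r x (grid k (i k J)) \<and> r x (grid k (i k J)) - r x (cl J)
          \<le> C * (cl J - grid k (i k J))"
      proof -
        have "0 \<le> grid k (i k J) \<and> grid k (i k J) \<le> cl J \<and> cl J \<le> rM"
          using near[OF that, of J] cl[of J] grid[of k "i k J"] by auto
        then show ?thesis using good[OF x(2)] x(1) by blast
      qed
      moreover have "C * (cl J - grid k (i k J)) \<le> C * (rM / real k)" using near[OF that, of J] C
          by (intro mult_left_mono) auto
      ultimately show ?thesis using x by (simp add: \<rho>_def)
    qed
    have "(\<lambda>k. C * (rM / real k)) \<longlonglongrightarrow> 0"
      by (intro tendsto_mult_right_zero tendsto_divide_0[OF tendsto_const] filterlim_at_top_imp_at_infinity filterlim_real_sequentially)
    then have "(\<lambda>k. a k x J - \<rho> x J) \<longlonglongrightarrow> 0"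
      by (rule Lim_null_comparison[rotated])
          (use bound in \<open>auto intro!: eventually_mono[OF eventually_gt_at_top[of 0]]\<close>)
    then show ?thesis by (simp add: LIM_zero_iff)
  qed (auto simp: a_def \<rho>_def)
  have cl_meas [measurable]: "cl \<in> borel_measurable borel" unfolding cl_def by measurable
  have a_meas: "(\<lambda>p. a k (fst p) (snd p)) \<in> borel_measurable (borel \<Otimes>\<^sub>M borel)" for k
  proof -
    have "(\<lambda>p. i k (snd p)) \<in> measurable (borel \<Otimes>\<^sub>M borel) (count_space UNIV)" unfolding i_def by measurable
    then have "(\<lambda>p. g k (i k (snd p)) (fst p)) \<in> borel_measurable (borel \<Otimes>\<^sub>M borel)"
      by (rule measurable_compose_countable[rotated]) measurable
    then show ?thesis unfolding a_def by measurable
  qed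
  have "(\<lambda>p. \<rho> (fst p) (snd p)) \<in> borel_measurable (borel \<Otimes>\<^sub>M borel)"
    by (rule borel_measurable_LIMSEQ_real[OF _ a_meas]) (rule lim)
  then have meas: "(\<lambda>p. \<rho> (fst p) (snd p)) \<in> borel_measurable borel" by (simp add: borel_prod)
  have bd: "0 \<le> r x (cl J) \<and> r x (cl J) \<le> rM" if "0 < x" for x J using r_bounds[OF that cl] .
  show ?thesis
  proof (rule that[of \<rho> N])
    show "decreasing_rate rM C \<rho>"
    proof
      show "(\<lambda>p. \<rho> (fst p) (snd p)) \<in> borel_measurable borel" by (rule meas)
      show "0 \<le> \<rho> x J" "\<rho> x J \<le> rM" for x J using bd[of x J] rM_pos by (auto simp: \<rho>_def)
      fix x J K :: real assume JK: "J \<le> K"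
      show "\<rho> x K \<le> \<rho> x J" using good[of x] cl_mono[OF JK] cl[of J] cl[of K] by (auto simp: \<rho>_def)
      have "r x (cl J) - r x (cl K) \<le> C * (K - J)" if "0 < x" "x \<notin> N"
      proof -
        have "r x (cl J) - r x (cl K) \<le> C * (cl K - cl J)"
            using good[OF that(2)] that(1) cl_mono[OF JK] cl[of J] cl[of K] by auto
        also have "\<dots> \<le> C * (K - J)" by (rule mult_left_mono[OF cl_lip[OF JK] C])
        finally show ?thesis .
      qed
      then show "\<rho> x J - \<rho> x K \<le> C * (K - J)" using C JK by (auto simp: \<rho>_def)
    qed (auto simp: rM_pos C \<rho>_def)
    show "\<forall>x J. 0 < x \<longrightarrow> x \<notin> N \<longrightarrow> J \<in> {0..rM} \<longrightarrow> r x J = \<rho> x J" by (simp add: \<rho>_def cl_id)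
    show "\<forall>r0. (\<forall>x>0. \<forall>J\<in>{0..rM}. r0 \<le> r x J) \<longrightarrow> (\<forall>x>0. r0 \<le> \<rho> x rM)"
    proof (intro allI impI)
      fix r0 x :: real assume r0: "\<forall>x>0. \<forall>J\<in>{0..rM}. r0 \<le> r x J" and x: "0 < x"
      have "r0 \<le> r x rM" using r0 x rM_pos by auto
      moreover have "r x rM \<le> rM" using r_bounds[OF x, of rM] rM_pos by auto
      ultimately show "r0 \<le> \<rho> x rM" using x rM_pos by (auto simp: \<rho>_def cl_def)
    qed
  qed (rule N)
qed

context decreasing_rate begin

text \<open>
  The stationary density for the level \<open>J\<close>. At nonpositive \<open>x\<close> the integral is over an empty set and the
  value is \<open>J\<close>, the birth rate, as \<open>solution\<close> requires.
\<close>

definition profile :: "real \<Rightarrow> real \<Rightarrow> real" where "profile J x = J * exp (- (LBINT s:{0<..x}. \<rho> s J))"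

lemma along_profile:
  assumes "0 \<le> t" shows "along (profile J) (\<lambda>_. J) y t = profile J (y + t)"
proof -
  have "(LBINT s:{0<..t}. \<rho> (y + s) J) = (LBINT s:{y + 0<..y + t}. \<rho> s J)"
      by (rule set_integral_Ioc_shift[symmetric])
  then have sh: "(LBINT s:{0<..t}. \<rho> (y + s) J) = (LBINT s:{y<..y + t}. \<rho> s J)" by simp
  have i: "set_integrable lborel {a<..b} (\<lambda>s. \<rho> s J)" for a b using rate_Ioc_integrable[of "\<lambda>_. J" a b 0]
      by simp
  have "(LBINT s:{0<..y}. \<rho> s J) + (LBINT s:{y<..y + t}. \<rho> s J) = (LBINT s:{0<..y + t}. \<rho> s J)"
  proof (cases "0 \<le> y")
    case True
    then show ?thesis using set_integral_Ioc_split[OF True _ i, of "y + t"] assms by simp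
  next
    case False
    then have "(LBINT s:{0<..y}. \<rho> s J) = 0" by (simp add: set_lebesgue_integral_def)
    moreover have "(LBINT s:{y<..y + t}. \<rho> s J) = (LBINT s:{0<..y + t}. \<rho> s J)"
      unfolding set_lebesgue_integral_def using False
      by (intro Bochner_Integration.integral_cong) (auto simp: indicator_def rate_nonpos_age)
    ultimately show ?thesis by simp
  qed
  then show ?thesis by (simp add: along_def profile_def sh exp_add[symmetric] del: exp_add)
qed

text \<open>
  The births condition \<open>J = \<integral> \<rho>(\<cdot>,J) profile J\<close> holds because \<open>profile J\<close> decreases from \<open>J\<close> to 0, and its
  total decrease is the total loss.
\<close>

lemma stationary_solution:
  assumes int: "set_integrable lborel {0<..} survival" and J: "0 \<le> J" "J \<le> rM"
    and mass: "(LBINT x:{0<..}. profile J x) = 1"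
  shows "solution (profile J) (\<lambda>_. J)"
proof -
  have meas [measurable]: "profile J \<in> borel_measurable borel"
    unfolding profile_def[abs_def] by measurable
  have nonneg: "0 \<le> profile J x" for x using J by (simp add: profile_def)
  have ri: "set_integrable lborel {a<..b} (\<lambda>s. \<rho> s K)" for a b K using rate_Ioc_integrable[of "\<lambda>_. K" a b 0]
      by simp
  have le_S: "profile J x \<le> J * survival x" for x
  proof -
    have "(LBINT s:{0<..x}. \<rho> s rM) \<le> (LBINT s:{0<..x}. \<rho> s J)"
      by (rule set_integral_mono[OF ri ri]) (use J in \<open>auto intro: rate_antimono\<close>)
    then show ?thesis unfolding profile_def survival_def using J by (intro mult_left_mono) auto
  qed
  have le_J: "profile J x \<le> J" for x
  proof -
    have "0 \<le> (LBINT s:{0<..x}. \<rho> s J)" by (rule set_integral_nonneg_real) (rule rate_nonneg)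
    then show ?thesis using J by (simp add: profile_def mult_left_le)
  qed
  have G0: "y \<le> 0 \<Longrightarrow> profile J y = J" for y by (simp add: profile_def set_lebesgue_integral_def)
  have Gi: "set_integrable lborel {0<..} (profile J)"
  proof (rule set_integrable_bound)
    show "set_integrable lborel {0<..} (\<lambda>x. J * survival x)" using int by simp
    show "set_borel_measurable lborel {0<..} (profile J)" unfolding set_borel_measurable_def by measurable
    show "AE x in lborel. x \<in> {0<..} \<longrightarrow> norm (profile J x) \<le> norm (J * survival x)"
      using le_S nonneg J survival_pos by (intro AE_I2) (simp add: abs_mult less_imp_le)
  qed
  have \<rho>Gi: "set_integrable lborel {0<..} (\<lambda>x. \<rho> x J * profile J x)"
  proof (rule set_integrable_bound)
    show "set_integrable lborel {0<..} (\<lambda>x. rM * profile J x)" using Gi by simp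
    show "set_borel_measurable lborel {0<..} (\<lambda>x. \<rho> x J * profile J x)" unfolding set_borel_measurable_def
        by measurable
    show "AE x in lborel. x \<in> {0<..} \<longrightarrow> norm (\<rho> x J * profile J x) \<le> norm (rM * profile J x)"
      using nonneg abs_rate rM_pos by (intro AE_I2) (auto simp: abs_mult intro: mult_right_mono)
  qed
  have split: "profile J t = profile J s * exp (- (LBINT v:{s<..t}. \<rho> v J))" if "0 \<le> s" "s \<le> t" for s t
    using set_integral_Ioc_split[OF that ri] by (simp add: profile_def exp_add[symmetric])
  have ftc: "(LBINT v:{0<..X}. \<rho> v J * profile J v) = J - profile J X" if "0 \<le> X" for X
  proof -
    have "profile J 0 - (LBINT v:{0<..X}. \<rho> v J * profile J v) \<le> profile J X"
    proof (rule decay_integral_lower[where M = rM and B = J])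
      fix s t :: real assume "0 \<le> s" "s \<le> t"
      from split[OF this] show "profile J s * exp (- (LBINT v:{s<..t}. \<rho> v J)) \<le> profile J t" by simp
    qed (use that in \<open>simp_all add: rate_nonneg rate_le nonneg le_J\<close>)
    moreover have "profile J X \<le> profile J 0 - (LBINT v:{0<..X}. \<rho> v J * profile J v)"
    proof (rule decay_integral_upper[where M = rM and B = J])
      fix s t :: real assume "0 \<le> s" "s \<le> t"
      from split[OF this] show "profile J t \<le> profile J s * exp (- (LBINT v:{s<..t}. \<rho> v J))" by simp
    qed (use that in \<open>simp_all add: rate_nonneg rate_le nonneg le_J\<close>)
    ultimately show ?thesis using G0[of 0] by simp
  qed
  have "((\<lambda>X. LBINT v. indicator {0<..X} v * (\<rho> v J * profile J v)) \<longlongrightarrow> (LBINT v. indicator {0<..} v * (\<rho> v J * profile J v))) at_top"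
  proof (rule integral_dominated_convergence_at_top)
    show "integrable lborel (\<lambda>v. indicator {0<..} v * (\<rho> v J * profile J v))" using \<rho>Gi by
        (simp add: set_integrable_def)
    show "AE v in lborel. ((\<lambda>X. indicator {0<..X} v * (\<rho> v J * profile J v)) \<longlongrightarrow> indicator {0<..} v * (\<rho> v J * profile J v)) at_top"
    proof (rule AE_I2)
      fix v
      have "\<forall>\<^sub>F X in at_top. indicator {0<..X} v * (\<rho> v J * profile J v)
          = indicator {0<..} v * (\<rho> v J * profile J v)"
        using eventually_ge_at_top[of v] by eventually_elim (auto simp: indicator_def)
      then show "((\<lambda>X. indicator {0<..X} v * (\<rho> v J * profile J v)) \<longlongrightarrow> indicator {0<..} v * (\<rho> v J * profile J v)) at_top" by (rule tendsto_eventually)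
    qed
    show "\<forall>\<^sub>F X in at_top. AE v in lborel. norm (indicator {0<..X} v * (\<rho> v J * profile J v))
        \<le> indicator {0<..} v * (\<rho> v J * profile J v)"
      using nonneg rate_nonneg by (intro always_eventually allI AE_I2) (auto simp: indicator_def)
  qed auto
  then have lim1: "((\<lambda>X. LBINT v:{0<..X}. \<rho> v J * profile J v) \<longlongrightarrow> (LBINT v:{0<..}. \<rho> v J * profile J v)) at_top"
    by (simp add: set_lebesgue_integral_def)
  have limJS: "((\<lambda>X. J * survival X) \<longlongrightarrow> 0) at_top" by (rule tendsto_mult_right_zero[OF survival_at_top[OF int]])
  have "(profile J \<longlongrightarrow> 0) at_top"
    by (rule tendsto_sandwich[OF _ _ tendsto_const limJS]) (use nonneg le_S in auto)
  then have "((\<lambda>X. J - profile J X) \<longlongrightarrow> J - 0) at_top" by (intro tendsto_intros)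
  then have "((\<lambda>X. LBINT v:{0<..X}. \<rho> v J * profile J v) \<longlongrightarrow> J - 0) at_top"
    by (rule Lim_transform_eventually)
        (use ftc in \<open>auto intro!: eventually_mono[OF eventually_ge_at_top[of 0]]\<close>)
  then have births: "(LBINT v:{0<..}. \<rho> v J * profile J v) = J"
    using tendsto_unique[OF trivial_limit_at_top_linorder lim1] by simp
  have "(LBINT y:{-t<..}. along (profile J) (\<lambda>_. J) y t) = 1" if "0 \<le> t" for t
    using mass set_integral_Ioi_shift[of "\<lambda>y. profile J (y + t)" t] that by (simp add: along_profile)
  moreover have "(LBINT y:{-t<..}. \<rho> (y + t) J * along (profile J) (\<lambda>_. J) y t) = J" if "0 \<le> t" for t
    using births set_integral_Ioi_shift[of "\<lambda>y. \<rho> (y + t) J * profile J (y + t)" t] that by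
        (simp add: along_profile)
  ultimately show ?thesis
    unfolding solution_def using J nonneg G0 Gi by simp
qed

end

section \<open>Convergence to the stationary state\<close>

context two_solutions begin

lemma L1_distance_eq:
  assumes t: "0 \<le> t" shows "(LBINT y:{-t<..}. \<bar>w1 y t - w2 y t\<bar>) = 2 * excess t"
proof -
  have i: "set_integrable lborel {-t<..} (\<lambda>y. w1 y t)" "set_integrable lborel {-t<..} (\<lambda>y. common y t)"
    using w1_integrable[of "\<lambda>_. 1" 1 "{-t<..}" "-t" t] common_integrable[of "\<lambda>_. 1" 1 "{-t<..}" "-t" t] by auto
  have i2: "set_integrable lborel {-t<..} (\<lambda>y. w2 y t)"
    using two_solutions.w1_integrable[OF swapped, of "\<lambda>_. 1" 1 "{-t<..}" "-t" t] by auto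
  have "(LBINT y:{-t<..}. \<bar>w1 y t - w2 y t\<bar>) = (LBINT y:{-t<..}. (w1 y t - common y t) + (w2 y t - common y t))"
    by (rule set_lebesgue_integral_cong) (auto simp: common_def min_def)
  also have "\<dots> = (LBINT y:{-t<..}. w1 y t - common y t) + (LBINT y:{-t<..}. w2 y t - common y t)"
    by (intro set_integral_add(2) set_integral_diff(1) i i2)
  also have "(LBINT y:{-t<..}. w2 y t - common y t) = excess t"
    using two_solutions.excess_eq[OF swapped t] by (simp add: swapped_eqs)
  finally show ?thesis by (simp add: excess_eq[OF t])
qed

end

context decreasing_rate begin

text \<open>
  A null set of ages where \<open>r\<close> and \<open>\<rho>\<close> differ is met by each characteristic at a null set of times only.
  The two cases of the weak formulation correspond to the labels \<open>y = x - t\<close> of either sign.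
\<close>

lemma age_solution_along_characteristics:
  assumes N: "N \<in> null_sets lborel"
    and r_eq: "\<And>x J. 0 < x \<Longrightarrow> x \<notin> N \<Longrightarrow> J \<in> {0..rM} \<Longrightarrow> r x J = \<rho> x J"
    and nini_int: "set_integrable lebesgue {0<..} nini"
    and nini_nonneg: "AE x in lebesgue_on {0<..}. 0 \<le> nini x"
    and sol: "age_solution rM r nini n I"
  obtains u J where "solution u J" "AE x in lborel. 0 < x \<longrightarrow> nini x = u x"
    "\<forall>t\<ge>0. AE x in lborel. 0 < x \<longrightarrow> n t x = along u J (x - t) t"
proof -
  have I_cont: "continuous_on {0..} I" and I_bd: "\<And>t. 0 \<le> t \<Longrightarrow> I t \<in> {0..rM}"
    and n_mass: "\<And>t. 0 \<le> t \<Longrightarrow> (LINT x:{0<..}|lebesgue. n t x) = 1"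
    and n_births: "\<And>t. 0 \<le> t \<Longrightarrow> I t = (LINT x:{0<..}|lebesgue. r x (I t) * n t x)"
    and n_char: "\<And>t. 0 \<le> t \<Longrightarrow> AE x in lborel. 0 < x \<longrightarrow> n t x =
          (if t \<le> x
           then nini (x - t) * exp (- (LINT s:{0<..<t}|lebesgue. r (x - t + s) (I s)))
           else I (t - x) * exp (- (LINT s:{0<..<x}|lebesgue. r s (I (t - x + s)))))"
    using sol unfolding age_solution_def AE_lebesgue_on_Ioi by blast+
  \<comment> \<open>The birth rate is extended continuously to negative times.\<close>
  define J where "J s = I (max 0 s)" for s
  have "continuous_on UNIV J"
    unfolding J_def by (rule continuous_on_compose2[OF I_cont]) (auto intro!: continuous_intros)
  then have [measurable]: "J \<in> borel_measurable borel" by (rule borel_measurable_continuous_onI)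
  have J_bd: "J s \<in> {0..rM}" for s using I_bd[of "max 0 s"] by (simp add: J_def)
  have J_eq: "J s = I s" if "0 \<le> s" for s using that by (simp add: J_def)
  have "(\<lambda>x. indicator {0<..} x *\<^sub>R nini x) \<in> borel_measurable lebesgue"
    using nini_int unfolding set_integrable_def by (rule borel_measurable_integrable)
  from completion_ex_borel_measurable_real[OF this]
  obtain g where g [measurable]: "g \<in> borel_measurable borel" and g_eq:
      "AE x in lborel. indicator {0<..} x *\<^sub>R nini x = g x"
    by auto
  define u where "u y = (if 0 < y then max 0 (g y) else J (- y))" for y
  have u_meas [measurable]: "u \<in> borel_measurable borel" unfolding u_def by measurable
  have u_eq: "AE x in lborel. 0 < x \<longrightarrow> nini x = u x"
    using g_eq nini_nonneg unfolding AE_lebesgue_on_Ioi by eventually_elim (auto simp: u_def)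
  obtain N' where N': "N' \<in> null_sets lborel" and u_eq': "\<And>x. x \<notin> N' \<Longrightarrow> 0 < x \<longrightarrow> nini x = u x"
    using AE_lborel_null_set[OF u_eq] by metis
  have along_eq: "AE x in lborel. 0 < x \<longrightarrow> n t x = along u J (x - t) t" if t: "0 \<le> t" for t
    using n_char[OF t] AE_lborel_translate[OF N', of "-t"] AE_lborel_singleton[of t]
  proof eventually_elim
    case (elim x)
    show ?case
    proof
      assume x: "0 < x"
      show "n t x = along u J (x - t) t"
      proof (cases "t < x")
        case True
        have "(LINT s:{0<..<t}|lebesgue. r (x - t + s) (I s)) = (LBINT s:{0<..t}. \<rho> (x - t + s) (J s))"
        proof (rule set_lebesgue_integral_AE_borel(1))
          show "AE s in lborel. indicator {0<..<t} s * r (x - t + s) (I s)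
              = indicator {0<..t} s * \<rho> (x - t + s) (J s)"
            using AE_lborel_translate[OF N, of "x - t"] AE_lborel_singleton[of t]
          proof eventually_elim
            case (elim s)
            have "r (x - t + s) (I s) = \<rho> (x - t + s) (J s)" if "0 < s" "s < t"
              using r_eq[of "x - t + s" "I s"] I_bd[of s] elim True that by (simp add: J_eq)
            then show ?case using elim by (auto simp: indicator_def)
          qed
        qed auto
        moreover have "nini (x - t) = u (x - t)" using u_eq'[of "x - t"] elim True by simp
        ultimately show ?thesis using elim x True by (simp add: along_def)
      next
        case False
        then have xt: "x < t" using elim by simp
        have "(LINT s:{0<..<x}|lebesgue. r s (I (t - x + s))) = (LBINT s:{x - t<..x}. \<rho> s (J (t - x + s)))"
        proof (rule set_lebesgue_integral_AE_borel(1))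
          show "AE s in lborel. indicator {0<..<x} s * r s (I (t - x + s))
              = indicator {x - t<..x} s * \<rho> s (J (t - x + s))"
            using AE_not_in[OF N] AE_lborel_singleton[of x]
          proof eventually_elim
            case (elim s)
            show ?case
            proof (cases "0 < s \<and> s < x")
              case True
              then show ?thesis using r_eq[of s "I (t - x + s)"] I_bd[of "t - x + s"] elim xt by
                  (simp add: J_eq)
            next
              case False
              then show ?thesis using elim by (auto simp: indicator_def rate_nonpos_age)
            qed
          qed
        qed auto
        also have "\<dots> = (LBINT s:{(x - t) + 0<..(x - t) + t}. \<rho> s (J (t - x + s)))" by simp
        also have "\<dots> = (LBINT s:{0<..t}. \<rho> (x - t + s) (J s))" unfolding set_integral_Ioc_shift by simp
        finally show ?thesis using elim x xt by (simp add: along_def u_def J_eq)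
      qed
    qed
  qed
  have shift: "(LINT x:{0<..}|lebesgue. h x * n t x) = (LBINT y:{-t<..}. k (y + t) * along u J y t)"
    if t: "0 \<le> t" and [measurable]: "k \<in> borel_measurable borel" and hk: "AE x in lborel. 0 < x \<longrightarrow> h x = k x"
        for t h k
  proof -
    have "(LINT x:{0<..}|lebesgue. h x * n t x) = (LBINT x:{0<..}. k x * along u J (x - t) t)"
    proof (rule set_lebesgue_integral_AE_borel(1))
      show "AE x in lborel. indicator {0<..} x * (h x * n t x)
          = indicator {0<..} x * (k x * along u J (x - t) t)"
        using along_eq[OF t] hk by eventually_elim (auto simp: indicator_def)
    qed auto
    also have "\<dots> = (LBINT y:{-t<..}. k (y + t) * along u J y t)"
      using set_integral_Ioi_shift[of "\<lambda>y. k (y + t) * along u J y t" t] by simp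
    finally show ?thesis .
  qed
  have "solution u J"
    unfolding solution_def
  proof (intro conjI allI impI)
    show "0 \<le> u y" for y using J_bd[of "-y"] by (simp add: u_def)
    show "0 \<le> J s" "J s \<le> rM" for s using J_bd[of s] by auto
    show "u y = J (- y)" if "y \<le> 0" for y using that by (simp add: u_def)
    have "set_integrable lebesgue {0<..} nini \<longleftrightarrow> set_integrable lborel {0<..} u"
      by (rule set_lebesgue_integral_AE_borel(2))
          (use u_eq in \<open>auto elim!: eventually_mono simp: indicator_def\<close>)
    then show "set_integrable lborel {0<..} u" using nini_int by simp
    fix t :: real assume t: "0 \<le> t"
    show "(LBINT y:{-t<..}. along u J y t) = 1"
      using shift[OF t, of "\<lambda>_. 1" "\<lambda>_. 1"] n_mass[OF t] by simp
    have "AE x in lborel. 0 < x \<longrightarrow> r x (I t) = \<rho> x (J t)"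
      using AE_not_in[OF N] by eventually_elim (use r_eq I_bd[OF t] t in \<open>simp add: J_eq\<close>)
    then show "(LBINT y:{-t<..}. \<rho> (y + t) (J t) * along u J y t) = J t"
      using shift[OF t, of "\<lambda>x. \<rho> x (J t)" "\<lambda>x. r x (I t)"] n_births[OF t] t by (simp add: J_eq)
  qed (auto simp: u_meas)
  then show ?thesis using that[of u J] u_eq along_eq by blast
qed

text \<open>
  The integral is positive, since the integrand is at least \<open>exp (- rM)\<close> on \<open>(0,1]\<close>; so the inverse is a
  genuine one.
\<close>

lemma stationary_mass:
  assumes int: "set_integrable lborel {0<..} survival" and J: "J \<le> rM"
    and inv: "J = inverse (LBINT x:{0<..}. exp (- (LBINT s:{0<..x}. \<rho> s J)))"
  shows "(LBINT x:{0<..}. profile J x) = 1"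
proof -
  define E where "E x = exp (- (LBINT s:{0<..x}. \<rho> s J))" for x
  have ri: "set_integrable lborel {a<..b} (\<lambda>s. \<rho> s K)" for a b K using rate_Ioc_integrable[of "\<lambda>_. K" a b 0]
      by simp
  have meas [measurable]: "E \<in> borel_measurable borel"
    unfolding E_def[abs_def] by measurable
  have le: "E x \<le> survival x" for x
    unfolding E_def survival_def using set_integral_mono[OF ri ri, of 0 x rM J] J by (auto intro: rate_antimono)
  have Ei: "set_integrable lborel {0<..} E"
  proof (rule set_integrable_bound[OF int])
    show "set_borel_measurable lborel {0<..} E" unfolding set_borel_measurable_def by measurable
    show "AE x in lborel. x \<in> {0<..} \<longrightarrow> norm (E x) \<le> norm (survival x)"
      using le by (auto simp: E_def survival_def)
  qed
  have "exp (- rM) * (1 - 0) \<le> (LBINT x:{0<..1}. E x)"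
  proof (rule set_integral_Ioc_bounds(1)[where h = 1])
    fix x :: real assume x: "0 < x" "x \<le> 1"
    have "(LBINT s:{0<..x}. \<rho> s J) \<le> rM * (x - 0)"
      by (rule set_integral_Ioc_bounds(2)[where l = 0]) (use x in \<open>auto simp: rate_le rate_nonneg\<close>)
    also have "\<dots> \<le> rM" using x rM_pos by simp
    finally show "exp (- rM) \<le> E x" by (simp add: E_def)
    have "0 \<le> (LBINT s:{0<..x}. \<rho> s J)" by (rule set_integral_nonneg_real) (rule rate_nonneg)
    then show "E x \<le> 1" by (simp add: E_def)
  qed auto
  also have "(LBINT x:{0<..1}. E x) \<le> (LBINT x:{0<..}. E x)"
    by (rule set_integral_mono_set[OF Ei]) (auto simp: E_def)
  finally have "0 < (LBINT x:{0<..}. E x)" using less_le_trans[OF exp_gt_zero[of "- rM"]] by simp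
  moreover have "J = inverse (LBINT x:{0<..}. E x)" using inv by (simp add: E_def)
  ultimately have "J * (LBINT x:{0<..}. E x) = 1" by simp
  then show ?thesis by (simp add: profile_def E_def)
qed

end

theorem theorem2p4:
  fixes rM :: real
    and r dr dR :: "real \<Rightarrow> real \<Rightarrow> real"
    and nini nbar :: "real \<Rightarrow> real"
    and Ibar :: real
    and n :: "real \<Rightarrow> real \<Rightarrow> real"
    and I :: "real \<Rightarrow> real"
  assumes rM_pos: "0 < rM"
    and r_meas: "\<And>J. J \<in> {0..rM} \<Longrightarrow> (\<lambda>x. r x J) \<in> borel_measurable (lebesgue_on {0<..})"
    and r_bounds: "\<And>x J. 0 < x \<Longrightarrow> J \<in> {0..rM} \<Longrightarrow> 0 \<le> r x J \<and> r x J \<le> rM"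
    and dr: "is_partial_I rM r dr"
    and dr_Linf: "\<exists>C. AE p in lebesgue_on ({0<..} \<times> {0<..<rM}). \<bar>dr (fst p) (snd p)\<bar> \<le> C"
    and dr_nonpos: "AE p in lebesgue_on ({0<..} \<times> {0<..<rM}). dr (fst p) (snd p) \<le> 0"
    and exp_int: "set_integrable lebesgue {0<..} (\<lambda>x. exp (- cumulative_rate r x rM))"
    and dR: "is_partial_I rM (cumulative_rate r) dR"
    and dR_sup: "(SUP J\<in>{0<..<rM}. \<integral>\<^sup>+x\<in>{0<..}.
        ennreal (\<bar>dR x J\<bar> * exp (- cumulative_rate r x J)) \<partial>lebesgue) < \<infinity>"
    and stat: "stationary_state rM r nbar Ibar"
    and nini_int: "set_integrable lebesgue {0<..} nini"
    and nini_nonneg: "AE x in lebesgue_on {0<..}. 0 \<le> nini x"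
    and nini_mass: "(LINT x:{0<..}|lebesgue. nini x) = 1"
    and sol: "age_solution rM r nini n I"
  shows "(\<forall>r0>0. (\<forall>x>0. \<forall>J\<in>{0..rM}. r0 \<le> r x J) \<longrightarrow>
            (\<forall>t\<ge>0. L1_norm (\<lambda>x. n t x - nbar x)
                     \<le> exp (- r0 * t) * L1_norm (\<lambda>x. nini x - nbar x)))
       \<and> ((\<exists>xs\<in>interior (closure {x. 0 < x \<and> r x Ibar \<noteq> 0}). strict_antimono_on {0..rM} (r xs)) \<longrightarrow>
            ((\<lambda>t. L1_norm (\<lambda>x. n t x - nbar x)) \<longlongrightarrow> 0) at_top)"
proof -
  obtain C where C: "0 \<le> C" and reg: "AE x in lborel. 0 < x \<longrightarrow>
    (\<forall>J K. 0 \<le> J \<and> J \<le> K \<and> K \<le> rM \<longrightarrow> r x K \<le> r x J \<and> r x J - r x K \<le> C * (K - J))"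
    by (rule partial_bounds_imp_lipschitz_antimono[OF dr dr_Linf dr_nonpos])
  obtain \<rho> N where dec: "decreasing_rate rM C \<rho>" and N: "N \<in> null_sets lborel"
    and r_eq': "\<forall>x J. 0 < x \<longrightarrow> x \<notin> N \<longrightarrow> J \<in> {0..rM} \<longrightarrow> r x J = \<rho> x J"
    and r0_le: "\<forall>r0. (\<forall>x>0. \<forall>J\<in>{0..rM}. r0 \<le> r x J) \<longrightarrow> (\<forall>x>0. r0 \<le> \<rho> x rM)"
    by (rule borel_decreasing_rate[OF rM_pos C r_meas r_bounds reg])
  have r_eq: "r x J = \<rho> x J" if "0 < x" "x \<notin> N" "J \<in> {0..rM}" for x J using r_eq' that by blast
  interpret decreasing_rate rM C \<rho> by (rule dec)
  have cum: "cumulative_rate r x J = (LBINT s:{0<..x}. \<rho> s J)" if J: "J \<in> {0..rM}" for x J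
    unfolding cumulative_rate_def
  proof (rule set_lebesgue_integral_AE_borel(1))
    show "AE s in lborel. indicator {0<..<x} s * r s J = indicator {0<..x} s * \<rho> s J"
      using AE_not_in[OF N] AE_lborel_singleton[of x]
      by eventually_elim (auto simp: indicator_def r_eq[OF _ _ J])
  qed auto
  have int: "set_integrable lborel {0<..} survival"
    using exp_int set_lebesgue_integral_AE_borel(2)[of survival "{0<..}" "{0<..}"
        "\<lambda>x. exp (- cumulative_rate r x rM)"] rM_pos
    by (simp add: survival_def cum)
  have Ibar: "Ibar \<in> {0..rM}" "Ibar = inverse (LINT x:{0<..}|lebesgue. exp (- cumulative_rate r x Ibar))"
    and nbar: "\<And>x. 0 < x \<Longrightarrow> nbar x = profile Ibar x"
    using stat by (auto simp: stationary_state_def profile_def cum)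
  have "(LINT x:{0<..}|lebesgue. exp (- cumulative_rate r x Ibar))
      = (LBINT x:{0<..}. exp (- (LBINT s:{0<..x}. \<rho> s Ibar)))"
    unfolding cum[OF Ibar(1)]
  proof (rule set_lebesgue_integral_AE_borel(1))
    show "(\<lambda>x. exp (- (LBINT s:{0<..x}. \<rho> s Ibar))) \<in> borel_measurable borel" by measurable
  qed auto
  then have mass: "(LBINT x:{0<..}. profile Ibar x) = 1"
    using stationary_mass[OF int] Ibar by auto
  have sol2: "solution (profile Ibar) (\<lambda>_. Ibar)"
    by (rule stationary_solution[OF int _ _ mass]) (use Ibar(1) in auto)
  obtain u J where sol1: "solution u J" and u_eq: "AE x in lborel. 0 < x \<longrightarrow> nini x = u x"
    and n_eq: "\<forall>t\<ge>0. AE x in lborel. 0 < x \<longrightarrow> n t x = along u J (x - t) t"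
    by (rule age_solution_along_characteristics[OF N r_eq nini_int nini_nonneg sol])
  \<comment> \<open>Both claims concern the excess of the solution against the stationary state.\<close>
  interpret two_solutions rM C \<rho> u J "profile Ibar" "\<lambda>_. Ibar" by unfold_locales (fact sol1 sol2)+
  have L1: "L1_norm (\<lambda>x. h x - nbar x) = 2 * excess t"
    if t: "0 \<le> t" and h: "AE x in lborel. 0 < x \<longrightarrow> h x = w1 (x - t) t" for h t
  proof -
    have "L1_norm (\<lambda>x. h x - nbar x) = (LBINT x:{0<..}. \<bar>w1 (x - t) t - w2 (x - t) t\<bar>)"
      unfolding L1_norm_def
    proof (rule set_lebesgue_integral_AE_borel(1))
      show "AE x in lborel. indicator {0<..} x * \<bar>h x - nbar x\<bar>
          = indicator {0<..} x * \<bar>w1 (x - t) t - w2 (x - t) t\<bar>"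
        using h by eventually_elim (auto simp: indicator_def nbar along_profile[OF t])
    qed auto
    also have "\<dots> = (LBINT y:{-t<..}. \<bar>w1 y t - w2 y t\<bar>)"
      by (rule set_integral_Ioi_shift[of "\<lambda>y. \<bar>w1 y t - w2 y t\<bar>" t])
    finally show ?thesis using L1_distance_eq[OF t] by simp
  qed
  have L1_t: "L1_norm (\<lambda>x. n t x - nbar x) = 2 * excess t" if "0 \<le> t" for t
    by (rule L1[OF that]) (use n_eq that in blast)
  have L1_0: "L1_norm (\<lambda>x. nini x - nbar x) = 2 * excess 0"
    by (rule L1) (use u_eq in \<open>auto simp: along_def set_lebesgue_integral_def\<close>)
  show ?thesis
  proof (intro conjI impI allI)
    fix r0 t :: real
    assume "0 < r0" "\<forall>x>0. \<forall>J\<in>{0..rM}. r0 \<le> r x J" "0 \<le> t"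
    then have "excess t \<le> exp (- r0 * t) * excess 0" using r0_le by (intro excess_exponential_decay) auto
    then show "L1_norm (\<lambda>x. n t x - nbar x) \<le> exp (- r0 * t) * L1_norm (\<lambda>x. nini x - nbar x)"
      using L1_t[OF \<open>0 \<le> t\<close>] L1_0 by simp
  next
    have "((\<lambda>t. 2 * excess t) \<longlongrightarrow> 2 * 0) at_top" by (intro tendsto_intros excess_tendsto_0[OF int])
    then have "((\<lambda>t. 2 * excess t) \<longlongrightarrow> 0) at_top" by simp
    then show "((\<lambda>t. L1_norm (\<lambda>x. n t x - nbar x)) \<longlongrightarrow> 0) at_top"
      by (rule Lim_transform_eventually)
          (use L1_t in \<open>auto intro!: eventually_mono[OF eventually_ge_at_top[of 0]]\<close>)
  qed
qed

end
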